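(* Let $\mu$ be a non-negative Radon measure on $\mathbb{R}$ satisfying the Brinck condition, let $\mathbf{H}_\mu$ be the operator generated by the form $\mathbf{a}_\mu$, and let $\Lambda=\inf\sigma_{ess}(\mathbf{H}_\mu)$. Set $$Q_1=\limsup_{x\to\pm\infty}q^*_2(x),\qquad Q_2=\liminf_{x\to\pm\infty}q^*_\alpha(x),\qquad \alpha=\left(\pi^2+\tfrac34\right)^{-1}.$$ Then $$-4Q_1\ \le\ \Lambda\ \le\ -\frac14\,Q_2 .$$
   Context: $\Delta_x(d)=[x-\frac d2,x+\frac d2]$. A Radon measure here is a positive Borel measure on $\mathbb{R}$, finite on compact sets (and regular). The Brinck condition: there is $C>0$ with $\mu([x,x+1])<C$ for all $x\in\mathbb{R}$. For $\alpha>0$ the Otelbaev function of $\mu$ is $$q^*_\alpha(x)=\inf\left\{\tfrac1{d^2}:\ d>0,\ \mu(\Delta_x(d))<\tfrac1{\alpha d}\right\}.$$ The notation $x\to\pm\infty$ in $\limsup$ and $\liminf$ means $|x|\to\infty$. The form is $\mathbf{a}_\mu(f,g)=\int_{\mathbb{R}}f'\overline{g'}\,dx-\int_{\mathbb{R}}f\overline{g}\,d\mu$ on $\{f\in H^1(\mathbb{R}):\int|f|^2d\mu<\infty\}$; under the Brinck condition it is densely defined, symmetric, lower semibounded and closed in $L^2(\mathbb{R})$, and $\mathbf{H}_\mu$ is the self-adjoint operator associated with it. $\sigma_{ess}$ is the essential spectrum. Discreteness of the negative spectrum is not assumed. *)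

theory Defs
  imports "HOL-Analysis.Analysis"
begin

subsection \<open>Radon measures, the Brinck condition, the Otelbaev function\<close>

definition radon_measure :: "real measure \<Rightarrow> bool" where
  "radon_measure \<mu> \<longleftrightarrow>
     sets \<mu> = sets borel \<and>
     (\<forall>K. compact K \<longrightarrow> emeasure \<mu> K < \<infinity>) \<and>
     (\<forall>A \<in> sets borel. emeasure \<mu> A = (INF U \<in> {U. open U \<and> A \<subseteq> U}. emeasure \<mu> U)) \<and>
     (\<forall>A \<in> sets borel. emeasure \<mu> A = (SUP K \<in> {K. compact K \<and> K \<subseteq> A}. emeasure \<mu> K))"

definition brinck :: "real measure \<Rightarrow> bool" where
  "brinck \<mu> \<longleftrightarrow> (\<exists>C>0. \<forall>x. emeasure \<mu> {x..x + 1} < ennreal C)"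

definition otelbaev :: "real measure \<Rightarrow> real \<Rightarrow> real \<Rightarrow> ereal" where
  "otelbaev \<mu> \<alpha> x =
     Inf {ereal (1 / d\<^sup>2) | d. d > 0 \<and> emeasure \<mu> {x - d / 2..x + d / 2} < ennreal (1 / (\<alpha> * d))}"


subsection \<open>The Hilbert space \<open>L\<^sup>2(\<real>)\<close>\<close>

text \<open>
  Elements of \<open>L\<^sup>2(\<real>)\<close> are represented by square integrable complex functions;
  equality in \<open>L\<^sup>2(\<real>)\<close> is equality almost everywhere.
\<close>

definition L2 :: "(real \<Rightarrow> complex) set" where
  "L2 = {f. f \<in> borel_measurable lborel \<and> integrable lborel (\<lambda>x. (cmod (f x))\<^sup>2)}"

definition L2_inner :: "(real \<Rightarrow> complex) \<Rightarrow> (real \<Rightarrow> complex) \<Rightarrow> complex" where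
  "L2_inner f g = (LINT x|lborel. f x * cnj (g x))"

definition L2_norm :: "(real \<Rightarrow> complex) \<Rightarrow> real" where
  "L2_norm f = sqrt (LINT x|lborel. (cmod (f x))\<^sup>2)"


subsection \<open>Spectra of operators in \<open>L\<^sup>2(\<real>)\<close>\<close>

text \<open>
  An operator is given by its graph, a set of pairs of representatives: \<open>(u, w) \<in> T\<close> means that
  \<open>u\<close> is in the domain of \<open>T\<close> and that \<open>w\<close> represents \<open>T u\<close>. The notions below do not depend on
  the choice of representatives.
\<close>

type_synonym L2_operator = "((real \<Rightarrow> complex) \<times> (real \<Rightarrow> complex)) set"

text \<open>
  \<open>T - z\<close> is a bijection from the domain of \<open>T\<close> onto \<open>L\<^sup>2(\<real>)\<close> with bounded inverse; the norm
  estimate contains the injectivity.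
\<close>

definition resolvent_set :: "L2_operator \<Rightarrow> complex set" where
  "resolvent_set T =
     {z. (\<forall>f \<in> L2. \<exists>(u, w) \<in> T. AE x in lborel. w x - z * u x = f x) \<and>
         (\<exists>c. \<forall>(u, w) \<in> T. L2_norm u \<le> c * L2_norm (\<lambda>x. w x - z * u x))}"

definition spectrum :: "L2_operator \<Rightarrow> complex set" where
  "spectrum T = - resolvent_set T"

definition eigenspace :: "L2_operator \<Rightarrow> complex \<Rightarrow> (real \<Rightarrow> complex) set" where
  "eigenspace T z = {u. \<exists>w. (u, w) \<in> T \<and> (AE x in lborel. w x = z * u x)}"

definition eigenvalue :: "L2_operator \<Rightarrow> complex \<Rightarrow> bool" where
  "eigenvalue T z \<longleftrightarrow> (\<exists>u \<in> eigenspace T z. \<not> (AE x in lborel. u x = 0))"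

definition finite_multiplicity :: "L2_operator \<Rightarrow> complex \<Rightarrow> bool" where
  "finite_multiplicity T z \<longleftrightarrow>
     (\<exists>B. finite B \<and> B \<subseteq> L2 \<and>
        (\<forall>u \<in> eigenspace T z. \<exists>c. AE x in lborel. u x = (\<Sum>b\<in>B. c b * b x)))"

definition discrete_spectrum :: "L2_operator \<Rightarrow> complex set" where
  "discrete_spectrum T =
     {z \<in> spectrum T. \<not> z islimpt spectrum T \<and> eigenvalue T z \<and> finite_multiplicity T z}"

text \<open>The essential spectrum of a self-adjoint operator.\<close>

definition essential_spectrum :: "L2_operator \<Rightarrow> complex set" where
  "essential_spectrum T = spectrum T - discrete_spectrum T"


subsection \<open>The Sobolev space \<open>H\<^sup>1(\<real>)\<close>\<close>

definition test_function :: "(real \<Rightarrow> real) \<Rightarrow> bool" where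
  "test_function \<phi> \<longleftrightarrow> \<phi> C1_differentiable_on UNIV \<and> compact (closure {x. \<phi> x \<noteq> 0})"

definition has_weak_deriv :: "(real \<Rightarrow> complex) \<Rightarrow> (real \<Rightarrow> complex) \<Rightarrow> bool" where
  "has_weak_deriv f g \<longleftrightarrow>
     (\<forall>\<phi>. test_function \<phi> \<longrightarrow>
        (LINT x|lborel. f x * of_real (deriv \<phi> x)) = - (LINT x|lborel. g x * of_real (\<phi> x)))"

text \<open>
  Every class in \<open>H\<^sup>1(\<real>)\<close> has exactly one continuous representative. The elements of \<open>H1\<close> are
  these representatives: the measure \<open>\<mu>\<close> in the form below need not be absolutely continuous
  (it may have atoms), so integrals against \<open>\<mu>\<close> make sense only for them.
\<close>

definition H1 :: "(real \<Rightarrow> complex) set" where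
  "H1 = {f \<in> L2. continuous_on UNIV f \<and> (\<exists>g \<in> L2. has_weak_deriv f g)}"

definition weak_deriv :: "(real \<Rightarrow> complex) \<Rightarrow> (real \<Rightarrow> complex)" where
  "weak_deriv f = (SOME g. g \<in> L2 \<and> has_weak_deriv f g)"


subsection \<open>The form \<open>a\<^sub>\<mu>\<close> and the operator \<open>H\<^sub>\<mu>\<close>\<close>

definition form_domain :: "real measure \<Rightarrow> (real \<Rightarrow> complex) set" where
  "form_domain \<mu> = {f \<in> H1. integrable \<mu> (\<lambda>x. (cmod (f x))\<^sup>2)}"

definition form_a :: "real measure \<Rightarrow> (real \<Rightarrow> complex) \<Rightarrow> (real \<Rightarrow> complex) \<Rightarrow> complex" where
  "form_a \<mu> f g = L2_inner (weak_deriv f) (weak_deriv g) - (LINT x|\<mu>. f x * cnj (g x))"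

text \<open>
  The operator associated with a densely defined, symmetric, lower semibounded, closed form
  \<open>a\<close> with domain \<open>D\<close> by the first representation theorem: \<open>u\<close> is in its domain and is mapped to \<open>w\<close>
  iff \<open>a u v = \<langle>w, v\<rangle>\<close> for all \<open>v \<in> D\<close>.
\<close>

definition form_operator ::
    "(real \<Rightarrow> complex) set \<Rightarrow> ((real \<Rightarrow> complex) \<Rightarrow> (real \<Rightarrow> complex) \<Rightarrow> complex) \<Rightarrow> L2_operator" where
  "form_operator D a = {(u, w). u \<in> D \<and> w \<in> L2 \<and> (\<forall>v \<in> D. a u v = L2_inner w v)}"

definition H_op :: "real measure \<Rightarrow> L2_operator" where
  "H_op \<mu> = form_operator (form_domain \<mu>) (form_a \<mu>)"

text \<open>
  \<open>inf \<sigma>\<^sub>e\<^sub>s\<^sub>s\<close>: the spectrum of a self-adjoint operator is real, so taking real parts only changes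
  the type.
\<close>

definition inf_ess :: "L2_operator \<Rightarrow> ereal" where
  "inf_ess T = (INF z \<in> essential_spectrum T. ereal (Re z))"

end

theory Submission
  imports Defs
begin

text \<open>
  Both bounds come from the variational description of the bottom of the essential spectrum. If the
  form is bounded below by \<open>a\<close> up to a finite rank term, then every sequence of approximate
  eigenvectors below \<open>a\<close> has a convergent subsequence, so the spectrum below \<open>a\<close> consists of
  isolated eigenvalues of finite multiplicity. If the form is at most \<open>a\<close> on unit vectors
  orthogonal to any given finite set, then a Weyl sequence for the resolvent yields a point of the
  essential spectrum in \<open>]-\<infinity>, a]\<close>.

  For the lower bound the line is cut into intervals of length \<open>d\<close> with \<open>1 / d\<^sup>2\<close> above \<open>Q\<^sub>1\<close>. Far out
  each of them has measure at most \<open>1 / (2 * d)\<close>, and a Sobolev inequality on the interval bounds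
  the form below by \<open>- 1 / d\<^sup>2\<close>; a bounded set contributes a finite rank term only. For the upper
  bound one tests the form with plateau functions on far apart intervals of length \<open>d\<close>, where
  \<open>1 / d\<^sup>2\<close> is below \<open>Q\<^sub>2\<close>.
\<close>

subsection \<open>Hilbert space preliminaries\<close>

text \<open>Regularity and isolation of spectral points are decided by norm estimates on the graph
  of the operator, which is accessible through its symmetry and one everywhere defined resolvent.
  The measure may have atoms, so every comparison of \<open>\<mu>\<close> with Lebesgue measure
  passes through a bound for the supremum of a continuous function on an interval. The intervals
  that tile the line are half-open, since an atom at a shared endpoint would otherwise be counted
  twice; the closed intervals in \<open>otelbaev\<close> still dominate them. On an interval of
  length \<open>d\<close> the supremum of \<open>|f|^2\<close> is at most \<open>2 * d\<close> times
  the integral of \<open>|f'|^2\<close> plus \<open>2 / d\<close> times that of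
  \<open>|f|^2\<close>. A mass of \<open>1 / (2 * d)\<close>, the threshold for index 2, turns these
  coefficients into exactly 1 and \<open>1 / d\<^sup>2\<close>, which stays well within the factor 4
  of the lower bound. For the upper bound, \<open>1 / \<alpha>\<close> is large enough that the mass
  on a plateau outweighs the energy of its two ramps.\<close>

lemma linear_coefficient_zero:
  fixes p q :: real
  assumes "\<And>t. 0 \<le> 2 * t * p + t\<^sup>2 * q"
  shows "p = 0"
proof (rule ccontr)
  assume p: "p \<noteq> 0"
  \<comment> \<open>Any positive \<open>k\<close> above \<open>q\<close> works: the value at
    \<open>t = - p / k\<close> has the sign of \<open>q - 2 * k\<close>.\<close>
  define k where "k = \<bar>q\<bar> + 1"
  have k: "k > 0" "q < k" by (auto simp: k_def)
  have "0 \<le> 2 * (- p / k) * p + (- p / k)\<^sup>2 * q" using assms by blast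
  also have "\<dots> = p\<^sup>2 * (q - 2 * k) / k\<^sup>2"
    using k by (simp add: field_simps power2_eq_square)
  also have "\<dots> < 0"
    using k p by (auto simp: divide_less_0_iff mult_less_0_iff)
  finally show False by simp
qed

text \<open>The carrier is a subspace of a larger type because the same facts are applied to the
  inner product on a closed subspace, to the shifted form on the graph of weak differentiation, and
  to a shifted bounded operator on the complement of a finite set.\<close>

locale psd_form =
  fixes G :: "'h::real_vector set" and b :: "'h \<Rightarrow> 'h \<Rightarrow> real"
  assumes subspace: "subspace G"
    and add: "\<And>x y z. x \<in> G \<Longrightarrow> y \<in> G \<Longrightarrow> z \<in> G \<Longrightarrow> b (x + y) z = b x z + b y z"
    and scale: "\<And>r x y. x \<in> G \<Longrightarrow> y \<in> G \<Longrightarrow> b (r *\<^sub>R x) y = r * b x y"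
    and sym: "\<And>x y. x \<in> G \<Longrightarrow> y \<in> G \<Longrightarrow> b x y = b y x"
    and nonneg: "\<And>x. x \<in> G \<Longrightarrow> 0 \<le> b x x"
begin

lemma add_right: "x \<in> G \<Longrightarrow> y \<in> G \<Longrightarrow> z \<in> G \<Longrightarrow> b z (x + y) = b z x + b z y"
  by (metis add subspace_add[OF subspace] sym)

lemma scale_right: "x \<in> G \<Longrightarrow> y \<in> G \<Longrightarrow> b y (r *\<^sub>R x) = r * b y x"
  by (metis scale subspace_scale[OF subspace] sym)

lemma expand:
  assumes "x \<in> G" "y \<in> G"
  shows "b (x + t *\<^sub>R y) (x + t *\<^sub>R y) = b x x + 2 * t * b x y + t\<^sup>2 * b y y"
proof -
  have "t *\<^sub>R y \<in> G" using assms subspace by (simp add: subspace_scale)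
  then show ?thesis
    using assms sym[OF assms]
    by (simp add: add add_right scale scale_right subspace_add[OF subspace] power2_eq_square algebra_simps)
qed

lemma cauchy_schwarz:
  assumes "x \<in> G" "y \<in> G"
  shows "(b x y)\<^sup>2 \<le> b x x * b y y"
proof -
  have ex: "0 \<le> b x x + 2 * t * b x y + t\<^sup>2 * b y y" for t
    using expand[OF assms, of t] nonneg assms subspace
    by (metis subspace_add subspace_scale)
  show ?thesis
  \<comment> \<open>In the degenerate case the parabola is affine in \<open>t\<close> and stays
    nonnegative only if its slope vanishes; otherwise it is evaluated at its minimum.\<close>
  proof (cases "b y y = 0")
    case True
    have "b x y = 0"
    proof (rule ccontr)
      assume "b x y \<noteq> 0"
      then have "b x x + 2 * (- (b x x + 1) / (2 * b x y)) * b x y = -1" by (simp add: field_simps)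
      then show False using ex[of "- (b x x + 1) / (2 * b x y)"] True by simp
    qed
    then show ?thesis using True by simp
  next
    case False
    then have pos: "b y y > 0" using nonneg[OF assms(2)] by simp
    have "0 \<le> b y y * (b x x + 2 * (- b x y / b y y) * b x y + (- b x y / b y y)\<^sup>2 * b y y)"
      using ex[of "- b x y / b y y"] pos by simp
    also have "\<dots> = b x x * b y y - (b x y)\<^sup>2"
      using pos by (simp add: field_simps power2_eq_square)
    finally show ?thesis by simp
  qed
qed

end

text \<open>The solution minimises \<open>b x x - 2 l x\<close>: minimising sequences are Cauchy by the parallelogram law.\<close>

lemma riesz_form:
  fixes G :: "'h::{real_inner,complete_space} set"
  assumes form: "psd_form G b" and "closed G"
    and k: "k > 0" "\<And>x. x \<in> G \<Longrightarrow> k * (norm x)\<^sup>2 \<le> b x x"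
    and K: "\<And>x. x \<in> G \<Longrightarrow> b x x \<le> K * (norm x)\<^sup>2"
    and l: "bounded_linear l"
  shows "\<exists>x\<in>G. \<forall>y\<in>G. b x y = l y"
proof -
  interpret psd_form G b by (rule form)
  interpret l: bounded_linear l by (rule l)
  define Q where "Q x = b x x - 2 * l x" for x
  obtain L where L: "L > 0" "\<And>x. norm (l x) \<le> norm x * L" using l.pos_bounded by auto
  have lower: "- (L\<^sup>2 / k) \<le> Q x" if "x \<in> G" for x
  proof -
    have "0 \<le> (k * norm x - L)\<^sup>2 / k" using k(1) by simp
    also have "\<dots> = k * (norm x)\<^sup>2 - 2 * (norm x * L) + L\<^sup>2 / k"
      using k(1) by (simp add: field_simps power2_eq_square)
    also have "\<dots> \<le> Q x + L\<^sup>2 / k"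
      using k(2)[OF that] L(2)[of x] unfolding Q_def by (simp add: abs_le_iff)
    finally show ?thesis by simp
  qed
  define m where "m = Inf (Q ` G)"
  have bdd: "bdd_below (Q ` G)" using lower by (auto intro!: bdd_belowI)
  have G0: "0 \<in> G" using subspace by (simp add: subspace_0)
  have m: "m \<le> Q x" if "x \<in> G" for x
    unfolding m_def using bdd that by (simp add: cInf_lower)
  have "\<exists>x\<in>G. Q x < m + 1 / real (Suc n)" for n
  proof -
    have "Inf (Q ` G) < m + 1 / real (Suc n)" by (simp add: m_def)
    then show ?thesis using cInf_lessD[of "Q ` G"] G0 by blast
  qed
  then obtain x where x: "\<And>n. x n \<in> G" "\<And>n. Q (x n) < m + 1 / real (Suc n)" by metis
  have diff: "k * (norm (x i - x j))\<^sup>2 \<le> 2 / real (Suc i) + 2 / real (Suc j)" for i j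
  proof -
    define z where "z = (1/2) *\<^sub>R (x i + x j)"
    have z: "z \<in> G" "x i + x j \<in> G" "x i - x j \<in> G"
      using x subspace by (auto simp: z_def intro: subspace_add subspace_scale subspace_diff)
    have 1: "b (x i - x j) (x i - x j) = b (x i) (x i) - 2 * b (x i) (x j) + b (x j) (x j)"
      using expand[OF x(1) x(1), of i "-1" j] by simp
    have 2: "b (x i + x j) (x i + x j) = b (x i) (x i) + 2 * b (x i) (x j) + b (x j) (x j)"
      using expand[OF x(1) x(1), of i 1 j] by simp
    have 3: "b z z = b (x i + x j) (x i + x j) / 4"
      unfolding z_def using z(2) by (simp add: scale scale_right subspace_scale[OF subspace])
    have "k * (norm (x i - x j))\<^sup>2 \<le> b (x i - x j) (x i - x j)" using k z by blast
    also have "\<dots> = 2 * Q (x i) + 2 * Q (x j) - 4 * Q z"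
      unfolding Q_def 1 3 2 by (simp add: z_def l.add l.scaleR field_simps)
    also have "\<dots> \<le> 2 / real (Suc i) + 2 / real (Suc j)"
    proof -
      define p q where "p = 1 / real (Suc i)" and "q = 1 / real (Suc j)"
      have "Q (x i) < m + p" "Q (x j) < m + q" "m \<le> Q z" using x(2) m[OF z(1)] by (auto simp: p_def q_def)
      then have "2 * Q (x i) + 2 * Q (x j) - 4 * Q z \<le> 2 * p + 2 * q" by linarith
      then show ?thesis by (simp add: p_def q_def)
    qed
    finally show ?thesis .
  qed
  have "Cauchy x"
  proof (rule CauchyI)
    fix e :: real assume e: "e > 0"
    obtain N where N: "4 / (k * e\<^sup>2) < real (Suc N)"
      by (meson less_Suc_eq of_nat_less_iff order_less_trans reals_Archimedean2)
    have "norm (x i - x j) < e" if "i \<ge> N" "j \<ge> N" for i j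
    proof -
      have "2 / real (Suc i) \<le> 2 / real (Suc N)" "2 / real (Suc j) \<le> 2 / real (Suc N)"
        using that by (auto intro!: divide_left_mono)
      then have "k * (norm (x i - x j))\<^sup>2 \<le> 4 / real (Suc N)" using diff[of i j] by simp
      also have "\<dots> < k * e\<^sup>2" using N e k by (simp add: field_simps)
      finally have "(norm (x i - x j))\<^sup>2 < e\<^sup>2" using k by simp
      then show ?thesis using e by (simp add: power_less_imp_less_base)
    qed
    then show "\<exists>M. \<forall>m\<ge>M. \<forall>n\<ge>M. norm (x m - x n) < e" by blast
  qed
  then obtain a where a: "x \<longlonglongrightarrow> a" using Cauchy_convergent_iff convergent_def by blast
  have aG: "a \<in> G" using closed_sequentially[OF \<open>closed G\<close>] x a by blast
  have lim: "(\<lambda>n. b (x n) y) \<longlonglongrightarrow> b a y" if y: "y \<in> G" for y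
  proof -
    \<comment> \<open>Continuity of \<open>b\<close> in its first argument comes from Cauchy-Schwarz
      together with the upper bound \<open>K\<close>.\<close>
    have bound: "(b (x n - a) y)\<^sup>2 \<le> K * (norm (x n - a))\<^sup>2 * b y y" for n
    proof -
      have "x n - a \<in> G" using x aG subspace by (simp add: subspace_diff)
      then have "(b (x n - a) y)\<^sup>2 \<le> b (x n - a) (x n - a) * b y y" using cauchy_schwarz y by blast
      also have "\<dots> \<le> K * (norm (x n - a))\<^sup>2 * b y y"
        using K[OF \<open>x n - a \<in> G\<close>] nonneg[OF y] by (intro mult_right_mono) auto
      finally show ?thesis .
    qed
    have "(\<lambda>n. x n - a) \<longlonglongrightarrow> 0" using a by (simp add: LIM_zero)
    then have "(\<lambda>n. K * (norm (x n - a))\<^sup>2 * b y y) \<longlonglongrightarrow> K * (norm (0::'h))\<^sup>2 * b y y"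
      by (intro tendsto_intros)
    then have "(\<lambda>n. K * (norm (x n - a))\<^sup>2 * b y y) \<longlonglongrightarrow> 0" by simp
    then have "(\<lambda>n. (b (x n - a) y)\<^sup>2) \<longlonglongrightarrow> 0"
      by (rule Lim_null_comparison[OF always_eventually, rotated]) (use bound in simp)
    then have "(\<lambda>n. sqrt ((b (x n - a) y)\<^sup>2)) \<longlonglongrightarrow> sqrt 0" by (intro tendsto_intros)
    then have "(\<lambda>n. b (x n - a) y) \<longlonglongrightarrow> 0" by (simp add: tendsto_rabs_zero_iff)
    moreover have "b (x n - a) y = b (x n) y - b a y" for n
      using add[of "x n - a" a y] x aG y subspace by (simp add: subspace_diff)
    ultimately show ?thesis by (simp add: LIM_zero_iff)
  qed
  have "b a y = l y" if y: "y \<in> G" for y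
  proof -
    have "0 \<le> 2 * t * (b a y - l y) + t\<^sup>2 * b y y" for t
    proof -
      \<comment> \<open>The comparison is made at the near-minimiser \<open>x n\<close>, whose value
        exceeds \<open>m\<close> by less than \<open>1 / Suc n\<close>; only the linear term then
        has to pass to the limit.\<close>
      have "0 \<le> 2 * t * (b (x n) y - l y) + t\<^sup>2 * b y y + 1 / real (Suc n)" for n
      proof -
        have "x n + t *\<^sub>R y \<in> G" using x y subspace by (simp add: subspace_add subspace_scale)
        then have "m \<le> Q (x n + t *\<^sub>R y)" by (rule m)
        also have "\<dots> = Q (x n) + 2 * t * (b (x n) y - l y) + t\<^sup>2 * b y y"
          unfolding Q_def expand[OF x(1) y] by (simp add: l.add l.scaleR algebra_simps)
        finally show ?thesis using x(2)[of n] by linarith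
      qed
      moreover have "(\<lambda>n. 2 * t * (b (x n) y - l y) + t\<^sup>2 * b y y + 1 / real (Suc n))
          \<longlonglongrightarrow> 2 * t * (b a y - l y) + t\<^sup>2 * b y y + 0"
        by (intro tendsto_intros lim[OF y] LIMSEQ_Suc[OF lim_1_over_n])
      ultimately show ?thesis using LIMSEQ_le_const by fastforce
    qed
    then have "b a y - l y = 0" by (rule linear_coefficient_zero)
    then show ?thesis by simp
  qed
  then show ?thesis using aG by blast
qed

lemma orthogonal_projection_exists:
  fixes G :: "'h::{real_inner,complete_space} set"
  assumes "subspace G" "closed G"
  shows "\<exists>p\<in>G. \<forall>y\<in>G. (w - p) \<bullet> y = 0"
proof -
  have "psd_form G inner"
    unfolding psd_form_def using assms(1) inner_commute by (auto simp: inner_add_left)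
  then have "\<exists>p\<in>G. \<forall>y\<in>G. p \<bullet> y = w \<bullet> y"
    using assms by (intro riesz_form[where k = 1 and K = 1])
      (auto simp: power2_norm_eq_inner intro: bounded_linear_inner_right)
  then show ?thesis by (metis inner_diff_left right_minus_eq)
qed

text \<open>Functionals that separate the points of \<open>E\<close> bound its dimension: each
  \<open>f\<close> either vanishes on \<open>E\<close> or splits off one vector \<open>e\<close>,
  leaving the kernel of \<open>f\<close> for the induction. This is how a finite rank term yields
  finite multiplicity.\<close>

lemma finite_span_of_separation:
  fixes E :: "'h::real_inner set"
  assumes "finite F" "subspace E" "\<And>u. u \<in> E \<Longrightarrow> (\<forall>f\<in>F. u \<bullet> f = 0) \<Longrightarrow> u = 0"
  shows "\<exists>B. finite B \<and> E \<subseteq> span B"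
  using assms
proof (induction F arbitrary: E rule: finite_induct)
  case empty
  then have "E \<subseteq> span {}" by auto
  then show ?case by blast
next
  case (insert f F)
  define E' where "E' = {u \<in> E. u \<bullet> f = 0}"
  have sub: "subspace E'"
    using insert.prems(1) unfolding E'_def subspace_def by (auto simp: inner_add_left)
  have "\<exists>B. finite B \<and> E' \<subseteq> span B"
    by (rule insert.IH[OF sub]) (use insert.prems(2) in \<open>auto simp: E'_def\<close>)
  then obtain B where B: "finite B" "E' \<subseteq> span B" by blast
  show ?case
  proof (cases "\<exists>e\<in>E. e \<bullet> f \<noteq> 0")
    case False
    then show ?thesis using B by (auto simp: E'_def)
  next
    case True
    then obtain e where e: "e \<in> E" "e \<bullet> f \<noteq> 0" by blast
    have "u \<in> span (insert e B)" if "u \<in> E" for u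
    proof -
      have "u - (u \<bullet> f / (e \<bullet> f)) *\<^sub>R e \<in> E'"
        using that e insert.prems(1)
        by (auto simp: E'_def subspace_diff subspace_scale inner_diff_left)
      then have "u - (u \<bullet> f / (e \<bullet> f)) *\<^sub>R e \<in> span B" using B by blast
      then show ?thesis by (auto simp: span_insert)
    qed
    then show ?thesis using B(1) by (intro exI[of _ "insert e B"]) auto
  qed
qed

text \<open>More vectors than linear conditions. Gaussian elimination with a pivot
  \<open>e k\<close> discards one condition and one index at a time. Nontriviality concerns the
  coefficients only, as the \<open>e i\<close> may be dependent.\<close>

lemma orthogonal_combination:
  fixes e :: "'i \<Rightarrow> 'h::real_inner"
  assumes "finite B" "finite I" "card B < card I"
  shows "\<exists>c. (\<exists>i\<in>I. c i \<noteq> 0) \<and> (\<forall>b\<in>B. (\<Sum>i\<in>I. c i *\<^sub>R e i) \<bullet> b = 0)"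
  using assms
proof (induction B arbitrary: I e rule: finite_induct)
  case empty
  then have "I \<noteq> {}" by auto
  then show ?case by (intro exI[of _ "\<lambda>_. 1"]) auto
next
  case (insert b B)
  show ?case
  proof (cases "\<exists>k\<in>I. e k \<bullet> b \<noteq> 0")
    case False
    have "card B < card I" using insert by simp
    then obtain c where "\<exists>i\<in>I. c i \<noteq> 0" "\<forall>b\<in>B. (\<Sum>i\<in>I. c i *\<^sub>R e i) \<bullet> b = 0"
      using insert.IH[OF insert.prems(1)] by blast
    then show ?thesis using False by (intro exI[of _ c]) (auto simp: inner_sum_left)
  next
    case True
    then obtain k where k: "k \<in> I" "e k \<bullet> b \<noteq> 0" by blast
    define q where "q i = e i \<bullet> b / (e k \<bullet> b)" for i
    define e' where "e' i = e i - q i *\<^sub>R e k" for i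
    have "card B < card (I - {k})" using insert k by simp
    then obtain c where c: "\<exists>i\<in>I - {k}. c i \<noteq> 0" "\<forall>b\<in>B. (\<Sum>i\<in>I - {k}. c i *\<^sub>R e' i) \<bullet> b = 0"
      using insert.IH[of "I - {k}" e'] insert.prems(1) by blast
    \<comment> \<open>The coefficient at the pivot collects what the vectors \<open>e'\<close>
      subtract, so that both combinations agree.\<close>
    define d where "d = c(k := - (\<Sum>i\<in>I - {k}. c i * q i))"
    have eq: "(\<Sum>i\<in>I. d i *\<^sub>R e i) = (\<Sum>i\<in>I - {k}. c i *\<^sub>R e' i)"
    proof -
      have "(\<Sum>i\<in>I. d i *\<^sub>R e i) = d k *\<^sub>R e k + (\<Sum>i\<in>I - {k}. d i *\<^sub>R e i)"
        using k insert.prems(1) by (simp add: sum.remove)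
      also have "(\<Sum>i\<in>I - {k}. d i *\<^sub>R e i) = (\<Sum>i\<in>I - {k}. c i *\<^sub>R e i)"
        by (intro sum.cong) (auto simp: d_def)
      also have "d k *\<^sub>R e k + \<dots> = (\<Sum>i\<in>I - {k}. c i *\<^sub>R e' i)"
        by (simp add: d_def e'_def algebra_simps sum_subtractf scaleR_sum_left)
      finally show ?thesis .
    qed
    have "e' i \<bullet> b = 0" for i using k by (simp add: e'_def q_def inner_diff_left)
    then have "\<forall>b\<in>insert b B. (\<Sum>i\<in>I. d i *\<^sub>R e i) \<bullet> b = 0"
      unfolding eq using c(2) by (auto simp: inner_sum_left)
    moreover have "\<exists>i\<in>I. d i \<noteq> 0" using c(1) by (auto simp: d_def)
    ultimately show ?thesis by blast
  qed
qed

text \<open>Bolzano-Weierstrass, once for each element of \<open>F\<close>; a finite rank term sees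
  no more of the sequence than these inner products.\<close>

lemma subsequence_inner_convergent:
  fixes u :: "nat \<Rightarrow> 'h::real_inner"
  assumes "finite F" "\<And>n. norm (u n) \<le> K"
  shows "\<exists>r::nat \<Rightarrow> nat. strict_mono r \<and> (\<forall>f\<in>F. convergent (\<lambda>n. u (r n) \<bullet> f))"
  using assms(1)
proof (induction F rule: finite_induct)
  case empty
  show ?case by (intro exI[of _ id]) (auto simp: strict_mono_def)
next
  case (insert f F)
  then obtain r where r: "strict_mono r" "\<forall>f\<in>F. convergent (\<lambda>n. u (r n) \<bullet> f)" by blast
  have "bounded (range (\<lambda>n. u (r n) \<bullet> f))"
  proof (rule boundedI[where B = "K * norm f"])
    fix x assume "x \<in> range (\<lambda>n. u (r n) \<bullet> f)"
    then obtain n where "x = u (r n) \<bullet> f" by blast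
    then show "norm x \<le> K * norm f"
      using Cauchy_Schwarz_ineq2[of "u (r n)" f] mult_right_mono[OF assms(2)[of "r n"], of "norm f"] by simp
  qed
  then obtain l s where s: "strict_mono s" "((\<lambda>n. u (r n) \<bullet> f) \<circ> s) \<longlonglongrightarrow> l"
    using bounded_imp_convergent_subsequence by blast
  have "convergent (\<lambda>n. u ((r \<circ> s) n) \<bullet> g)" if "g \<in> insert f F" for g
  proof (cases "g = f")
    case True
    then show ?thesis using s by (auto simp: convergent_def o_def)
  next
    case False
    then show ?thesis using that r(2) convergent_subseq_convergent[OF _ s(1), of "\<lambda>n. u (r n) \<bullet> g"]
      by (auto simp: o_def)
  qed
  then show ?case using strict_mono_o[OF r(1) s(1)] by blast
qed

lemma subspace_closure:
  fixes A :: "'a::real_normed_vector set"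
  assumes "subspace A"
  shows "subspace (closure A)"
  unfolding subspace_def
proof (intro conjI ballI allI)
  show "0 \<in> closure A" using subspace_0[OF assms] closure_subset by blast
next
  fix x y assume "x \<in> closure A" "y \<in> closure A"
  then obtain f g where "\<And>n. f n \<in> A" "f \<longlonglongrightarrow> x" "\<And>n. g n \<in> A" "g \<longlonglongrightarrow> y"
    by (auto simp: closure_sequential)
  then show "x + y \<in> closure A"
    unfolding closure_sequential
    by (intro exI[of _ "\<lambda>n. f n + g n"] conjI allI subspace_add[OF assms] tendsto_add)
next
  fix c x assume "x \<in> closure A"
  then obtain f where "\<And>n. f n \<in> A" "f \<longlonglongrightarrow> x" by (auto simp: closure_sequential)
  then show "c *\<^sub>R x \<in> closure A"
    unfolding closure_sequential
    by (intro exI[of _ "\<lambda>n. c *\<^sub>R f n"] conjI allI subspace_scale[OF assms] tendsto_scaleR tendsto_const)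
qed

subsection \<open>Self-adjoint relations and their spectra\<close>

text \<open>
  Complex Hilbert spaces are treated as real ones, with the real part of the inner product, and
  a map \<open>J\<close> that stands for the multiplication by the imaginary unit. Self-adjoint relations
  instead of operators save the proof that the form domain is dense.
\<close>

locale selfadjoint_relation =
  fixes S :: "('h::{real_inner,complete_space} \<times> 'h) set" and J :: "'h \<Rightarrow> 'h"
  assumes selfadjoint: "\<And>w h. (w, h) \<in> S \<longleftrightarrow> (\<forall>(u, v)\<in>S. v \<bullet> w = u \<bullet> h)"
    and J_add: "\<And>u v. J (u + v) = J u + J v"
    and J_scale: "\<And>r u. J (r *\<^sub>R u) = r *\<^sub>R J u"
    and J_J: "\<And>u. J (J u) = - u"
    and J_inner: "\<And>u v. J u \<bullet> J v = u \<bullet> v"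
    and S_J: "\<And>u v. (u, v) \<in> S \<Longrightarrow> (J u, J v) \<in> S"
begin

lemma symmetric: "(u, v) \<in> S \<Longrightarrow> (w, h) \<in> S \<Longrightarrow> v \<bullet> w = u \<bullet> h"
  using selfadjoint by blast

text \<open>Linearity and closedness of \<open>S\<close> are consequences of
  \<open>selfadjoint\<close>, which describes membership by equations that are linear and continuous
  in \<open>(w, h)\<close>.\<close>

lemma S_add: "(u, v) \<in> S \<Longrightarrow> (u', v') \<in> S \<Longrightarrow> (u + u', v + v') \<in> S"
  using selfadjoint[of "u + u'" "v + v'"] symmetric by (fastforce simp: inner_add_right)

lemma S_scale: "(u, v) \<in> S \<Longrightarrow> (r *\<^sub>R u, r *\<^sub>R v) \<in> S"
  using selfadjoint[of "r *\<^sub>R u" "r *\<^sub>R v"] symmetric by fastforce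

lemma S_diff: "(u, v) \<in> S \<Longrightarrow> (u', v') \<in> S \<Longrightarrow> (u - u', v - v') \<in> S"
  using S_add[OF _ S_scale[of u' v' "-1"]] by fastforce

lemma S_zero: "(0, 0) \<in> S"
  using selfadjoint[of 0 0] by auto

lemma S_closed:
  assumes "\<And>n. (u n, v n) \<in> S" "u \<longlonglongrightarrow> w" "v \<longlonglongrightarrow> h"
  shows "(w, h) \<in> S"
proof -
  have "y \<bullet> w = x \<bullet> h" if "(x, y) \<in> S" for x y
  proof -
    have "(\<lambda>n. y \<bullet> u n) \<longlonglongrightarrow> y \<bullet> w" "(\<lambda>n. x \<bullet> v n) \<longlonglongrightarrow> x \<bullet> h"
      using assms by (auto intro!: tendsto_intros)
    moreover have "y \<bullet> u n = x \<bullet> v n" for n using symmetric[OF that assms(1)] .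
    ultimately show ?thesis using LIMSEQ_unique by auto
  qed
  then show ?thesis using selfadjoint by auto
qed

lemma J_skew: "J u \<bullet> v = - (u \<bullet> J v)"
  using J_inner[of u "J v"] by (simp add: J_J)

lemma J_self [simp]: "u \<bullet> J u = 0"
  using J_skew[of u u] by (simp add: inner_commute)

lemma norm_J [simp]: "norm (J u) = norm u"
  by (simp add: norm_eq_sqrt_inner J_inner)

lemma J_bounded_linear: "bounded_linear J"
  by (rule bounded_linear_intro[where K = 1]) (auto simp: J_add J_scale)

lemma J_minus: "J (- u) = - J u"
  using J_scale[of "-1" u] by simp

lemma J_diff: "J (u - v) = J u - J v"
  using J_add[of u "- v"] by (simp add: J_minus)

text \<open>\<open>T - z\<close> on an element of the graph, with \<open>J\<close> for the imaginary
  unit.\<close>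

definition shift :: "complex \<Rightarrow> 'h \<times> 'h \<Rightarrow> 'h" where
  "shift z p = snd p - Re z *\<^sub>R fst p - Im z *\<^sub>R J (fst p)"

definition regular :: "complex \<Rightarrow> bool" where
  "regular z \<longleftrightarrow> (\<forall>f. \<exists>p\<in>S. shift z p = f) \<and> (\<exists>c. \<forall>p\<in>S. norm (fst p) \<le> c * norm (shift z p))"

text \<open>Counterpart of \<open>discrete_spectrum\<close>. The point is required to be real, as
  nonreal points are always regular. The span is a real one, which doubles dimensions but does not
  affect their finiteness.\<close>

definition isolated_eigenvalue :: "complex \<Rightarrow> bool" where
  "isolated_eigenvalue z \<longleftrightarrow>
     Im z = 0 \<and> (\<exists>u. u \<noteq> 0 \<and> (u, Re z *\<^sub>R u) \<in> S) \<and>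
     (\<exists>B. finite B \<and> (\<forall>u. (u, Re z *\<^sub>R u) \<in> S \<longrightarrow> u \<in> span B)) \<and>
     (\<exists>d>0. \<forall>z'. z' \<noteq> z \<and> cmod (z' - z) < d \<longrightarrow> regular z')"

lemma shift_real [simp]: "shift (complex_of_real x) p = snd p - x *\<^sub>R fst p"
  by (simp add: shift_def)

text \<open>Symmetry gives \<open>v \<bullet> J u = u \<bullet> J v\<close> and skewness of
  \<open>J\<close> gives the opposite sign, so \<open>v\<close> is orthogonal to \<open>J u\<close>
  and Pythagoras applies.\<close>

lemma shift_norm: "(norm (shift z p))\<^sup>2 = (norm (snd p - Re z *\<^sub>R fst p))\<^sup>2 + (Im z * norm (fst p))\<^sup>2"
  if "p \<in> S"
proof -
  obtain u v where p: "p = (u, v)" by force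
  have "v \<bullet> J u = u \<bullet> J v" using symmetric[OF _ S_J, of u v u v] that p by simp
  moreover have "u \<bullet> J v = - (v \<bullet> J u)" using J_skew[of u v] by (simp add: inner_commute)
  ultimately have "v \<bullet> J u = 0" by simp
  then have "(v - Re z *\<^sub>R u) \<bullet> (Im z *\<^sub>R J u) = 0" by (simp add: inner_diff_left)
  moreover have "(norm (x - y))\<^sup>2 = (norm x)\<^sup>2 + (norm y)\<^sup>2" if "x \<bullet> y = 0" for x y :: 'h
    using that by (simp add: power2_norm_eq_inner inner_diff_left inner_diff_right inner_commute)
  ultimately show ?thesis unfolding p shift_def by (simp add: power_mult_distrib)
qed

text \<open>The lower bound makes the range closed, and by self-adjointness its orthogonal
  complement is the kernel of \<open>T\<close> minus the conjugate of \<open>z\<close>. Hence the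
  condition \<open>ker\<close> carries the opposite sign of \<open>Im z\<close>.\<close>

lemma regularI:
  assumes k: "k > 0" "\<And>p. p \<in> S \<Longrightarrow> k * norm (fst p) \<le> norm (shift z p)"
    and ker: "\<And>w. (w, Re z *\<^sub>R w - Im z *\<^sub>R J w) \<in> S \<Longrightarrow> w = 0"
  shows "regular z"
proof -
  interpret J: bounded_linear J by (rule J_bounded_linear)
  define R where "R = shift z ` S"
  have diff: "shift z (p - q) = shift z p - shift z q" for p q
    by (simp add: shift_def J_diff algebra_simps)
  have sub: "subspace R"
    unfolding R_def subspace_def
  proof (intro conjI ballI allI)
    show "0 \<in> shift z ` S" using S_zero J.zero by (force simp: shift_def image_iff)
  next
    fix x y assume "x \<in> shift z ` S" "y \<in> shift z ` S"
    then obtain u v u' v' where "(u, v) \<in> S" "x = shift z (u, v)" "(u', v') \<in> S" "y = shift z (u', v')"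
      by auto
    then show "x + y \<in> shift z ` S"
      by (intro image_eqI[of _ _ "(u + u', v + v')"]) (auto simp: shift_def J_add algebra_simps S_add)
  next
    fix c x assume "x \<in> shift z ` S"
    then obtain u v where "(u, v) \<in> S" "x = shift z (u, v)" by auto
    then show "c *\<^sub>R x \<in> shift z ` S"
      by (intro image_eqI[of _ _ "(c *\<^sub>R u, c *\<^sub>R v)"]) (auto simp: shift_def J_scale algebra_simps S_scale)
  qed
  have clo: "closed R"
    unfolding closed_sequential_limits
  proof (intro allI impI, elim conjE)
    fix f l assume f: "\<forall>n. f n \<in> R" "f \<longlonglongrightarrow> l"
    then have "\<forall>n. \<exists>p. p \<in> S \<and> f n = shift z p" unfolding R_def by blast
    then obtain p where p: "\<And>n. p n \<in> S" "\<And>n. f n = shift z (p n)" by metis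
    have "Cauchy (\<lambda>n. fst (p n))"
    proof (rule CauchyI)
      fix e :: real assume e: "e > 0"
      obtain M where M: "\<forall>m\<ge>M. \<forall>n\<ge>M. norm (f m - f n) < k * e"
        using CauchyD[OF LIMSEQ_imp_Cauchy[OF f(2)], of "k * e"] k(1) e by (meson mult_pos_pos)
      have "norm (fst (p m) - fst (p n)) < e" if "m \<ge> M" "n \<ge> M" for m n
      proof -
        have "p m - p n \<in> S" using S_diff[of "fst (p m)" "snd (p m)" "fst (p n)" "snd (p n)"] p
          by (simp add: minus_prod_def)
        then have "k * norm (fst (p m - p n)) \<le> norm (f m - f n)" unfolding p(2) diff[symmetric] by (rule k(2))
        also have "\<dots> < k * e" using M that by blast
        finally show ?thesis using k by simp
      qed
      then show "\<exists>M. \<forall>m\<ge>M. \<forall>n\<ge>M. norm (fst (p m) - fst (p n)) < e" by blast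
    qed
    then obtain u where u: "(\<lambda>n. fst (p n)) \<longlonglongrightarrow> u" using Cauchy_convergent_iff convergent_def by blast
    have "snd (p n) = f n + Re z *\<^sub>R fst (p n) + Im z *\<^sub>R J (fst (p n))" for n
      by (simp add: p(2) shift_def)
    then have v: "(\<lambda>n. snd (p n)) \<longlonglongrightarrow> l + Re z *\<^sub>R u + Im z *\<^sub>R J u"
      using u f(2) by (simp add: tendsto_intros J.tendsto)
    have "(u, l + Re z *\<^sub>R u + Im z *\<^sub>R J u) \<in> S"
      using S_closed[OF _ u v] p by simp
    then show "l \<in> R" unfolding R_def by (rule rev_image_eqI) (simp add: shift_def)
  qed
  have "f \<in> R" for f
  proof -
    obtain p where p: "p \<in> R" "\<And>y. y \<in> R \<Longrightarrow> (f - p) \<bullet> y = 0"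
      using orthogonal_projection_exists[OF sub clo] by blast
    define w where "w = f - p"
    have "v \<bullet> w = u \<bullet> (Re z *\<^sub>R w - Im z *\<^sub>R J w)" if "(u, v) \<in> S" for u v
    proof -
      have "w \<bullet> shift z (u, v) = 0" unfolding w_def by (rule p(2)) (use that R_def in blast)
      then have "v \<bullet> w = Re z * (u \<bullet> w) + Im z * (J u \<bullet> w)"
        by (simp add: shift_def inner_diff_right inner_commute)
      then show ?thesis using J_skew[of u w] by (simp add: inner_diff_right)
    qed
    then have "(w, Re z *\<^sub>R w - Im z *\<^sub>R J w) \<in> S"
      using selfadjoint[THEN iffD2] by blast
    then have "w = 0" by (rule ker)
    then show ?thesis using p(1) by (simp add: w_def)
  qed
  moreover have "norm (fst p) \<le> inverse k * norm (shift z p)" if "p \<in> S" for p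
    using k(2)[OF that] k(1) by (simp add: field_simps)
  ultimately show ?thesis unfolding regular_def R_def by (blast dest: sym)
qed

lemma nonreal_regular:
  assumes "Im z \<noteq> 0"
  shows "regular z"
proof (rule regularI[of "\<bar>Im z\<bar>"])
  have *: "\<bar>Im x\<bar> * norm (fst p) \<le> norm (shift x p)" if "p \<in> S" for p x
  proof -
    have "(\<bar>Im x\<bar> * norm (fst p))\<^sup>2 \<le> (norm (shift x p))\<^sup>2"
      using shift_norm[OF that, of x] by (simp add: power_mult_distrib)
    then show ?thesis by (rule power2_le_imp_le) simp
  qed
  show "p \<in> S \<Longrightarrow> \<bar>Im z\<bar> * norm (fst p) \<le> norm (shift z p)" for p by (rule *)
  fix w assume "(w, Re z *\<^sub>R w - Im z *\<^sub>R J w) \<in> S"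
  \<comment> \<open>The vector lies in the kernel at the conjugate point, where the same estimate
    holds.\<close>
  from *[OF this, of "cnj z"] show "w = 0" using assms by (simp add: shift_def mult_le_0_iff)
qed (use assms in auto)

lemma kernel_subspace: "subspace {u. (u, x *\<^sub>R u) \<in> S}"
  unfolding subspace_def
proof (intro conjI ballI allI)
  show "0 \<in> {u. (u, x *\<^sub>R u) \<in> S}" using S_zero by simp
next
  fix u v assume "u \<in> {u. (u, x *\<^sub>R u) \<in> S}" "v \<in> {u. (u, x *\<^sub>R u) \<in> S}"
  then show "u + v \<in> {u. (u, x *\<^sub>R u) \<in> S}" using S_add by (fastforce simp: scaleR_add_right)
next
  fix c u assume "u \<in> {u. (u, x *\<^sub>R u) \<in> S}"
  then show "c *\<^sub>R u \<in> {u. (u, x *\<^sub>R u) \<in> S}" using S_scale[of u "x *\<^sub>R u" c] by (simp add: mult.commute)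
qed

text \<open>The finite rank term converges along a subsequence, so the lower bound makes the sequence Cauchy.\<close>

lemma approximate_eigenvectors_converge:
  assumes F: "finite F" "C \<ge> 0"
    and low: "\<And>u v. (u, v) \<in> S \<Longrightarrow> a * (norm u)\<^sup>2 - C * (\<Sum>f\<in>F. (u \<bullet> f)\<^sup>2) \<le> v \<bullet> u"
    and "x < a"
    and u: "\<And>n. (u n, v n) \<in> S" "\<And>n. norm (u n) = 1"
    and v: "(\<lambda>n. v n - x *\<^sub>R u n) \<longlonglongrightarrow> 0"
  shows "\<exists>r w. strict_mono (r :: nat \<Rightarrow> nat) \<and> (\<lambda>n. u (r n)) \<longlonglongrightarrow> w \<and> norm w = 1 \<and> (w, x *\<^sub>R w) \<in> S"
proof -
  obtain r where r: "strict_mono (r :: nat \<Rightarrow> nat)" "\<And>f. f \<in> F \<Longrightarrow> convergent (\<lambda>n. u (r n) \<bullet> f)"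
    using subsequence_inner_convergent[OF F(1), of u 1] u(2) by (metis order_refl)
  define k where "k = a - x"
  have k: "k > 0" using \<open>x < a\<close> by (simp add: k_def)
  define e where "e n = v (r n) - x *\<^sub>R u (r n)" for n
  have e: "e \<longlonglongrightarrow> 0" unfolding e_def using LIMSEQ_subseq_LIMSEQ[OF v r(1)] by (simp add: o_def)
  \<comment> \<open>\<open>low\<close> is applied to a difference of two members: its image is
    \<open>e i - e j\<close> plus \<open>x\<close> times the difference, and the surplus
    \<open>a - x\<close> controls the norm.\<close>
  have est: "k * (norm (u (r i) - u (r j)))\<^sup>2
      \<le> 2 * norm (e i - e j) + C * (\<Sum>f\<in>F. (u (r i) \<bullet> f - u (r j) \<bullet> f)\<^sup>2)" for i j
  proof -
    define d where "d = u (r i) - u (r j)"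
    have dS: "(d, v (r i) - v (r j)) \<in> S" unfolding d_def by (rule S_diff[OF u(1) u(1)])
    have "v (r i) - v (r j) = (e i - e j) + x *\<^sub>R d" by (simp add: e_def d_def algebra_simps)
    then have "a * (norm d)\<^sup>2 - C * (\<Sum>f\<in>F. (d \<bullet> f)\<^sup>2) \<le> (e i - e j) \<bullet> d + x * (norm d)\<^sup>2"
      using low[OF dS] by (simp add: inner_add_left power2_norm_eq_inner)
    moreover have "(e i - e j) \<bullet> d \<le> norm (e i - e j) * 2"
    proof -
      have "norm d \<le> 2" using norm_triangle_ineq4[of "u (r i)" "u (r j)"] u(2) by (simp add: d_def)
      then show ?thesis
        using norm_cauchy_schwarz[of "e i - e j" d] by (meson mult_left_mono norm_ge_zero order_trans)
    qed
    ultimately show ?thesis by (simp add: k_def d_def inner_diff_left algebra_simps)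
  qed
  have "Cauchy (\<lambda>n. u (r n))"
  proof (rule CauchyI)
    fix t :: real assume t: "t > 0"
    define s where "s = k * t\<^sup>2"
    have s: "s > 0" using k t by (simp add: s_def)
    \<comment> \<open>Half of \<open>s\<close> is reserved for the errors \<open>e\<close> and half
      for the sum over \<open>F\<close>, in shares of \<open>s / (2 * m)\<close>; the added 1 covers
      an empty \<open>F\<close>.\<close>
    define m where "m = real (card F) + 1"
    have m: "m > 0" by (simp add: m_def)
    have "\<forall>f\<in>F. \<exists>M. \<forall>i\<ge>M. \<forall>j\<ge>M. C * (u (r i) \<bullet> f - u (r j) \<bullet> f)\<^sup>2 < s / (2 * m)"
    proof
      fix f assume "f \<in> F"
      then have "Cauchy (\<lambda>n. u (r n) \<bullet> f)" using r(2) Cauchy_convergent_iff by blast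
      then obtain M where M: "\<forall>i\<ge>M. \<forall>j\<ge>M. norm (u (r i) \<bullet> f - u (r j) \<bullet> f) < sqrt (s / (2 * m * (C + 1)))"
        using CauchyD s m F(2) by (metis add_nonneg_pos divide_pos_pos mult_pos_pos real_sqrt_gt_zero zero_less_numeral zero_less_one)
      have "C * (u (r i) \<bullet> f - u (r j) \<bullet> f)\<^sup>2 < s / (2 * m)" if "i \<ge> M" "j \<ge> M" for i j
      proof -
        define y where "y = (u (r i) \<bullet> f - u (r j) \<bullet> f)\<^sup>2"
        have "\<bar>u (r i) \<bullet> f - u (r j) \<bullet> f\<bar> < sqrt (s / (2 * m * (C + 1)))" using M that by simp
        then have "\<bar>u (r i) \<bullet> f - u (r j) \<bullet> f\<bar>\<^sup>2 < (sqrt (s / (2 * m * (C + 1))))\<^sup>2"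
          by (intro power_strict_mono) auto
        then have "y < s / (2 * m * (C + 1))" using s m F(2) by (simp add: y_def)
        moreover have "0 < 2 * m * (C + 1)" using m F(2) by simp
        ultimately have "y * (2 * m * (C + 1)) < s" by (simp add: pos_less_divide_eq)
        then have "y * (C + 1) < s / (2 * m)" using m by (simp add: pos_less_divide_eq mult_ac)
        moreover have "C * y \<le> y * (C + 1)" by (simp add: y_def algebra_simps)
        ultimately show ?thesis by (simp add: y_def)
      qed
      then show "\<exists>M. \<forall>i\<ge>M. \<forall>j\<ge>M. C * (u (r i) \<bullet> f - u (r j) \<bullet> f)\<^sup>2 < s / (2 * m)" by blast
    qed
    then obtain M where M: "\<And>f i j. f \<in> F \<Longrightarrow> i \<ge> M f \<Longrightarrow> j \<ge> M f \<Longrightarrow>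
        C * (u (r i) \<bullet> f - u (r j) \<bullet> f)\<^sup>2 < s / (2 * m)" by metis
    obtain M' where M': "\<And>i j. i \<ge> M' \<Longrightarrow> j \<ge> M' \<Longrightarrow> norm (e i - e j) < s / 4"
      using CauchyD[OF LIMSEQ_imp_Cauchy[OF e], of "s / 4"] s by auto
    define N where "N = Max (insert M' (M ` F))"
    have N: "M' \<le> N" "\<And>f. f \<in> F \<Longrightarrow> M f \<le> N" using F(1) by (auto simp: N_def)
    have "norm (u (r i) - u (r j)) < t" if "i \<ge> N" "j \<ge> N" for i j
    proof -
      have "C * (\<Sum>f\<in>F. (u (r i) \<bullet> f - u (r j) \<bullet> f)\<^sup>2) \<le> (\<Sum>f\<in>F. s / (2 * m))"
        unfolding sum_distrib_left using M N that by (intro sum_mono less_imp_le) (meson order_trans)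
      also have "\<dots> \<le> s / 2" using s by (simp add: m_def field_simps)
      finally have "k * (norm (u (r i) - u (r j)))\<^sup>2 < k * t\<^sup>2"
        using est[of i j] M'[of i j] that N unfolding s_def[symmetric] by auto
      then have "(norm (u (r i) - u (r j)))\<^sup>2 < t\<^sup>2" using k by simp
      then show ?thesis using t by (simp add: power_less_imp_less_base)
    qed
    then show "\<exists>M. \<forall>m\<ge>M. \<forall>n\<ge>M. norm (u (r m) - u (r n)) < t" by blast
  qed
  then obtain w where w: "(\<lambda>n. u (r n)) \<longlonglongrightarrow> w" using Cauchy_convergent_iff convergent_def by blast
  have "(\<lambda>n. e n + x *\<^sub>R u (r n)) \<longlonglongrightarrow> 0 + x *\<^sub>R w" using e w by (intro tendsto_intros)
  then have "(\<lambda>n. v (r n)) \<longlonglongrightarrow> x *\<^sub>R w" by (simp add: e_def)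
  then have "(w, x *\<^sub>R w) \<in> S" using S_closed[OF u(1) w] by blast
  moreover have "norm w = 1" using tendsto_norm[OF w] u(2) by (simp add: LIMSEQ_const_iff)
  ultimately show ?thesis using r w by blast
qed

text \<open>By \<open>regularI\<close> a point below \<open>a\<close> that is not regular has
  approximate eigenvectors, and by compactness true ones. The elements of \<open>F\<close> separate
  its eigenspace, which is therefore finite-dimensional. If such points accumulated, unit
  eigenvectors would converge to an eigenvector at the limit point, to which all of them are
  orthogonal.\<close>

lemma below_essential_spectrum:
  assumes F: "finite F" "C \<ge> 0"
    and low: "\<And>u v. (u, v) \<in> S \<Longrightarrow> a * (norm u)\<^sup>2 - C * (\<Sum>f\<in>F. (u \<bullet> f)\<^sup>2) \<le> v \<bullet> u"
    and "Re z < a"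
  shows "regular z \<or> isolated_eigenvalue z"
proof -
  have eig: "\<exists>u. norm u = 1 \<and> (u, x *\<^sub>R u) \<in> S" if x: "x < a" "\<not> regular (complex_of_real x)" for x
  proof (rule ccontr)
    assume no: "\<not> ?thesis"
    have ker: "w = 0" if "(w, x *\<^sub>R w) \<in> S" for w
    proof (rule ccontr)
      assume "w \<noteq> 0"
      moreover have "(inverse (norm w) *\<^sub>R w, x *\<^sub>R (inverse (norm w) *\<^sub>R w)) \<in> S"
        using S_scale[OF that, of "inverse (norm w)"] by (simp add: mult.commute)
      ultimately show False using no by (metis norm_sgn sgn_div_norm)
    qed
    have "\<exists>p. p \<in> S \<and> norm (fst p) = 1 \<and> norm (snd p - x *\<^sub>R fst p) < 1 / real (Suc n)" for n
    proof -
      have "\<not> (\<forall>p\<in>S. 1 / real (Suc n) * norm (fst p) \<le> norm (shift (complex_of_real x) p))"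
        using regularI[of "1 / real (Suc n)" "complex_of_real x"] ker x by fastforce
      then obtain u v where p: "(u, v) \<in> S" "norm (v - x *\<^sub>R u) < 1 / real (Suc n) * norm u"
        by fastforce
      then have n: "norm u > 0" by (metis mult_zero_right norm_ge_zero not_less order_le_less)
      define c where "c = inverse (norm u)"
      have "(c *\<^sub>R u, c *\<^sub>R v) \<in> S" by (rule S_scale[OF p(1)])
      moreover have "norm (c *\<^sub>R u) = 1" using n by (simp add: c_def)
      moreover have "c *\<^sub>R v - x *\<^sub>R (c *\<^sub>R u) = c *\<^sub>R (v - x *\<^sub>R u)" by (simp add: algebra_simps)
      then have "norm (c *\<^sub>R v - x *\<^sub>R (c *\<^sub>R u)) = norm (v - x *\<^sub>R u) / norm u"
        by (simp only: norm_scaleR) (simp add: c_def field_simps)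
      then have "norm (c *\<^sub>R v - x *\<^sub>R (c *\<^sub>R u)) < 1 / real (Suc n)"
        using p n by (simp only: pos_divide_less_eq)
      ultimately show ?thesis by (metis fst_conv snd_conv)
    qed
    then obtain p where p: "\<And>n. p n \<in> S" "\<And>n. norm (fst (p n)) = 1"
        "\<And>n. norm (snd (p n) - x *\<^sub>R fst (p n)) < 1 / real (Suc n)" by metis
    have "(\<lambda>n. snd (p n) - x *\<^sub>R fst (p n)) \<longlonglongrightarrow> 0"
      by (rule Lim_null_comparison[OF always_eventually LIMSEQ_Suc[OF lim_1_over_n]])
        (use p(3) less_imp_le in blast)
    then have "\<exists>r w. strict_mono (r :: nat \<Rightarrow> nat) \<and> (\<lambda>n. fst (p (r n))) \<longlonglongrightarrow> w \<and> norm w = 1 \<and> (w, x *\<^sub>R w) \<in> S"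
      using approximate_eigenvectors_converge[OF F low x(1), of "\<lambda>n. fst (p n)" "\<lambda>n. snd (p n)"] p by simp
    then show False using no by blast
  qed
  show ?thesis
  proof (rule disjCI)
    assume nz: "\<not> isolated_eigenvalue z"
    show "regular z"
    proof (rule ccontr)
      assume nr: "\<not> regular z"
      define x where "x = Re z"
      have z: "z = complex_of_real x"
        using nonreal_regular[of z] nr by (auto simp: x_def complex_eq_iff)
      have x: "x < a" using \<open>Re z < a\<close> by (simp add: x_def)
      obtain u0 where u0: "norm u0 = 1" "(u0, x *\<^sub>R u0) \<in> S" using eig[OF x] nr z by blast
      define E where "E = {u. (u, x *\<^sub>R u) \<in> S}"
      have "u = 0" if "u \<in> E" "\<forall>f\<in>F. u \<bullet> f = 0" for u
      proof -
        have "a * (norm u)\<^sup>2 \<le> x * (norm u)\<^sup>2"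
          using low[of u "x *\<^sub>R u"] that by (simp add: E_def power2_norm_eq_inner)
        then show ?thesis using x by (simp add: mult_le_cancel_right)
      qed
      then obtain B where B: "finite B" "E \<subseteq> span B"
        using finite_span_of_separation[OF F(1)] kernel_subspace[of x] unfolding E_def by blast
      have "\<not> (\<exists>d>0. \<forall>z'. z' \<noteq> z \<and> cmod (z' - z) < d \<longrightarrow> regular z')"
      proof -
        have "u0 \<noteq> 0" using u0 by auto
        then show ?thesis using nz u0(2) B unfolding isolated_eigenvalue_def z E_def by auto
      qed
      \<comment> \<open>The first bound keeps the nearby points below \<open>a\<close>, where
        \<open>eig\<close> applies; the second makes them converge to \<open>x\<close>.\<close>
      moreover define d where "d n = min (a - x) (1 / real (Suc n))" for n
      moreover have "d n > 0" for n using x by (simp add: d_def)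
      ultimately have "\<forall>n. \<exists>z'. z' \<noteq> z \<and> cmod (z' - z) < d n \<and> \<not> regular z'" by blast
      then obtain Z where Z: "\<And>n. Z n \<noteq> z" "\<And>n. cmod (Z n - z) < d n" "\<And>n. \<not> regular (Z n)" by metis
      define y where "y n = Re (Z n)" for n
      have Zy: "Z n = complex_of_real (y n)" for n
        using nonreal_regular[of "Z n"] Z(3)[of n] by (auto simp: y_def complex_eq_iff)
      have y: "y n \<noteq> x" "\<bar>y n - x\<bar> < d n" for n
        using Z(1,2)[of n] unfolding Zy z of_real_diff[symmetric] norm_of_real by auto
      have "y n < a" for n using y(2)[of n] by (auto simp: d_def)
      then have "\<forall>n. \<exists>u. norm u = 1 \<and> (u, y n *\<^sub>R u) \<in> S" using eig Z(3) Zy by metis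
      then obtain u where u: "\<And>n. norm (u n) = 1" "\<And>n. (u n, y n *\<^sub>R u n) \<in> S" by metis
      have "(\<lambda>n. y n *\<^sub>R u n - x *\<^sub>R u n) \<longlonglongrightarrow> 0"
      proof (rule Lim_null_comparison[OF always_eventually LIMSEQ_Suc[OF lim_1_over_n]], rule allI)
        fix n
        have "norm (y n *\<^sub>R u n - x *\<^sub>R u n) = \<bar>y n - x\<bar>" using u by (simp flip: scaleR_left_diff_distrib)
        then show "norm (y n *\<^sub>R u n - x *\<^sub>R u n) \<le> 1 / real (Suc n)" using y(2)[of n] by (simp add: d_def)
      qed
      then obtain r w where w: "(\<lambda>n. u (r n)) \<longlonglongrightarrow> w" "norm w = 1" "(w, x *\<^sub>R w) \<in> S"
        using approximate_eigenvectors_converge[OF F low x, of u "\<lambda>n. y n *\<^sub>R u n"] u by blast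
      \<comment> \<open>Eigenvectors for distinct real eigenvalues are orthogonal, yet
        \<open>w\<close> is a limit of some of the \<open>u n\<close>.\<close>
      have "u n \<bullet> w = 0" for n
        using symmetric[OF u(2)[of n] w(3)] y(1)[of n] by simp
      moreover have "(\<lambda>n. u (r n) \<bullet> w) \<longlonglongrightarrow> w \<bullet> w" by (intro tendsto_intros w)
      ultimately have "w \<bullet> w = 0" by (simp add: LIMSEQ_const_iff)
      then show False using w(2) by simp
    qed
  qed
qed

text \<open>
  A vector that almost attains the norm \<open>\<beta>\<close> of the resolvent at \<open>c\<close> is an approximate eigenvector of the
  squared resolvent, so \<open>c + 1 / \<beta>\<close> or \<open>c - 1 / \<beta>\<close> is not regular.
\<close>

lemma regular_ball_bound:
  assumes "\<eta> > 0" and reg: "\<And>y. \<bar>y - c\<bar> < \<eta> \<Longrightarrow> regular (complex_of_real y)"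
    and "(u0, v0) \<in> S"
  shows "\<eta> * norm u0 \<le> norm (v0 - c *\<^sub>R u0)"
proof (rule ccontr)
  assume no: "\<not> ?thesis"
  have bound: "\<exists>k\<ge>0. \<forall>(u, v)\<in>S. norm u \<le> k * norm (v - y *\<^sub>R u)" if y: "\<bar>y - c\<bar> < \<eta>" for y
  proof -
    obtain k where k: "\<forall>p\<in>S. norm (fst p) \<le> k * norm (shift (complex_of_real y) p)"
      using reg[OF y] unfolding regular_def by blast
    have "norm u \<le> \<bar>k\<bar> * norm (v - y *\<^sub>R u)" if uv: "(u, v) \<in> S" for u v
      using k[rule_format, OF uv] mult_right_mono[OF abs_ge_self[of k], of "norm (v - y *\<^sub>R u)"] by simp
    then show ?thesis by (intro exI[of _ "\<bar>k\<bar>"]) auto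
  qed
  obtain k where k: "k \<ge> 0" "\<And>u v. (u, v) \<in> S \<Longrightarrow> norm u \<le> k * norm (v - c *\<^sub>R u)"
    using bound[of c] \<open>\<eta> > 0\<close> by auto
  \<comment> \<open>\<open>Sup D\<close> is the operator norm of the inverse of
    \<open>T - c\<close>.\<close>
  define D where "D = {norm u | u v. (u, v) \<in> S \<and> norm (v - c *\<^sub>R u) \<le> 1}"
  define \<beta> where "\<beta> = Sup D"
  have D: "0 \<in> D" "bdd_above D"
  proof -
    show "0 \<in> D" unfolding D_def using S_zero by force
    have "norm u \<le> k" if "(u, v) \<in> S" "norm (v - c *\<^sub>R u) \<le> 1" for u v
      using k(2)[OF that(1)] mult_left_mono[OF that(2) k(1)] by simp
    then show "bdd_above D" unfolding D_def by (intro bdd_aboveI[of _ k]) blast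
  qed
  have le: "norm u \<le> \<beta> * norm (v - c *\<^sub>R u)" if uv: "(u, v) \<in> S" for u v
  proof (cases "v - c *\<^sub>R u = 0")
    case True
    then show ?thesis using k(2)[OF uv] by simp
  next
    case False
    define t where "t = inverse (norm (v - c *\<^sub>R u))"
    have t: "t > 0" using False by (simp add: t_def)
    have "t *\<^sub>R v - c *\<^sub>R (t *\<^sub>R u) = t *\<^sub>R (v - c *\<^sub>R u)" by (simp add: algebra_simps)
    then have "norm (t *\<^sub>R v - c *\<^sub>R (t *\<^sub>R u)) = 1" using False by (simp only: norm_scaleR) (simp add: t_def)
    then have "norm (t *\<^sub>R u) \<in> D" unfolding D_def using S_scale[OF uv, of t] by (metis (mono_tags, lifting) mem_Collect_eq order_refl)
    then have "norm (t *\<^sub>R u) \<le> \<beta>" unfolding \<beta>_def using D(2) by (rule cSup_upper)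
    then show ?thesis using False t by (simp add: t_def divide_inverse[symmetric] pos_divide_le_eq mult.commute)
  qed
  \<comment> \<open>The negated claim says that \<open>\<beta>\<close> exceeds
    \<open>1 / \<eta>\<close>, so \<open>c + 1 / \<beta>\<close> and \<open>c - 1 / \<beta>\<close>
    both lie in the regular ball.\<close>
  have \<beta>: "\<beta> > 0" "1 / \<beta> < \<eta>"
  proof -
    have "norm (v0 - c *\<^sub>R u0) < \<eta> * (\<beta> * norm (v0 - c *\<^sub>R u0))"
      using no mult_left_mono[OF le[OF assms(3)] less_imp_le[OF \<open>\<eta> > 0\<close>]] by linarith
    then have "1 < \<eta> * \<beta>"
      by (metis mult.assoc mult.left_neutral mult_less_cancel_right norm_ge_zero not_less)
    then show "\<beta> > 0" using \<open>\<eta> > 0\<close> by (smt (verit) mult_nonneg_nonpos)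
    then show "1 / \<beta> < \<eta>" using \<open>1 < \<eta> * \<beta>\<close> by (simp add: pos_divide_less_eq)
  qed
  obtain k1 where k1: "k1 \<ge> 0" "\<And>u v. (u, v) \<in> S \<Longrightarrow> norm u \<le> k1 * norm (v - (c + 1 / \<beta>) *\<^sub>R u)"
    using bound[of "c + 1 / \<beta>"] \<beta> by auto
  obtain k2 where k2: "k2 \<ge> 0" "\<And>u v. (u, v) \<in> S \<Longrightarrow> norm u \<le> k2 * norm (v - (c - 1 / \<beta>) *\<^sub>R u)"
    using bound[of "c - 1 / \<beta>"] \<beta> by auto
  have key: "2 * \<beta> * (\<beta> - e) \<le> (k1 + k2) * sqrt (2 * \<beta> * e)" if e: "0 < e" for e
  proof -
    have "\<beta> - e < Sup D" using e by (simp add: \<beta>_def)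
    then obtain u v where uv: "(u, v) \<in> S" "norm (v - c *\<^sub>R u) \<le> 1" "\<beta> - e < norm u"
      using less_cSupD[of D "\<beta> - e"] D(1) unfolding D_def by blast
    have u: "norm u \<le> \<beta>"
      using le[OF uv(1)] mult_left_mono[OF uv(2) less_imp_le[OF \<beta>(1)]] by linarith
    define f where "f = v - c *\<^sub>R u"
    obtain w h where wh: "(w, h) \<in> S" "h - c *\<^sub>R w = u"
      using reg[of c] \<open>\<eta> > 0\<close> unfolding regular_def by (metis abs_zero diff_self prod.collapse shift_real)
    have w: "norm w \<le> \<beta> * norm u" using le[OF wh(1)] wh(2) by simp
    have "f \<bullet> w = u \<bullet> (h - c *\<^sub>R w)"
      by (simp add: f_def inner_diff_left inner_diff_right symmetric[OF uv(1) wh(1)])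
    then have fw: "f \<bullet> w = u \<bullet> u" by (simp add: wh(2))
    \<comment> \<open>\<open>w\<close> is the squared inverse of \<open>T - c\<close> at
      \<open>f\<close>. As \<open>norm u\<close> is close to its maximal value
      \<open>\<beta>\<close>, the vector \<open>f\<close> nearly satisfies the eigenvalue equation
      with \<open>\<beta>\<^sup>2\<close>, and \<open>g\<close> is the defect.\<close>
    define g where "g = w - \<beta>\<^sup>2 *\<^sub>R f"
    have "(norm g)\<^sup>2 = (norm w)\<^sup>2 - 2 * \<beta>\<^sup>2 * (norm u)\<^sup>2 + (\<beta>\<^sup>2)\<^sup>2 * (norm f)\<^sup>2"
    proof -
      have "(norm g)\<^sup>2 = (norm w)\<^sup>2 - 2 * \<beta>\<^sup>2 * (f \<bullet> w) + (\<beta>\<^sup>2)\<^sup>2 * (norm f)\<^sup>2"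
        unfolding g_def
        by (simp add: power2_norm_eq_inner inner_diff_left inner_diff_right inner_commute)
      then show ?thesis by (simp add: fw power2_norm_eq_inner)
    qed
    also have "\<dots> \<le> (\<beta> * norm u)\<^sup>2 - 2 * \<beta>\<^sup>2 * (norm u)\<^sup>2 + (\<beta>\<^sup>2)\<^sup>2 * 1"
      using w uv(2) by (intro add_mono diff_mono mult_left_mono power_mono order_refl) (auto simp: f_def power_le_one)
    also have "\<dots> = \<beta>\<^sup>2 * ((\<beta> - norm u) * (\<beta> + norm u))"
      by (simp add: power2_eq_square algebra_simps)
    also have "\<dots> \<le> \<beta>\<^sup>2 * (e * (2 * \<beta>))"
      using uv(3) u e \<beta>(1) by (intro mult_left_mono mult_mono) auto
    finally have "norm g \<le> sqrt (\<beta>\<^sup>2 * (2 * \<beta> * e))" by (simp add: real_le_rsqrt mult_ac)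
    then have g: "norm g \<le> \<beta> * sqrt (2 * \<beta> * e)" using \<beta>(1) by (simp add: real_sqrt_mult)
    \<comment> \<open>The squared inverse minus \<open>\<beta>\<^sup>2\<close> factors into a sum
      and a difference: \<open>w + \<beta> *\<^sub>R u\<close> and
      \<open>w - \<beta> *\<^sub>R u\<close> are approximate eigenvectors of \<open>T\<close> at
      \<open>c + 1 / \<beta>\<close> and \<open>c - 1 / \<beta>\<close>, and by regularity both must
      be small.\<close>
    have "(h + \<beta> *\<^sub>R v) - (c + 1 / \<beta>) *\<^sub>R (w + \<beta> *\<^sub>R u) = (- (1 / \<beta>)) *\<^sub>R g"
      using \<beta>(1) unfolding g_def f_def
      by (simp add: wh(2)[symmetric] algebra_simps power2_eq_square)
    then have "norm (w + \<beta> *\<^sub>R u) \<le> k1 * ((1 / \<beta>) * norm g)"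
      using k1(2)[OF S_add[OF wh(1) S_scale[OF uv(1)]], of \<beta>] \<beta>(1) by simp
    also have "\<dots> \<le> k1 * sqrt (2 * \<beta> * e)"
      using g \<beta>(1) k1(1) by (intro mult_left_mono) (auto simp: pos_divide_le_eq mult.commute)
    finally have 1: "norm (w + \<beta> *\<^sub>R u) \<le> k1 * sqrt (2 * \<beta> * e)" .
    have "(h - \<beta> *\<^sub>R v) - (c - 1 / \<beta>) *\<^sub>R (w - \<beta> *\<^sub>R u) = (1 / \<beta>) *\<^sub>R g"
      using \<beta>(1) unfolding g_def f_def
      by (simp add: wh(2)[symmetric] algebra_simps power2_eq_square)
    then have "norm (w - \<beta> *\<^sub>R u) \<le> k2 * ((1 / \<beta>) * norm g)"
      using k2(2)[OF S_diff[OF wh(1) S_scale[OF uv(1)]], of \<beta>] \<beta>(1) by simp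
    also have "\<dots> \<le> k2 * sqrt (2 * \<beta> * e)"
      using g \<beta>(1) k2(1) by (intro mult_left_mono) (auto simp: pos_divide_le_eq mult.commute)
    finally have 2: "norm (w - \<beta> *\<^sub>R u) \<le> k2 * sqrt (2 * \<beta> * e)" .
    \<comment> \<open>Both being small contradicts that their difference has norm close to
      \<open>2 * \<beta>\<^sup>2\<close>.\<close>
    have "2 * \<beta> * norm u = norm ((w + \<beta> *\<^sub>R u) - (w - \<beta> *\<^sub>R u))"
      using \<beta>(1) by (simp add: scaleR_2[symmetric])
    also have "\<dots> \<le> (k1 + k2) * sqrt (2 * \<beta> * e)"
      using norm_triangle_ineq4[of "w + \<beta> *\<^sub>R u" "w - \<beta> *\<^sub>R u"] 1 2 by (simp add: distrib_right)
    finally have "2 * \<beta> * norm u \<le> (k1 + k2) * sqrt (2 * \<beta> * e)" .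
    moreover have "2 * \<beta> * (\<beta> - e) \<le> 2 * \<beta> * norm u" using uv(3) \<beta>(1) by simp
    ultimately show ?thesis by linarith
  qed
  have "(\<lambda>n. 2 * \<beta> * (\<beta> - 1 / real (Suc n))) \<longlonglongrightarrow> 2 * \<beta> * (\<beta> - 0)"
    by (intro tendsto_intros LIMSEQ_Suc[OF lim_1_over_n])
  moreover have "(\<lambda>n. (k1 + k2) * sqrt (2 * \<beta> * (1 / real (Suc n)))) \<longlonglongrightarrow> (k1 + k2) * sqrt (2 * \<beta> * 0)"
    by (intro tendsto_intros LIMSEQ_Suc[OF lim_1_over_n])
  ultimately have "2 * \<beta> * (\<beta> - 0) \<le> (k1 + k2) * sqrt (2 * \<beta> * 0)"
    by (rule LIMSEQ_le) (intro exI[of _ 0] allI impI key, simp)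
  then show False using \<beta>(1) by (simp add: mult_le_0_iff)
qed

text \<open>This is the spectral gap that remains after the eigenspace is removed. The regular balls
  around \<open>x + \<eta>\<close> and \<open>x - \<eta>\<close> bound the quadratic form of the
  symmetric correspondence between \<open>v - x *\<^sub>R u\<close> and \<open>u\<close>,
  polarisation turns this into a norm bound, and a vector orthogonal to the kernel lies in the
  closure of the range, where it can be tested.\<close>

lemma isolated_kernel_complement_bound:
  assumes \<eta>: "\<eta> > 0" and reg: "\<And>y. y \<noteq> x \<Longrightarrow> \<bar>y - x\<bar> < 2 * \<eta> \<Longrightarrow> regular (complex_of_real y)"
    and uv: "(u, v) \<in> S" and perp: "\<And>w. (w, x *\<^sub>R w) \<in> S \<Longrightarrow> u \<bullet> w = 0"
  shows "2 * \<eta> * norm u \<le> norm (v - x *\<^sub>R u)"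
proof -
  have gap: "2 * \<eta> * \<bar>(v - x *\<^sub>R u) \<bullet> u\<bar> \<le> (norm (v - x *\<^sub>R u))\<^sup>2" if "(u, v) \<in> S" for u v
  proof -
    define g where "g = v - x *\<^sub>R u"
    have *: "2 * s * (g \<bullet> u) \<le> (norm g)\<^sup>2" if "\<bar>s\<bar> = \<eta>" for s
    proof -
      have "\<eta> * norm u \<le> norm (v - (x + s) *\<^sub>R u)"
      proof (rule regular_ball_bound[OF \<eta> _ \<open>(u, v) \<in> S\<close>])
        fix y assume "\<bar>y - (x + s)\<bar> < \<eta>"
        \<comment> \<open>Both balls touch \<open>x\<close> without containing it.\<close>
        then have "y \<noteq> x" "\<bar>y - x\<bar> < 2 * \<eta>" using that by auto
        then show "regular (complex_of_real y)" by (rule reg)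
      qed
      also have "v - (x + s) *\<^sub>R u = g - s *\<^sub>R u" by (simp add: g_def algebra_simps)
      finally have "(\<eta> * norm u)\<^sup>2 \<le> (norm (g - s *\<^sub>R u))\<^sup>2" using \<eta> by (intro power_mono) auto
      also have "\<dots> = (norm g)\<^sup>2 - 2 * s * (g \<bullet> u) + s\<^sup>2 * (norm u)\<^sup>2"
        by (simp add: power2_norm_eq_inner inner_diff_left inner_diff_right inner_commute)
          (simp add: power2_eq_square algebra_simps)
      \<comment> \<open>The centres have distance exactly \<open>\<eta>\<close> from
        \<open>x\<close>, so the terms with \<open>norm u\<close> cancel.\<close>
      also have "s\<^sup>2 = \<eta>\<^sup>2" using that by (metis power2_abs)
      finally show ?thesis by (simp add: power_mult_distrib)
    qed
    show ?thesis using *[of \<eta>] *[of "- \<eta>"] \<eta> unfolding g_def[symmetric] by (auto simp: abs_if)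
  qed
  define g where "g = v - x *\<^sub>R u"
  have polar: "4 * (g' \<bullet> u) * (2 * \<eta>) \<le> 2 * (norm g)\<^sup>2 + 2 * (norm g')\<^sup>2"
    if "(u', v') \<in> S" "g' = v' - x *\<^sub>R u'" for u' v' g'
  proof -
    have "v \<bullet> u' = u \<bullet> v'" by (rule symmetric[OF uv that(1)])
    then have s: "g \<bullet> u' = g' \<bullet> u" by (simp add: g_def that(2) inner_diff_left inner_diff_right inner_commute)
    have 1: "2 * \<eta> * ((g + g') \<bullet> (u + u')) \<le> (norm (g + g'))\<^sup>2"
    proof -
      have "g + g' = (v + v') - x *\<^sub>R (u + u')" by (simp add: g_def that(2) algebra_simps)
      then have "2 * \<eta> * \<bar>(g + g') \<bullet> (u + u')\<bar> \<le> (norm (g + g'))\<^sup>2" using gap[OF S_add[OF uv that(1)]] by simp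
      moreover have "2 * \<eta> * ((g + g') \<bullet> (u + u')) \<le> 2 * \<eta> * \<bar>(g + g') \<bullet> (u + u')\<bar>"
        using \<eta> by (intro mult_left_mono) auto
      ultimately show ?thesis by linarith
    qed
    have 2: "2 * \<eta> * (- ((g - g') \<bullet> (u - u'))) \<le> (norm (g - g'))\<^sup>2"
    proof -
      have "g - g' = (v - v') - x *\<^sub>R (u - u')" by (simp add: g_def that(2) algebra_simps)
      then have "2 * \<eta> * \<bar>(g - g') \<bullet> (u - u')\<bar> \<le> (norm (g - g'))\<^sup>2" using gap[OF S_diff[OF uv that(1)]] by simp
      moreover have "2 * \<eta> * (- ((g - g') \<bullet> (u - u'))) \<le> 2 * \<eta> * \<bar>(g - g') \<bullet> (u - u')\<bar>"
        using \<eta> by (intro mult_left_mono) auto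
      ultimately show ?thesis by linarith
    qed
    have "(g + g') \<bullet> (u + u') - (g - g') \<bullet> (u - u') = 4 * (g' \<bullet> u)"
      using s by (simp add: inner_add_left inner_add_right inner_diff_left inner_diff_right)
    moreover have "(norm (g + g'))\<^sup>2 + (norm (g - g'))\<^sup>2 = 2 * (norm g)\<^sup>2 + 2 * (norm g')\<^sup>2"
      by (simp add: power2_norm_eq_inner inner_add_left inner_add_right inner_diff_left inner_diff_right)
    moreover have "2 * \<eta> * ((g + g') \<bullet> (u + u') - (g - g') \<bullet> (u - u'))
        \<le> (norm (g + g'))\<^sup>2 + (norm (g - g'))\<^sup>2"
      using 1 2 by (simp add: right_diff_distrib)
    ultimately show ?thesis by (simp add: mult.commute)
  qed
  define R where "R = {v' - x *\<^sub>R u' | u' v'. (u', v') \<in> S}"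
  have "subspace R"
    unfolding subspace_def
  proof (intro conjI ballI allI)
    show "0 \<in> R" unfolding R_def by (intro CollectI exI[of _ 0]) (simp add: S_zero)
  next
    fix a b assume "a \<in> R" "b \<in> R"
    then obtain u1 v1 u2 v2 where "(u1, v1) \<in> S" "a = v1 - x *\<^sub>R u1" "(u2, v2) \<in> S" "b = v2 - x *\<^sub>R u2"
      unfolding R_def by blast
    then have "(u1 + u2, v1 + v2) \<in> S" "a + b = (v1 + v2) - x *\<^sub>R (u1 + u2)"
      by (auto simp: S_add algebra_simps)
    then show "a + b \<in> R" unfolding R_def by blast
  next
    fix c a assume "a \<in> R"
    then obtain u1 v1 where "(u1, v1) \<in> S" "a = v1 - x *\<^sub>R u1" unfolding R_def by blast
    then have "(c *\<^sub>R u1, c *\<^sub>R v1) \<in> S" "c *\<^sub>R a = c *\<^sub>R v1 - x *\<^sub>R (c *\<^sub>R u1)"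
      by (auto simp: S_scale algebra_simps)
    then show "c *\<^sub>R a \<in> R" unfolding R_def by blast
  qed
  then have sub: "subspace (closure R)" by (rule subspace_closure)
  obtain p where p: "p \<in> closure R" "\<And>y. y \<in> closure R \<Longrightarrow> (u - p) \<bullet> y = 0"
    using orthogonal_projection_exists[OF sub closed_closure] by blast
  define q where "q = u - p"
  \<comment> \<open>The component \<open>q\<close> of \<open>u\<close> orthogonal to the range lies
    in the kernel by self-adjointness, and \<open>perp\<close> then makes it vanish.\<close>
  have "v' \<bullet> q = u' \<bullet> (x *\<^sub>R q)" if "(u', v') \<in> S" for u' v'
  proof -
    have "v' - x *\<^sub>R u' \<in> R" using that unfolding R_def by blast
    then have "v' - x *\<^sub>R u' \<in> closure R" using closure_subset by blast
    then have "q \<bullet> (v' - x *\<^sub>R u') = 0" unfolding q_def by (rule p(2))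
    then show ?thesis by (simp add: inner_diff_right inner_commute)
  qed
  then have "(q, x *\<^sub>R q) \<in> S" using selfadjoint by auto
  then have "u \<bullet> q = 0" by (rule perp)
  moreover have "q \<bullet> p = 0" unfolding q_def using p by blast
  ultimately have "q \<bullet> q = 0" unfolding q_def by (simp add: inner_diff_left inner_diff_right inner_commute)
  then have "u \<in> closure R" using p(1) by (simp add: q_def)
  then obtain G where G: "\<And>n. G n \<in> R" "G \<longlonglongrightarrow> u" by (auto simp: closure_sequential)
  have est: "4 * ((2 * \<eta>) * (G n \<bullet> u)) * (2 * \<eta>) \<le> 2 * (norm g)\<^sup>2 + 2 * ((2 * \<eta>)\<^sup>2 * (norm (G n))\<^sup>2)" for n
  proof -
    obtain u1 v1 where "(u1, v1) \<in> S" "G n = v1 - x *\<^sub>R u1" using G(1)[of n] unfolding R_def by blast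
    \<comment> \<open>The factor \<open>2 * \<eta>\<close> balances the two sides of
      \<open>polar\<close>, so that no constant is lost in the limit.\<close>
    then have "(2 * \<eta>) *\<^sub>R G n = (2 * \<eta>) *\<^sub>R v1 - x *\<^sub>R ((2 * \<eta>) *\<^sub>R u1)"
      by (simp add: scaleR_right_diff_distrib mult.commute)
    from polar[OF S_scale[OF \<open>(u1, v1) \<in> S\<close>] this] show ?thesis
      by (simp add: power_mult_distrib)
  qed
  have "(\<lambda>n. 4 * ((2 * \<eta>) * (G n \<bullet> u)) * (2 * \<eta>)) \<longlonglongrightarrow> 4 * ((2 * \<eta>) * (u \<bullet> u)) * (2 * \<eta>)"
    by (intro tendsto_intros G(2))
  moreover have "(\<lambda>n. 2 * (norm g)\<^sup>2 + 2 * ((2 * \<eta>)\<^sup>2 * (norm (G n))\<^sup>2))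
      \<longlonglongrightarrow> 2 * (norm g)\<^sup>2 + 2 * ((2 * \<eta>)\<^sup>2 * (norm u)\<^sup>2)"
    by (intro tendsto_intros G(2))
  ultimately have "4 * ((2 * \<eta>) * (u \<bullet> u)) * (2 * \<eta>) \<le> 2 * (norm g)\<^sup>2 + 2 * ((2 * \<eta>)\<^sup>2 * (norm u)\<^sup>2)"
    by (rule LIMSEQ_le) (use est in blast)
  then have "(2 * \<eta> * norm u)\<^sup>2 \<le> (norm g)\<^sup>2"
    by (simp add: power2_norm_eq_inner power_mult_distrib) (simp add: power2_eq_square)
  then show ?thesis unfolding g_def by (rule power2_le_imp_le) simp
qed

end

text \<open>
  \<open>s\<close> is the limit of the max-min values of \<open>R\<close>. Enlarging a finite set \<open>B\<close> by its image under \<open>R\<close>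
  keeps \<open>s - R\<close> inside the orthogonal complement of \<open>B\<close>.
\<close>

lemma weyl_vectors:
  fixes R :: "'h::real_inner \<Rightarrow> 'h"
  assumes R: "bounded_linear R" and R_sym: "\<And>u v. R u \<bullet> v = u \<bullet> R v"
    and r: "\<And>B. finite B \<Longrightarrow> \<exists>u. norm u = 1 \<and> (\<forall>b\<in>B. u \<bullet> b = 0) \<and> r \<le> R u \<bullet> u"
  shows "\<exists>s\<ge>r. \<forall>B e. finite B \<longrightarrow> 0 < e \<longrightarrow>
    (\<exists>u. norm u = 1 \<and> (\<forall>b\<in>B. u \<bullet> b = 0) \<and> norm (R u - s *\<^sub>R u) < e)"
proof -
  interpret R: bounded_linear R by (rule R)
  obtain K where K: "K > 0" "\<And>u. norm (R u) \<le> norm u * K" using R.pos_bounded by blast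
  define D where "D B = {R u \<bullet> u | u. norm u = 1 \<and> (\<forall>b\<in>B. u \<bullet> b = 0)}" for B
  define M where "M B = Sup (D B)" for B
  have DK: "y \<le> K" if y: "y \<in> D B" for y B
  proof -
    obtain u where u: "y = R u \<bullet> u" "norm u = 1" using y unfolding D_def by blast
    then show ?thesis using norm_cauchy_schwarz[of "R u" u] K(2)[of u] by simp
  qed
  have bdd: "bdd_above (D B)" for B using DK by (intro bdd_aboveI) blast
  have Mr: "r \<le> M B" if B: "finite B" for B
  proof -
    obtain u where u: "norm u = 1" "\<forall>b\<in>B. u \<bullet> b = 0" "r \<le> R u \<bullet> u" using r[OF B] by blast
    then have "R u \<bullet> u \<in> D B" by (auto simp: D_def)
    then have "R u \<bullet> u \<le> M B" unfolding M_def using bdd by (rule cSup_upper)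
    then show ?thesis using u(3) by simp
  qed
  define s where "s = Inf (M ` Collect finite)"
  have bdd_M: "bdd_below (M ` Collect finite)" using Mr by (intro bdd_belowI[of _ r]) auto
  have sr: "r \<le> s" unfolding s_def using Mr by (intro cInf_greatest) auto
  have sM: "s \<le> M B" if "finite B" for B unfolding s_def using that bdd_M by (intro cInf_lower) auto
  have "\<exists>u. norm u = 1 \<and> (\<forall>b\<in>B. u \<bullet> b = 0) \<and> norm (R u - s *\<^sub>R u) < e"
    if B: "finite B" and e: "0 < e" for B e
  proof -
    define A where "A t u = (s + t) *\<^sub>R u - R u" for t u
    define L where "L = \<bar>s\<bar> + 1 + K"
    have L: "L > 0" using K(1) by (simp add: L_def)
    \<comment> \<open>The bound \<open>e / 4\<close> controls the term \<open>t *\<^sub>R u\<close>,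
      and \<open>e\<^sup>2 / (16 * L)\<close> makes \<open>2 * t * L\<close>, which bounds the
      square of \<open>norm (A t u)\<close>, at most \<open>e\<^sup>2 / 8\<close>.\<close>
    define t where "t = min 1 (min (e / 4) (e\<^sup>2 / (16 * L)))"
    have t: "t > 0" "t \<le> 1" "t \<le> e / 4" "t \<le> e\<^sup>2 / (16 * L)" using e L by (auto simp: t_def)
    have "Inf (M ` Collect finite) < s + t" using t by (simp add: s_def)
    then obtain B0 where B0: "finite B0" "M B0 < s + t"
      using cInf_lessD[of "M ` Collect finite" "s + t"] by blast
    define B1 where "B1 = B \<union> B0 \<union> R ` B0"
    have "finite B1" using B B0 by (simp add: B1_def)
    then have "s - t < Sup (D B1)" using sM t(1) unfolding M_def[symmetric] by fastforce
    moreover have "D B1 \<noteq> {}" using r[OF \<open>finite B1\<close>] by (auto simp: D_def)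
    ultimately obtain y where "y \<in> D B1" "s - t < y" using less_cSupD by metis
    then obtain u where u: "norm u = 1" "\<forall>b\<in>B1. u \<bullet> b = 0" "s - t < R u \<bullet> u" by (auto simp: D_def)
    define G where "G = {w. \<forall>b\<in>B0. w \<bullet> b = 0}"
    have G: "subspace G" by (auto simp: G_def subspace_def inner_add_left)
    \<comment> \<open>\<open>M B0 < s + t\<close> makes \<open>s + t - R\<close> a nonnegative form
      on the complement of \<open>B0\<close>.\<close>
    have nonneg: "0 \<le> A t w \<bullet> w" if w: "w \<in> G" for w
    proof (cases "w = 0")
      case False
      define n where "n = inverse (norm w)"
      have "norm (n *\<^sub>R w) = 1" using False by (simp add: n_def)
      moreover have "\<forall>b\<in>B0. (n *\<^sub>R w) \<bullet> b = 0" using w by (auto simp: G_def)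
      ultimately have "R (n *\<^sub>R w) \<bullet> (n *\<^sub>R w) \<in> D B0" unfolding D_def by blast
      then have "R (n *\<^sub>R w) \<bullet> (n *\<^sub>R w) \<le> M B0" unfolding M_def using bdd by (rule cSup_upper)
      then have "n\<^sup>2 * (R w \<bullet> w) \<le> s + t" using B0(2) by (simp add: R.scaleR power2_eq_square)
      then have "R w \<bullet> w \<le> (s + t) * (norm w)\<^sup>2"
        using False by (simp add: n_def power_inverse field_simps)
      then show ?thesis by (simp add: A_def inner_diff_left power2_norm_eq_inner)
    qed (simp add: A_def)
    have A_add: "A t (x + y) = A t x + A t y" and A_scale: "A t (c *\<^sub>R x) = c *\<^sub>R A t x" for x y c
      by (simp_all add: A_def R.add R.scaleR algebra_simps)
    have A_sym: "A t x \<bullet> y = A t y \<bullet> x" for x y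
      using inner_commute[of x y] inner_commute[of x "R y"] by (simp add: A_def inner_diff_left R_sym[of x])
    interpret psd_form G "\<lambda>x y. A t x \<bullet> y"
      by (rule psd_form.intro[OF G _ _ A_sym nonneg]) (simp_all add: A_add A_scale inner_add_left)
    have uG: "u \<in> G" using u(2) by (auto simp: G_def B1_def)
    have "A t u \<bullet> b = 0" if "b \<in> B0" for b
      using that u(2) R_sym[of u b] by (auto simp: A_def inner_diff_left B1_def)
    then have AG: "A t u \<in> G" by (simp add: G_def)
    have AL: "norm (A t w) \<le> L * norm w" for w
    proof -
      have "norm (A t w) \<le> \<bar>s + t\<bar> * norm w + norm w * K"
        unfolding A_def using norm_triangle_ineq4[of "(s + t) *\<^sub>R w" "R w"] K(2)[of w] by simp
      also have "\<dots> = (\<bar>s + t\<bar> + K) * norm w" by (simp add: algebra_simps)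
      also have "\<dots> \<le> L * norm w" using t by (intro mult_right_mono) (auto simp: L_def)
      finally show ?thesis .
    qed
    have "A t u \<bullet> u = s + t - R u \<bullet> u"
      using u(1) by (simp add: A_def inner_diff_left power2_norm_eq_inner[symmetric])
    then have Au: "A t u \<bullet> u \<le> 2 * t" using u(3) by simp
    \<comment> \<open>A small value of a nonnegative form forces a small vector: Cauchy-Schwarz with
      \<open>A t u\<close> as second argument, which is admissible because \<open>B1\<close>
      contains the image of \<open>B0\<close> under \<open>R\<close>.\<close>
    have "((norm (A t u))\<^sup>2)\<^sup>2 \<le> (A t u \<bullet> u) * (A t (A t u) \<bullet> A t u)"
      using cauchy_schwarz[OF uG AG] by (simp add: power2_norm_eq_inner)
    also have "\<dots> \<le> (2 * t) * (L * (norm (A t u))\<^sup>2)"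
    proof (intro mult_mono)
      have "A t (A t u) \<bullet> A t u \<le> norm (A t (A t u)) * norm (A t u)" by (rule norm_cauchy_schwarz)
      also have "\<dots> \<le> L * norm (A t u) * norm (A t u)" by (intro mult_right_mono AL) simp
      finally show "A t (A t u) \<bullet> A t u \<le> L * (norm (A t u))\<^sup>2" by (simp add: power2_eq_square)
    qed (use Au nonneg[OF AG] t(1) in auto)
    finally have "(norm (A t u))\<^sup>2 * (norm (A t u))\<^sup>2 \<le> (2 * t * L) * (norm (A t u))\<^sup>2"
      by (simp add: power2_eq_square mult_ac)
    then have "A t u \<noteq> 0 \<Longrightarrow> (norm (A t u))\<^sup>2 \<le> 2 * t * L"
      by (rule mult_right_le_imp_le) simp
    then have "(norm (A t u))\<^sup>2 \<le> 2 * t * L" using t(1) L by (cases "A t u = 0") auto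
    also have "\<dots> \<le> e\<^sup>2 / 8" using mult_right_mono[OF t(4), of "2 * L"] L by (simp add: field_simps)
    also have "\<dots> \<le> (e / 2)\<^sup>2" by (simp add: power_divide)
    finally have "norm (A t u) \<le> e / 2" using e power2_le_imp_le[of "norm (A t u)" "e / 2"] by simp
    moreover have "R u - s *\<^sub>R u = t *\<^sub>R u - A t u" by (simp add: A_def algebra_simps)
    ultimately have "norm (R u - s *\<^sub>R u) < e"
      using norm_triangle_ineq4[of "t *\<^sub>R u" "A t u"] u(1) t e by simp
    then show ?thesis using u by (auto simp: B1_def)
  qed
  then show ?thesis using sr by blast
qed

text \<open>\<open>R\<close> is the inverse of \<open>T + c\<close>, and \<open>1 / s - c\<close> is
  the point of \<open>T\<close> that belongs to \<open>s\<close>. An estimate for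
  \<open>T - x\<close> on the complement of a finite set, which either regularity or an isolated
  eigenvalue would supply, fails at \<open>R u\<close> for a Weyl vector \<open>u\<close>.\<close>

lemma (in selfadjoint_relation) essential_spectrum_point:
  assumes R: "bounded_linear R" and R_sym: "\<And>u v. R u \<bullet> v = u \<bullet> R v"
    and S: "\<And>f. (R f, f - c *\<^sub>R R f) \<in> S"
    and "r > 0"
    and r: "\<And>B. finite B \<Longrightarrow> \<exists>u. norm u = 1 \<and> (\<forall>b\<in>B. u \<bullet> b = 0) \<and> r \<le> R u \<bullet> u"
  shows "\<exists>x. x \<le> 1 / r - c \<and> \<not> regular (complex_of_real x) \<and> \<not> isolated_eigenvalue (complex_of_real x)"
proof -
  obtain s where s: "r \<le> s" "\<And>B e. finite B \<Longrightarrow> 0 < e \<Longrightarrow>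
      \<exists>u. norm u = 1 \<and> (\<forall>b\<in>B. u \<bullet> b = 0) \<and> norm (R u - s *\<^sub>R u) < e"
    using weyl_vectors[OF R R_sym r] by blast
  have "s > 0" using s(1) \<open>r > 0\<close> by simp
  define x where "x = 1 / s - c"
  have no: False if B: "finite B"
    and k: "\<And>u v. (u, v) \<in> S \<Longrightarrow> \<forall>b\<in>B. u \<bullet> b = 0 \<Longrightarrow> norm u \<le> k * norm (v - x *\<^sub>R u)" for B k
  proof -
    define m where "m = 1 + \<bar>k\<bar> / s"
    define e where "e = s / (2 * m)"
    have den: "m > 0" using \<open>s > 0\<close> by (simp add: m_def add_pos_nonneg)
    have e: "e > 0" using \<open>s > 0\<close> den by (simp add: e_def)
    \<comment> \<open>Orthogonality of \<open>u\<close> to the image of \<open>B\<close> under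
      \<open>R\<close> is orthogonality of \<open>R u\<close> to \<open>B\<close>.\<close>
    obtain u where u: "norm u = 1" "\<forall>b\<in>R ` B. u \<bullet> b = 0" "norm (R u - s *\<^sub>R u) < e"
      using s(2)[of "R ` B" e] B e by blast
    have "(u - c *\<^sub>R R u) - x *\<^sub>R R u = (- (1 / s)) *\<^sub>R (R u - s *\<^sub>R u)"
      using \<open>s > 0\<close> by (simp add: x_def algebra_simps)
    then have "norm (R u) \<le> k * ((1 / s) * norm (R u - s *\<^sub>R u))"
      using k[OF S[of u]] u(2) R_sym \<open>s > 0\<close> by simp
    also have "\<dots> \<le> \<bar>k\<bar> * ((1 / s) * e)"
      using u(3) \<open>s > 0\<close> by (intro mult_mono mult_left_mono) auto
    finally have 1: "norm (R u) \<le> \<bar>k\<bar> / s * e" by simp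
    have "s = norm (R u - (R u - s *\<^sub>R u))" using u(1) \<open>s > 0\<close> by simp
    also have "\<dots> \<le> norm (R u) + norm (R u - s *\<^sub>R u)" by (rule norm_triangle_ineq4)
    also have "\<dots> < m * e" using 1 u(3) by (simp add: m_def distrib_right)
    also have "\<dots> = s / 2" using den by (simp add: e_def)
    finally show False using \<open>s > 0\<close> by simp
  qed
  have "\<not> regular (complex_of_real x)"
  proof
    assume "regular (complex_of_real x)"
    then obtain k where "\<forall>p\<in>S. norm (fst p) \<le> k * norm (shift (complex_of_real x) p)"
      unfolding regular_def by blast
    then show False by (intro no[of "{}" k]) auto
  qed
  moreover have "\<not> isolated_eigenvalue (complex_of_real x)"
  proof
    assume "isolated_eigenvalue (complex_of_real x)"
    then obtain B d where B: "finite B" "\<And>u. (u, x *\<^sub>R u) \<in> S \<Longrightarrow> u \<in> span B"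
      and d: "d > 0" "\<And>z'. z' \<noteq> complex_of_real x \<Longrightarrow> cmod (z' - complex_of_real x) < d \<Longrightarrow> regular z'"
      unfolding isolated_eigenvalue_def by auto
    show False
    proof (rule no[OF B(1), of "1 / d"])
      fix u v assume uv: "(u, v) \<in> S" "\<forall>b\<in>B. u \<bullet> b = 0"
      have "2 * (d / 2) * norm u \<le> norm (v - x *\<^sub>R u)"
      proof (rule isolated_kernel_complement_bound[OF _ _ uv(1)])
        fix y assume "y \<noteq> x" "\<bar>y - x\<bar> < 2 * (d / 2)"
        then show "regular (complex_of_real y)"
          by (intro d(2)) (auto simp flip: of_real_diff)
      next
        fix w assume "(w, x *\<^sub>R w) \<in> S"
        then have "w \<in> span B" by (rule B(2))
        then show "u \<bullet> w = 0"
          by (induction rule: span_induct_alt) (use uv(2) in \<open>auto simp: inner_add_right\<close>)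
      qed (use d in simp)
      then show "norm u \<le> 1 / d * norm (v - x *\<^sub>R u)" using d(1) by (simp add: field_simps)
    qed
  qed
  moreover have "x \<le> 1 / r - c"
    unfolding x_def using s(1) \<open>r > 0\<close> by (simp add: frac_le)
  ultimately show ?thesis by blast
qed

subsection \<open>The Hilbert space of square integrable functions\<close>

lemma square_norm_add_le: "(cmod (u + v))\<^sup>2 \<le> 2 * (cmod u)\<^sup>2 + 2 * (cmod v)\<^sup>2"
proof -
  have "(cmod (u + v))\<^sup>2 \<le> (cmod u + cmod v)\<^sup>2"
    by (intro power_mono norm_triangle_ineq) simp
  also have "\<dots> \<le> 2 * (cmod u)\<^sup>2 + 2 * (cmod v)\<^sup>2"
    using zero_le_power2[of "cmod u - cmod v"] by (simp add: power2_sum power2_diff)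
  finally show ?thesis .
qed

lemma norm_mult_le_squares: "cmod u * cmod v \<le> (cmod u)\<^sup>2 + (cmod v)\<^sup>2"
proof -
  have "2 * (cmod u * cmod v) \<le> (cmod u)\<^sup>2 + (cmod v)\<^sup>2"
    using zero_le_power2[of "cmod u - cmod v"] by (simp add: power2_diff)
  moreover have "0 \<le> cmod u * cmod v" by simp
  ultimately show ?thesis by linarith
qed

lemma L2_measurable [measurable_dest]: "f \<in> L2 \<Longrightarrow> f \<in> borel_measurable borel"
  by (simp add: L2_def)

lemma borel_measurable_cnj [measurable]: "cnj \<in> borel_measurable borel"
  by (intro borel_measurable_continuous_onI continuous_intros)

lemma L2_integrable: "f \<in> L2 \<Longrightarrow> integrable lborel (\<lambda>x. (cmod (f x))\<^sup>2)"
  by (simp add: L2_def)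

lemma L2I:
  assumes "f \<in> borel_measurable lborel" "integrable lborel g" "\<And>x. (cmod (f x))\<^sup>2 \<le> g x"
  shows "f \<in> L2"
proof -
  have "integrable lborel (\<lambda>x. (cmod (f x))\<^sup>2)"
  proof (rule Bochner_Integration.integrable_bound[OF assms(2)])
    show "(\<lambda>x. (cmod (f x))\<^sup>2) \<in> borel_measurable lborel" using assms(1) by measurable
    have "norm ((cmod (f x))\<^sup>2) \<le> norm (g x)" for x
      using assms(3)[of x] by simp
    then show "AE x in lborel. norm ((cmod (f x))\<^sup>2) \<le> norm (g x)" by simp
  qed
  then show ?thesis using assms(1) by (simp add: L2_def)
qed

lemma L2_zero: "(\<lambda>x. 0) \<in> L2"
  by (simp add: L2_def)

lemma L2_add:
  assumes "f \<in> L2" "g \<in> L2"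
  shows "(\<lambda>x. f x + g x) \<in> L2"
proof (rule L2I)
  show "integrable lborel (\<lambda>x. 2 * (cmod (f x))\<^sup>2 + 2 * (cmod (g x))\<^sup>2)"
    using assms L2_integrable by auto
  show "(cmod (f x + g x))\<^sup>2 \<le> 2 * (cmod (f x))\<^sup>2 + 2 * (cmod (g x))\<^sup>2" for x
    by (rule square_norm_add_le)
qed (use assms in measurable)

lemma L2_mult: "f \<in> L2 \<Longrightarrow> (\<lambda>x. c * f x) \<in> L2"
  by (auto simp: L2_def norm_mult power_mult_distrib)

lemma L2_scaleR: "f \<in> L2 \<Longrightarrow> (\<lambda>x. r *\<^sub>R f x) \<in> L2"
  using L2_mult[of f "of_real r"] by (simp add: scaleR_conv_of_real)

lemma L2_uminus: "f \<in> L2 \<Longrightarrow> (\<lambda>x. - f x) \<in> L2"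
  by (auto simp: L2_def)

lemma L2_diff: "f \<in> L2 \<Longrightarrow> g \<in> L2 \<Longrightarrow> (\<lambda>x. f x - g x) \<in> L2"
  using L2_add[OF _ L2_uminus[of g]] by simp

lemma L2_norm_mult_integrable:
  assumes "f \<in> L2" "g \<in> L2"
  shows "integrable lborel (\<lambda>x. cmod (f x) * cmod (g x))"
proof (rule Bochner_Integration.integrable_bound)
  show "integrable lborel (\<lambda>x. (cmod (f x))\<^sup>2 + (cmod (g x))\<^sup>2)" using assms L2_integrable by auto
  have "norm (cmod (f x) * cmod (g x)) \<le> norm ((cmod (f x))\<^sup>2 + (cmod (g x))\<^sup>2)" for x
    using norm_mult_le_squares[of "f x" "g x"] by (simp add: abs_mult)
  then show "AE x in lborel. norm (cmod (f x) * cmod (g x)) \<le> norm ((cmod (f x))\<^sup>2 + (cmod (g x))\<^sup>2)"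
    by simp
qed (use assms in measurable)

lemma L2_mult_cnj_integrable:
  assumes "f \<in> L2" "g \<in> L2"
  shows "integrable lborel (\<lambda>x. f x * cnj (g x))"
proof (rule Bochner_Integration.integrable_bound[OF L2_norm_mult_integrable[OF assms]])
  show "(\<lambda>x. f x * cnj (g x)) \<in> borel_measurable lborel" using assms by measurable
qed (simp add: norm_mult)

definition L2_eq :: "(real \<Rightarrow> complex) \<Rightarrow> (real \<Rightarrow> complex) \<Rightarrow> bool" where
  "L2_eq f g \<longleftrightarrow> f \<in> L2 \<and> g \<in> L2 \<and> (AE x in lborel. f x = g x)"

\<comment> \<open>Only partial: functions outside \<open>L2\<close> are not related to themselves,
  so they form no class.\<close>
quotient_type l2 = "real \<Rightarrow> complex" / partial: L2_eq
proof (rule part_equivpI)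
  show "\<exists>f. L2_eq f f" using L2_zero by (auto simp: L2_eq_def)
  show "symp L2_eq" by (rule sympI) (auto simp: L2_eq_def elim: AE_mp)
  show "transp L2_eq"
  proof (rule transpI)
    fix f g h assume a: "L2_eq f g" "L2_eq g h"
    then have "AE x in lborel. f x = g x" "AE x in lborel. g x = h x" by (auto simp: L2_eq_def)
    then have "AE x in lborel. f x = h x" by eventually_elim simp
    then show "L2_eq f h" using a by (simp add: L2_eq_def)
  qed
qed

lemma L2_inner_cong:
  assumes "L2_eq f f'" "L2_eq g g'"
  shows "L2_inner f g = L2_inner f' g'"
  unfolding L2_inner_def
proof (rule integral_cong_AE)
  have "AE x in lborel. f x = f' x" "AE x in lborel. g x = g' x" using assms by (auto simp: L2_eq_def)
  then show "AE x in lborel. f x * cnj (g x) = f' x * cnj (g' x)" by eventually_elim simp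
  have "f \<in> L2" "g \<in> L2" "f' \<in> L2" "g' \<in> L2" using assms by (auto simp: L2_eq_def)
  then show "(\<lambda>x. f x * cnj (g x)) \<in> borel_measurable lborel" "(\<lambda>x. f' x * cnj (g' x)) \<in> borel_measurable lborel"
    by measurable
qed

instantiation l2 :: real_inner
begin

lift_definition zero_l2 :: l2 is "\<lambda>x. 0"
  using L2_zero by (simp add: L2_eq_def)

lift_definition plus_l2 :: "l2 \<Rightarrow> l2 \<Rightarrow> l2" is "\<lambda>f g x. f x + g x"
proof -
  fix f f' g g' assume a: "L2_eq f f'" "L2_eq g g'"
  then have "AE x in lborel. f x = f' x" "AE x in lborel. g x = g' x" by (auto simp: L2_eq_def)
  then have "AE x in lborel. f x + g x = f' x + g' x" by eventually_elim simp
  then show "L2_eq (\<lambda>x. f x + g x) (\<lambda>x. f' x + g' x)" using a by (simp add: L2_eq_def L2_add)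
qed

lift_definition uminus_l2 :: "l2 \<Rightarrow> l2" is "\<lambda>f x. - f x"
  by (auto simp: L2_eq_def L2_uminus elim: AE_mp)

lift_definition minus_l2 :: "l2 \<Rightarrow> l2 \<Rightarrow> l2" is "\<lambda>f g x. f x - g x"
proof -
  fix f f' g g' assume a: "L2_eq f f'" "L2_eq g g'"
  then have "AE x in lborel. f x = f' x" "AE x in lborel. g x = g' x" by (auto simp: L2_eq_def)
  then have "AE x in lborel. f x - g x = f' x - g' x" by eventually_elim simp
  then show "L2_eq (\<lambda>x. f x - g x) (\<lambda>x. f' x - g' x)" using a by (simp add: L2_eq_def L2_diff)
qed

lift_definition scaleR_l2 :: "real \<Rightarrow> l2 \<Rightarrow> l2" is "\<lambda>r f x. r *\<^sub>R f x"
  by (auto simp: L2_eq_def L2_scaleR elim: AE_mp)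

lift_definition inner_l2 :: "l2 \<Rightarrow> l2 \<Rightarrow> real" is "\<lambda>f g. Re (L2_inner f g)"
  by (simp add: L2_inner_cong)

definition "norm_l2 (u :: l2) = sqrt (u \<bullet> u)"
definition "dist_l2 (u :: l2) v = norm (u - v)"
definition "sgn_l2 (u :: l2) = inverse (norm u) *\<^sub>R u"
definition [code del]: "uniformity_l2 = (INF e\<in>{0<..}. principal {(x :: l2, y). dist x y < e})"
definition [code del]: "open_l2 (S :: l2 set) \<longleftrightarrow> (\<forall>x\<in>S. \<forall>\<^sub>F (x', y) in uniformity. x' = x \<longrightarrow> y \<in> S)"

instance
proof
  show "(a + b) + c = a + (b + c)" for a b c :: l2
    by transfer (auto simp: L2_eq_def L2_add algebra_simps)
  show "a + b = b + a" for a b :: l2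
    by transfer (auto simp: L2_eq_def L2_add algebra_simps)
  show "0 + a = a" for a :: l2 by transfer (auto simp: L2_eq_def)
  show "- a + a = 0" for a :: l2 by transfer (auto simp: L2_eq_def L2_zero)
  show "a - b = a + - b" for a b :: l2
    by transfer (auto simp: L2_eq_def L2_diff)
  show "r *\<^sub>R (x + y) = r *\<^sub>R x + r *\<^sub>R y" for r and x y :: l2
    by transfer (auto simp: L2_eq_def L2_add L2_scaleR L2_mult scaleR_add_right)
  show "(r + s) *\<^sub>R x = r *\<^sub>R x + s *\<^sub>R x" for r s and x :: l2
    by transfer (auto simp: L2_eq_def L2_add L2_scaleR scaleR_add_left)
  show "r *\<^sub>R s *\<^sub>R x = (r * s) *\<^sub>R x" for r s and x :: l2
    by transfer (auto simp: L2_eq_def L2_scaleR)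
  show "1 *\<^sub>R x = x" for x :: l2 by transfer (auto simp: L2_eq_def)
  show "dist x y = norm (x - y)" for x y :: l2 by (rule dist_l2_def)
  show "sgn x = inverse (norm x) *\<^sub>R x" for x :: l2 by (rule sgn_l2_def)
  show "uniformity = (INF e\<in>{0<..}. principal {(x :: l2, y). dist x y < e})" by (rule uniformity_l2_def)
  show "open S \<longleftrightarrow> (\<forall>x\<in>S. \<forall>\<^sub>F (x', y) in uniformity. x' = x \<longrightarrow> y \<in> S)" for S :: "l2 set"
    by (rule open_l2_def)
  show "norm x = sqrt (x \<bullet> x)" for x :: l2 by (rule norm_l2_def)
  show "x \<bullet> y = y \<bullet> x" for x y :: l2
  proof transfer
    fix f g
    have "L2_inner g f = cnj (L2_inner f g)"
      unfolding L2_inner_def Bochner_Integration.integral_cnj[symmetric] by (simp add: mult.commute)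
    then show "Re (L2_inner f g) = Re (L2_inner g f)" by simp
  qed
  show "(x + y) \<bullet> z = x \<bullet> z + y \<bullet> z" for x y z :: l2
    by transfer (simp add: L2_eq_def L2_inner_def L2_mult_cnj_integrable distrib_right)
  show "r *\<^sub>R x \<bullet> y = r * (x \<bullet> y)" for r and x y :: l2
    by transfer (simp add: L2_eq_def L2_inner_def)
  have sq: "Re (L2_inner f f) = (LINT x|lborel. (cmod (f x))\<^sup>2)" for f
    unfolding L2_inner_def complex_norm_square[symmetric] of_real_power[symmetric] integral_complex_of_real by simp
  show "0 \<le> x \<bullet> x" for x :: l2
    by transfer (simp add: sq)
  show "x \<bullet> x = 0 \<longleftrightarrow> x = 0" for x :: l2
  proof transfer
    fix f assume "L2_eq f f"
    then have "f \<in> L2" by (simp add: L2_eq_def)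
    then show "Re (L2_inner f f) = 0 \<longleftrightarrow> L2_eq f (\<lambda>x. 0)"
      unfolding sq L2_eq_def
      by (subst integral_nonneg_eq_0_iff_AE) (auto simp: L2_integrable L2_zero)
  qed
qed

end

section \<open>Representatives, norms and limits in \<open>l2\<close>\<close>

lemma abs_l2_eq_iff: "f \<in> L2 \<Longrightarrow> g \<in> L2 \<Longrightarrow> abs_l2 f = abs_l2 g \<longleftrightarrow> (AE x in lborel. f x = g x)"
  using Quotient3_rel[OF Quotient3_l2, of f g] by (auto simp: L2_eq_def)

lemma l2_cases: obtains f where "f \<in> L2" "u = abs_l2 f"
  by (metis L2_eq_def Quotient3_abs_rep Quotient3_l2 Quotient3_rep_reflp)

lemma abs_l2_add: "f \<in> L2 \<Longrightarrow> g \<in> L2 \<Longrightarrow> abs_l2 f + abs_l2 g = abs_l2 (\<lambda>x. f x + g x)"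
  by (simp add: plus_l2.abs_eq L2_eq_def)

lemma abs_l2_diff: "f \<in> L2 \<Longrightarrow> g \<in> L2 \<Longrightarrow> abs_l2 f - abs_l2 g = abs_l2 (\<lambda>x. f x - g x)"
  by (simp add: minus_l2.abs_eq L2_eq_def)

lemma abs_l2_scaleR: "f \<in> L2 \<Longrightarrow> r *\<^sub>R abs_l2 f = abs_l2 (\<lambda>x. r *\<^sub>R f x)"
  by (simp add: scaleR_l2.abs_eq L2_eq_def)

lemma abs_l2_inner: "f \<in> L2 \<Longrightarrow> g \<in> L2 \<Longrightarrow> abs_l2 f \<bullet> abs_l2 g = Re (L2_inner f g)"
  by (simp add: inner_l2.abs_eq L2_eq_def)

lemma L2_inner_self: "L2_inner f f = of_real ((L2_norm f)\<^sup>2)"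
proof -
  have "0 \<le> (LINT x|lborel. (cmod (f x))\<^sup>2)" by simp
  then show ?thesis
    unfolding L2_inner_def L2_norm_def complex_norm_square[symmetric] of_real_power[symmetric] integral_complex_of_real
    by simp
qed

lemma abs_l2_norm: "f \<in> L2 \<Longrightarrow> norm (abs_l2 f) = L2_norm f"
  by (simp add: norm_eq_sqrt_inner abs_l2_inner L2_inner_self) (simp add: L2_norm_def)

lemma L2_norm_nonneg [simp]: "0 \<le> L2_norm f"
  by (simp add: L2_norm_def)

text \<open>Takes the role of \<open>J\<close> in \<open>selfadjoint_relation\<close>.\<close>

lift_definition imul :: "l2 \<Rightarrow> l2" is "\<lambda>f x. \<i> * f x"
  by (auto simp: L2_eq_def L2_mult elim: AE_mp)

lemma abs_l2_imul: "f \<in> L2 \<Longrightarrow> imul (abs_l2 f) = abs_l2 (\<lambda>x. \<i> * f x)"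
  by (simp add: imul.abs_eq L2_eq_def)

text \<open>Passing to the moduli first makes the integral an inner product of two elements of
  \<open>l2\<close>.\<close>

lemma L2_Cauchy_Schwarz:
  assumes "f \<in> L2" "g \<in> L2"
  shows "(LINT x|lborel. cmod (f x) * cmod (g x)) \<le> L2_norm f * L2_norm g"
proof -
  have c: "(\<lambda>x. complex_of_real (cmod (f x))) \<in> L2" if "f \<in> L2" for f
    using that by (auto simp: L2_def)
  have "abs_l2 (\<lambda>x. complex_of_real (cmod (f x))) \<bullet> abs_l2 (\<lambda>x. complex_of_real (cmod (g x)))
      \<le> norm (abs_l2 (\<lambda>x. complex_of_real (cmod (f x)))) * norm (abs_l2 (\<lambda>x. complex_of_real (cmod (g x))))"
    by (rule norm_cauchy_schwarz)
  then show ?thesis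
    using assms by (simp add: c abs_l2_inner abs_l2_norm L2_inner_def L2_norm_def flip: of_real_mult)
qed

lemma nn_integral_L2_norm: "f \<in> L2 \<Longrightarrow> (\<integral>\<^sup>+x. ennreal ((cmod (f x))\<^sup>2) \<partial>lborel) = ennreal ((L2_norm f)\<^sup>2)"
  by (simp add: L2_norm_def nn_integral_eq_integral L2_integrable)

text \<open>Balls of \<open>L2\<close> are closed under limits almost everywhere, by Fatou's lemma.
  This identifies limits both for completeness and for the closed graph.\<close>

lemma L2_Fatou:
  assumes f: "\<And>n. f n \<in> L2" "\<And>n. L2_norm (f n) \<le> K" and g: "g \<in> borel_measurable lborel"
    and lim: "AE x in lborel. (\<lambda>n. f n x) \<longlonglongrightarrow> g x"
  shows "g \<in> L2" "L2_norm g \<le> K"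
proof -
  have K: "0 \<le> K" using f(2)[of 0] L2_norm_nonneg[of "f 0"] by linarith
  have "AE x in lborel. ennreal ((cmod (g x))\<^sup>2) = liminf (\<lambda>n. ennreal ((cmod (f n x))\<^sup>2))"
    using lim
  proof eventually_elim
    case (elim x)
    have "(\<lambda>n. ennreal ((cmod (f n x))\<^sup>2)) \<longlonglongrightarrow> ennreal ((cmod (g x))\<^sup>2)"
      by (intro tendsto_ennrealI tendsto_power tendsto_norm elim)
    then show ?case using lim_imp_Liminf[OF sequentially_bot] by force
  qed
  then have "(\<integral>\<^sup>+x. ennreal ((cmod (g x))\<^sup>2) \<partial>lborel) = (\<integral>\<^sup>+x. liminf (\<lambda>n. ennreal ((cmod (f n x))\<^sup>2)) \<partial>lborel)"
    by (rule nn_integral_cong_AE)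
  also have "\<dots> \<le> liminf (\<lambda>n. \<integral>\<^sup>+x. ennreal ((cmod (f n x))\<^sup>2) \<partial>lborel)"
    using L2_measurable[OF f(1)] by (intro nn_integral_liminf) measurable
  also have "\<dots> = liminf (\<lambda>n. ennreal ((L2_norm (f n))\<^sup>2))" using f(1) by (simp add: nn_integral_L2_norm)
  also have "\<dots> \<le> ennreal (K\<^sup>2)"
    using f(2) by (intro Liminf_le always_eventually) (auto intro!: ennreal_leI power_mono)
  finally have le: "(\<integral>\<^sup>+x. ennreal ((cmod (g x))\<^sup>2) \<partial>lborel) \<le> ennreal (K\<^sup>2)" .
  have "(\<integral>\<^sup>+x. ennreal ((cmod (g x))\<^sup>2) \<partial>lborel) < \<infinity>" using le_less_trans[OF le ennreal_less_top] by simp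
  then have "integrable lborel (\<lambda>x. (cmod (g x))\<^sup>2)"
    using g by (intro integrableI_bounded) auto
  then show gL: "g \<in> L2" using g by (simp add: L2_def)
  from le have "(L2_norm g)\<^sup>2 \<le> K\<^sup>2"
    unfolding nn_integral_L2_norm[OF gL] using K by simp
  then show "L2_norm g \<le> K" using K by (rule power2_le_imp_le)
qed

text \<open>The square root of a positive integrable function, which exists by sigma-finiteness. It
  serves as a weight because elements of \<open>L2\<close> need not be integrable over the
  line.\<close>

lemma L2_positive_function: "\<exists>w. (\<lambda>x. complex_of_real (w x)) \<in> L2 \<and> (\<forall>x. 0 < w x)"
proof -
  obtain h where h: "h \<in> borel_measurable lborel" "integral\<^sup>N lborel h \<noteq> \<infinity>"
      "\<And>x::real. 0 < h x \<and> h x < \<infinity>"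
    using sigma_finite_measure.Ex_finite_integrable_function[OF sigma_finite_lborel] by auto
  define w where "w x = sqrt (enn2real (h x))" for x
  have h_eq: "ennreal (enn2real (h x)) = h x" for x
    using h(3)[of x] by (intro ennreal_enn2real) auto
  have "integrable lborel (\<lambda>x. enn2real (h x))"
    using h by (intro integrableI_bounded) (auto simp: h_eq less_top)
  then have "(\<lambda>x. complex_of_real (w x)) \<in> L2"
    using h(1) unfolding L2_def w_def by (auto simp: enn2real_nonneg)
  moreover have "0 < w x" for x
    using h(3)[of x] by (simp add: w_def enn2real_positive_iff)
  ultimately show ?thesis by blast
qed

text \<open>
  After multiplication by a positive function in \<open>L\<^sup>2\<close> a Cauchy sequence in \<open>L\<^sup>2\<close> is one in \<open>L\<^sup>1\<close>,
  so a subsequence converges almost everywhere.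
\<close>

lemma L2_complete:
  fixes s :: "nat \<Rightarrow> real \<Rightarrow> complex"
  assumes s: "\<And>n. s n \<in> L2"
    and cauchy: "\<And>e. e > 0 \<Longrightarrow> \<exists>N. \<forall>i\<ge>N. \<forall>j\<ge>N. L2_norm (\<lambda>x. s i x - s j x) < e"
  shows "\<exists>f\<in>L2. \<forall>e>0. \<exists>N. \<forall>n\<ge>N. L2_norm (\<lambda>x. s n x - f x) \<le> e"
proof -
  obtain w where w: "(\<lambda>x. complex_of_real (w x)) \<in> L2" "\<And>x. 0 < w x" using L2_positive_function by blast
  have wm: "w \<in> borel_measurable lborel"
    using measurable_compose[OF L2_measurable[OF w(1)] borel_measurable_Re] by (simp add: comp_def)
  define W where "W = L2_norm (\<lambda>x. complex_of_real (w x)) + 1"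
  have W: "W > 0" by (simp add: W_def add_nonneg_pos)
  define t where "t n x = w x *\<^sub>R s n x" for n x
  have t_int: "integrable lborel (t n)" for n
  proof (rule Bochner_Integration.integrable_bound[OF L2_norm_mult_integrable[OF w(1) s[of n]]])
    show "t n \<in> borel_measurable lborel" unfolding t_def[abs_def] using s[of n] wm by measurable
  qed (simp add: t_def)
  obtain r where r: "strict_mono r" "AE x in lborel. Cauchy (\<lambda>i. t (r i) x)"
  proof (rule cauchy_L1_AE_cauchy_subseq[of lborel t])
    fix e :: real assume e: "e > 0"
    obtain N where N: "\<forall>i\<ge>N. \<forall>j\<ge>N. L2_norm (\<lambda>x. s i x - s j x) < e / W" using cauchy[of "e / W"] e W by auto
    have "(LINT x|lborel. norm (t i x - t j x)) < e" if "i \<ge> N" "j \<ge> N" for i j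
    proof -
      have "(LINT x|lborel. norm (t i x - t j x)) = (LINT x|lborel. cmod (complex_of_real (w x)) * cmod (s i x - s j x))"
        using w(2) by (intro Bochner_Integration.integral_cong) (auto simp: t_def simp flip: scaleR_right_diff_distrib)
      also have "\<dots> \<le> L2_norm (\<lambda>x. complex_of_real (w x)) * L2_norm (\<lambda>x. s i x - s j x)"
        by (rule L2_Cauchy_Schwarz[OF w(1) L2_diff[OF s s]])
      also have "\<dots> \<le> W * L2_norm (\<lambda>x. s i x - s j x)" by (intro mult_right_mono) (auto simp: W_def)
      also have "\<dots> < e" using N that W by (simp add: pos_less_divide_eq mult.commute)
      finally show ?thesis .
    qed
    then show "\<exists>N. \<forall>i\<ge>N. \<forall>j\<ge>N. (LINT x|lborel. norm (t i x - t j x)) < e" by blast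
  qed (use t_int in auto)
  define f where "f x = lim (\<lambda>i. s (r i) x)" for x
  have f: "f \<in> borel_measurable lborel" unfolding f_def using s by measurable
  have lim: "AE x in lborel. (\<lambda>i. s (r i) x) \<longlonglongrightarrow> f x"
    using r(2)
  proof eventually_elim
    case (elim x)
    obtain l where "(\<lambda>i. t (r i) x) \<longlonglongrightarrow> l" using elim by (auto simp: Cauchy_convergent_iff convergent_def)
    then have "(\<lambda>i. inverse (w x) *\<^sub>R t (r i) x) \<longlonglongrightarrow> inverse (w x) *\<^sub>R l" by (intro tendsto_intros)
    then have "convergent (\<lambda>i. s (r i) x)" using w(2)[of x] by (auto simp: t_def convergent_def)
    then show ?case unfolding f_def by (simp add: convergent_LIMSEQ_iff)
  qed
  have close: "\<exists>N. \<forall>n\<ge>N. (\<lambda>x. s n x - f x) \<in> L2 \<and> L2_norm (\<lambda>x. s n x - f x) \<le> e" if e: "e > 0" for e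
  proof -
    obtain N where N: "\<And>i j. i \<ge> N \<Longrightarrow> j \<ge> N \<Longrightarrow> L2_norm (\<lambda>x. s i x - s j x) < e" using cauchy[OF e] by blast
    have "(\<lambda>x. s n x - f x) \<in> L2 \<and> L2_norm (\<lambda>x. s n x - f x) \<le> e" if n: "n \<ge> N" for n
    proof -
      \<comment> \<open>The subsequence is started at \<open>N\<close>, so that the bound required
        by \<open>L2_Fatou\<close> holds for every index.\<close>
      have le: "L2_norm (\<lambda>x. s n x - s (r (i + N)) x) \<le> e" for i
        using N[OF n, of "r (i + N)"] seq_suble[OF r(1), of "i + N"] by simp
      have "AE x in lborel. (\<lambda>i. s n x - s (r (i + N)) x) \<longlonglongrightarrow> s n x - f x"
        using lim by eventually_elim (intro tendsto_intros LIMSEQ_ignore_initial_segment)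
      from L2_Fatou[OF L2_diff[OF s s] le _ this] show ?thesis using s f by simp
    qed
    then show ?thesis by blast
  qed
  obtain N where "(\<lambda>x. s N x - f x) \<in> L2" using close[of 1] by auto
  then have "f \<in> L2" using L2_diff[OF s[of N], of "\<lambda>x. s N x - f x"] by simp
  then show ?thesis using close by blast
qed

instance l2 :: complete_space
proof
  fix X :: "nat \<Rightarrow> l2" assume X: "Cauchy X"
  have "\<forall>n. \<exists>f. f \<in> L2 \<and> X n = abs_l2 f" by (metis l2_cases)
  then obtain s where s: "\<And>n. s n \<in> L2" "\<And>n. X n = abs_l2 (s n)" by metis
  have "\<exists>f\<in>L2. \<forall>e>0. \<exists>N. \<forall>n\<ge>N. L2_norm (\<lambda>x. s n x - f x) \<le> e"
  proof (rule L2_complete[OF s(1)])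
    fix e :: real assume "e > 0"
    then show "\<exists>N. \<forall>i\<ge>N. \<forall>j\<ge>N. L2_norm (\<lambda>x. s i x - s j x) < e"
      using CauchyD[OF X] s by (simp add: abs_l2_diff abs_l2_norm L2_diff)
  qed
  then obtain f where f: "f \<in> L2" "\<And>e. e > 0 \<Longrightarrow> \<exists>N. \<forall>n\<ge>N. L2_norm (\<lambda>x. s n x - f x) \<le> e" by blast
  have "X \<longlonglongrightarrow> abs_l2 f"
  proof (rule LIMSEQ_I)
    fix e :: real assume "e > 0"
    then obtain N where N: "\<forall>n\<ge>N. L2_norm (\<lambda>x. s n x - f x) \<le> e / 2" using f(2)[of "e / 2"] by auto
    have "norm (X n - abs_l2 f) < e" if "n \<ge> N" for n
      using N that \<open>e > 0\<close> s f(1) by (force simp: abs_l2_diff abs_l2_norm L2_diff)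
    then show "\<exists>N. \<forall>n\<ge>N. norm (X n - abs_l2 f) < e" by blast
  qed
  then show "convergent X" by (auto simp: convergent_def)
qed

lemma imul_facts:
  "imul (u + v) = imul u + imul v" "imul (r *\<^sub>R u) = r *\<^sub>R imul u" "imul (imul u) = - u"
  "imul u \<bullet> imul v = u \<bullet> v"
proof -
  show "imul (u + v) = imul u + imul v"
    by transfer (auto simp: L2_eq_def L2_add L2_mult distrib_left)
  show "imul (r *\<^sub>R u) = r *\<^sub>R imul u"
    by transfer (auto simp: L2_eq_def L2_scaleR L2_mult)
  show "imul (imul u) = - u"
    by transfer (auto simp: L2_eq_def L2_uminus L2_mult simp flip: mult.assoc)
  show "imul u \<bullet> imul v = u \<bullet> v"
    by transfer (auto simp: L2_inner_def algebra_simps)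
qed

subsection \<open>The Sobolev space \<open>H\<^sup>1\<close> and absolutely continuous functions\<close>

text \<open>\<open>f\<close> is the absolutely continuous representative and \<open>g\<close> a
  derivative. Carrying the derivative along keeps linear combinations independent of the choice
  hidden in \<open>weak_deriv\<close>.\<close>

definition ac_pair :: "(real \<Rightarrow> complex) \<Rightarrow> (real \<Rightarrow> complex) \<Rightarrow> bool" where
  "ac_pair f g \<longleftrightarrow> f \<in> L2 \<and> g \<in> L2 \<and>
     (\<forall>x y. x \<le> y \<longrightarrow> f y - f x = (LINT t:{x..y}|lborel. g t))"

lemma L2_indicator: "(\<lambda>x. indicator {a..<b} x *\<^sub>R (1::complex)) \<in> L2"
proof (rule L2I[where g = "indicator {a..<b}"])
  have "bounded {a..<b}" by (rule bounded_subset[OF bounded_closed_interval[of a b]]) auto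
  then show "integrable lborel (indicat_real {a..<b})"
    by (intro integrable_real_indicator emeasure_bounded_finite) auto
qed (auto simp: indicator_def)

lemma L2_indicator_mult:
  assumes "f \<in> L2" "A \<in> sets borel"
  shows "(\<lambda>x. indicator A x *\<^sub>R f x) \<in> L2"
proof (rule L2I[OF _ L2_integrable[OF assms(1)]])
  show "(\<lambda>x. indicator A x *\<^sub>R f x) \<in> borel_measurable lborel" using assms by measurable
qed (auto simp: indicator_def)

lemma L2_set_Cauchy_Schwarz:
  assumes g: "g \<in> L2" and "a \<le> b"
  shows "set_integrable lborel {a..<b} g"
    and "(LINT x:{a..<b}|lborel. cmod (g x))\<^sup>2 \<le> (b - a) * (LINT x:{a..<b}|lborel. (cmod (g x))\<^sup>2)"
proof -
  let ?i = "\<lambda>x. indicator {a..<b} x *\<^sub>R (1::complex)"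
  let ?g = "\<lambda>x. indicator {a..<b} x *\<^sub>R g x"
  have gi: "?g \<in> L2" using L2_indicator_mult[OF g] by simp
  have eq: "cmod (?i x) * cmod (?g x) = indicator {a..<b} x *\<^sub>R cmod (g x)" for x
    by (auto simp: indicator_def)
  have int: "integrable lborel (\<lambda>x. indicator {a..<b} x *\<^sub>R cmod (g x))"
    using L2_norm_mult_integrable[OF L2_indicator[of a b] gi] unfolding eq .
  show "set_integrable lborel {a..<b} g"
    unfolding set_integrable_def
  proof (rule Bochner_Integration.integrable_bound[OF int])
    show "?g \<in> borel_measurable lborel" using g by measurable
  qed (auto simp: indicator_def)
  have "0 \<le> (LINT x:{a..<b}|lborel. cmod (g x))"
    unfolding set_lebesgue_integral_def by (intro Bochner_Integration.integral_nonneg) (auto simp: indicator_def)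
  moreover have "(LINT x:{a..<b}|lborel. cmod (g x)) \<le> L2_norm ?i * L2_norm ?g"
    using L2_Cauchy_Schwarz[OF L2_indicator[of a b] gi] unfolding eq set_lebesgue_integral_def .
  ultimately have "(LINT x:{a..<b}|lborel. cmod (g x))\<^sup>2 \<le> (L2_norm ?i * L2_norm ?g)\<^sup>2"
    by (intro power_mono)
  also have "\<dots> = (b - a) * (LINT x:{a..<b}|lborel. (cmod (g x))\<^sup>2)"
  proof -
    have "(L2_norm ?i)\<^sup>2 = (LINT x|lborel. indicator {a..<b} x)"
    proof -
      have "(cmod (?i x))\<^sup>2 = indicator {a..<b} x" for x by (auto simp: indicator_def)
      then show ?thesis unfolding L2_norm_def by (subst real_sqrt_pow2) auto
    qed
    also have "\<dots> = b - a" using \<open>a \<le> b\<close> by simp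
    finally have 1: "(L2_norm ?i)\<^sup>2 = b - a" .
    have "(L2_norm ?g)\<^sup>2 = (LINT x:{a..<b}|lborel. (cmod (g x))\<^sup>2)"
      unfolding L2_norm_def set_lebesgue_integral_def
      by (subst real_sqrt_pow2) (auto intro!: Bochner_Integration.integral_cong simp: indicator_def)
    with 1 show ?thesis by (simp add: power_mult_distrib)
  qed
  finally show "(LINT x:{a..<b}|lborel. cmod (g x))\<^sup>2 \<le> (b - a) * (LINT x:{a..<b}|lborel. (cmod (g x))\<^sup>2)" .
qed

lemma L2_set_square_integrable:
  "g \<in> L2 \<Longrightarrow> A \<in> sets borel \<Longrightarrow> set_integrable lborel A (\<lambda>x. (cmod (g x))\<^sup>2)"
  unfolding set_integrable_def by (intro integrable_mult_indicator L2_integrable) auto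

lemma L2_set_square_le:
  assumes "h \<in> L2" "A \<in> sets borel"
  shows "(LINT t:A|lborel. (cmod (h t))\<^sup>2) \<le> (L2_norm h)\<^sup>2"
proof -
  have "(LINT t:A|lborel. (cmod (h t))\<^sup>2) \<le> (LINT t|lborel. (cmod (h t))\<^sup>2)"
    unfolding set_lebesgue_integral_def
    using L2_set_square_integrable[OF assms] L2_integrable[OF assms(1)]
    by (intro integral_mono) (auto simp: set_integrable_def indicator_def)
  then show ?thesis by (simp add: L2_norm_def)
qed

lemma L2_set_integrable_bounded:
  assumes "g \<in> L2" "A \<in> sets borel" "A \<subseteq> {a..<b}"
  shows "set_integrable lborel A g"
proof -
  have "set_integrable lborel {a..<max a b} g" using L2_set_Cauchy_Schwarz(1)[OF assms(1)] by simp
  then show ?thesis by (rule set_integrable_subset) (use assms in auto)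
qed

lemma L2_set_integrable_Icc: "g \<in> L2 \<Longrightarrow> set_integrable lborel {x..y} g"
  by (rule L2_set_integrable_bounded[where a = x and b = "y + 1"]) auto

section \<open>Calculus and Sobolev inequalities for absolutely continuous functions\<close>

lemma ac_pairD:
  assumes "ac_pair f g"
  shows "f \<in> L2" "g \<in> L2" "x \<le> y \<Longrightarrow> f y - f x = (LINT t:{x..y}|lborel. g t)"
  using assms by (auto simp: ac_pair_def)

lemma ac_pair_add:
  assumes "ac_pair f g" "ac_pair f' g'"
  shows "ac_pair (\<lambda>x. f x + f' x) (\<lambda>x. g x + g' x)"
  unfolding ac_pair_def
proof (intro conjI allI impI)
  fix x y :: real assume "x \<le> y"
  have "(LINT t:{x..y}|lborel. g t + g' t) = (LINT t:{x..y}|lborel. g t) + (LINT t:{x..y}|lborel. g' t)"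
    by (rule set_integral_add(2)) (use assms L2_set_integrable_Icc ac_pairD in auto)
  then show "f y + f' y - (f x + f' x) = (LINT t:{x..y}|lborel. g t + g' t)"
    using ac_pairD(3)[OF assms(1) \<open>x \<le> y\<close>] ac_pairD(3)[OF assms(2) \<open>x \<le> y\<close>] by (simp add: algebra_simps)
qed (use assms ac_pairD L2_add in auto)

lemma ac_pair_mult:
  assumes "ac_pair f g"
  shows "ac_pair (\<lambda>x. c * f x) (\<lambda>x. c * g x)"
  unfolding ac_pair_def
proof (intro conjI allI impI)
  fix x y :: real assume "x \<le> y"
  then show "c * f y - c * f x = (LINT t:{x..y}|lborel. c * g t)"
    using ac_pairD(3)[OF assms \<open>x \<le> y\<close>] by (simp add: right_diff_distrib[symmetric])
qed (use assms ac_pairD L2_mult in auto)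

lemma ac_pair_scaleR: "ac_pair f g \<Longrightarrow> ac_pair (\<lambda>x. r *\<^sub>R f x) (\<lambda>x. r *\<^sub>R g x)"
  using ac_pair_mult[of f g "of_real r"] by (simp add: scaleR_conv_of_real)

lemma ac_pair_diff: "ac_pair f g \<Longrightarrow> ac_pair f' g' \<Longrightarrow> ac_pair (\<lambda>x. f x - f' x) (\<lambda>x. g x - g' x)"
  using ac_pair_add[OF _ ac_pair_mult[of f' g' "-1"]] by simp

lemma ac_pair_zero: "ac_pair (\<lambda>x. 0) (\<lambda>x. 0)"
  by (simp add: ac_pair_def L2_zero)

lemma ac_pair_increment:
  assumes fg: "ac_pair f g" and xy: "x \<in> {a..<b}" "y \<in> {a..<b}"
  shows "cmod (f y - f x) \<le> (LINT t:{a..<b}|lborel. cmod (g t))"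
proof -
  have main: "cmod (f y - f x) \<le> (LINT t:{a..<b}|lborel. cmod (g t))"
    if "x \<le> y" "x \<in> {a..<b}" "y \<in> {a..<b}" for x y
  proof -
    have g: "set_integrable lborel {a..<b} (\<lambda>t. cmod (g t))" "set_integrable lborel {x..y} (\<lambda>t. cmod (g t))"
      using that L2_set_Cauchy_Schwarz(1)[OF ac_pairD(2)[OF fg], of a b] L2_set_integrable_Icc[OF ac_pairD(2)[OF fg]]
      by (auto intro: set_integrable_norm)
    have "cmod (f y - f x) \<le> (LINT t:{x..y}|lborel. cmod (g t))"
      unfolding ac_pairD(3)[OF fg that(1)] set_lebesgue_integral_def
      by (rule order_trans[OF integral_norm_bound]) (simp add: norm_mult)
    also have "\<dots> \<le> (LINT t:{a..<b}|lborel. cmod (g t))"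
      unfolding set_lebesgue_integral_def
      by (rule integral_mono) (use g that in \<open>auto simp: set_integrable_def indicator_def\<close>)
    finally show ?thesis .
  qed
  show ?thesis
  proof (cases "x \<le> y")
    case False
    then show ?thesis using main[of y x] xy by (simp add: norm_minus_commute)
  qed (use main xy in auto)
qed

lemma ac_pair_increment_square:
  assumes fg: "ac_pair f g" and xy: "x \<in> {a..<b}" "y \<in> {a..<b}"
  shows "(cmod (f y - f x))\<^sup>2 \<le> (b - a) * (LINT t:{a..<b}|lborel. (cmod (g t))\<^sup>2)"
proof -
  have "(cmod (f y - f x))\<^sup>2 \<le> (LINT t:{a..<b}|lborel. cmod (g t))\<^sup>2"
    by (intro power_mono ac_pair_increment[OF assms]) simp
  also have "\<dots> \<le> (b - a) * (LINT t:{a..<b}|lborel. (cmod (g t))\<^sup>2)"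
    using xy by (intro L2_set_Cauchy_Schwarz(2) ac_pairD(2)[OF fg]) auto
  finally show ?thesis .
qed

text \<open>Split \<open>f y\<close> into \<open>f x\<close> and an increment, and average over
  \<open>x\<close> in the interval.\<close>

lemma ac_pair_sup_bound:
  assumes fg: "ac_pair f g" and y: "y \<in> {a..<b}"
  shows "(b - a) * (cmod (f y))\<^sup>2
    \<le> 2 * (LINT t:{a..<b}|lborel. (cmod (f t))\<^sup>2) + 2 * (b - a)\<^sup>2 * (LINT t:{a..<b}|lborel. (cmod (g t))\<^sup>2)"
proof -
  define G where "G = (LINT t:{a..<b}|lborel. (cmod (g t))\<^sup>2)"
  have ab: "a < b" using y by simp
  have le: "(cmod (f y))\<^sup>2 \<le> 2 * (cmod (f x))\<^sup>2 + 2 * ((b - a) * G)" if "x \<in> {a..<b}" for x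
    using square_norm_add_le[of "f x" "f y - f x"] ac_pair_increment_square[OF fg that y] by (simp add: G_def)
  have f2: "set_integrable lborel {a..<b} (\<lambda>t. (cmod (f t))\<^sup>2)"
    using L2_set_square_integrable ac_pairD(1)[OF fg] by simp
  have c: "set_integrable lborel {a..<b} (\<lambda>t. c :: real)" for c
    using ab by (simp add: set_integrable_def integrable_mult_left integrable_real_indicator)
  have "(LINT t:{a..<b}|lborel. (cmod (f y))\<^sup>2)
      \<le> (LINT t:{a..<b}|lborel. 2 * (cmod (f t))\<^sup>2 + 2 * ((b - a) * G))"
    by (rule set_integral_mono) (use c f2 le in auto)
  also have "\<dots> = 2 * (LINT t:{a..<b}|lborel. (cmod (f t))\<^sup>2) + (LINT t:{a..<b}|lborel. 2 * ((b - a) * G))"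
    using f2 c by (subst set_integral_add) auto
  finally show ?thesis
    using ab by (simp add: set_lebesgue_integral_def G_def power2_eq_square algebra_simps)
qed

text \<open>Here \<open>f y\<close> is compared with the mean of \<open>f\<close> instead. The
  derivative term keeps its order in \<open>b - a\<close>, while \<open>f\<close> enters through a
  single linear functional, that is through a term of rank one.\<close>

lemma ac_pair_mean_bound:
  assumes fg: "ac_pair f g" and y: "y \<in> {a..<b}"
  shows "(cmod (f y))\<^sup>2 \<le> 2 / (b - a)\<^sup>2 * (cmod (LINT t:{a..<b}|lborel. f t))\<^sup>2
      + 2 * (b - a) * (LINT t:{a..<b}|lborel. (cmod (g t))\<^sup>2)"
proof -
  define G where "G = (LINT t:{a..<b}|lborel. cmod (g t))"
  define m where "m = (LINT t:{a..<b}|lborel. f t)"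
  have ab: "a < b" using y by simp
  have f: "set_integrable lborel {a..<b} f" using L2_set_Cauchy_Schwarz(1) ac_pairD(1)[OF fg] ab by simp
  have c: "set_integrable lborel {a..<b} (\<lambda>t. c :: complex)" for c
    using ab by (simp add: set_integrable_def)
  have c': "set_integrable lborel {a..<b} (\<lambda>t. c :: real)" for c
    using ab by (simp add: set_integrable_def)
  have "(LINT t:{a..<b}|lborel. f y - f t) = (LINT t:{a..<b}|lborel. f y) - m"
    unfolding m_def by (rule set_integral_diff(2)[OF c f])
  also have "(LINT t:{a..<b}|lborel. f y) = (b - a) *\<^sub>R f y"
    using ab by (simp add: set_lebesgue_integral_def)
  finally have "cmod ((b - a) *\<^sub>R f y - m) = cmod (LINT t:{a..<b}|lborel. f y - f t)" by simp
  also have "\<dots> \<le> (LINT t:{a..<b}|lborel. cmod (f y - f t))"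
    unfolding set_lebesgue_integral_def
    by (rule order_trans[OF integral_norm_bound]) (simp add: norm_mult)
  also have "\<dots> \<le> (LINT t:{a..<b}|lborel. G)"
    using ac_pair_increment[OF fg _ y] set_integral_diff(1)[OF c f, of "f y"] c'
    by (intro set_integral_mono set_integrable_norm) (auto simp: G_def)
  also have "\<dots> = (b - a) * G" using ab by (simp add: set_lebesgue_integral_def)
  finally have d: "cmod ((b - a) *\<^sub>R f y - m) \<le> (b - a) * G" .
  have "(b - a)\<^sup>2 * (cmod (f y))\<^sup>2 = (cmod (m + ((b - a) *\<^sub>R f y - m)))\<^sup>2"
    by (simp add: power_mult_distrib)
  also have "\<dots> \<le> 2 * (cmod m)\<^sup>2 + 2 * (cmod ((b - a) *\<^sub>R f y - m))\<^sup>2" by (rule square_norm_add_le)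
  also have "\<dots> \<le> 2 * (cmod m)\<^sup>2 + 2 * ((b - a) * G)\<^sup>2"
    using d by (intro add_left_mono mult_left_mono power_mono) auto
  also have "\<dots> \<le> 2 * (cmod m)\<^sup>2 + 2 * ((b - a)\<^sup>2 * ((b - a) * (LINT t:{a..<b}|lborel. (cmod (g t))\<^sup>2)))"
    unfolding power_mult_distrib G_def
    using L2_set_Cauchy_Schwarz(2)[OF ac_pairD(2)[OF fg], of a b] ab
    by (intro add_left_mono mult_left_mono) auto
  finally have *: "(b - a)\<^sup>2 * (cmod (f y))\<^sup>2
      \<le> 2 * (cmod m)\<^sup>2 + 2 * ((b - a)\<^sup>2 * ((b - a) * (LINT t:{a..<b}|lborel. (cmod (g t))\<^sup>2)))" .
  have pos: "(b - a)\<^sup>2 > 0" using ab by simp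
  have "(cmod (f y))\<^sup>2 \<le> (2 * (cmod m)\<^sup>2 + 2 * ((b - a)\<^sup>2 * ((b - a) * (LINT t:{a..<b}|lborel. (cmod (g t))\<^sup>2)))) / (b - a)\<^sup>2"
    unfolding pos_le_divide_eq[OF pos] using * by (simp only: mult.commute)
  also have "\<dots> = 2 / (b - a)\<^sup>2 * (cmod m)\<^sup>2 + 2 * (b - a) * (LINT t:{a..<b}|lborel. (cmod (g t))\<^sup>2)"
    using pos by (simp add: add_divide_distrib)
  finally show ?thesis by (simp add: m_def)
qed

lemma ac_pair_continuous:
  assumes fg: "ac_pair f g"
  shows "continuous_on UNIV f"
proof -
  define K where "K = (L2_norm g)\<^sup>2"
  have K: "0 \<le> K" unfolding K_def by simp
  have bound: "(dist (f y) (f x))\<^sup>2 \<le> 2 * \<bar>y - x\<bar> * K" for x y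
  proof (cases "x = y")
    case False
    \<comment> \<open>The increment bound needs both points in a half-open interval; lengthening it
      by \<open>\<bar>y - x\<bar>\<close> costs a factor of 2.\<close>
    define a b where "a = min x y" and "b = max x y + \<bar>y - x\<bar>"
    have "(cmod (f y - f x))\<^sup>2 \<le> (b - a) * (LINT t:{a..<b}|lborel. (cmod (g t))\<^sup>2)"
      by (rule ac_pair_increment_square[OF fg]) (use False in \<open>auto simp: a_def b_def\<close>)
    also have "b - a = 2 * \<bar>y - x\<bar>" by (auto simp: a_def b_def)
    also have "(LINT t:{a..<b}|lborel. (cmod (g t))\<^sup>2) \<le> K"
      unfolding K_def by (rule L2_set_square_le[OF ac_pairD(2)[OF fg]]) simp
    finally show ?thesis by (simp add: dist_norm mult_left_mono)
  qed (use K in simp)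
  show ?thesis
    unfolding continuous_on_iff
  proof (intro ballI allI impI)
    fix x e :: real assume "e > 0"
    define d where "d = e\<^sup>2 / (2 * (K + 1))"
    have "d > 0" using K \<open>e > 0\<close> by (simp add: d_def)
    moreover have "dist (f y) (f x) < e" if "dist y x < d" for y
    proof -
      have "(dist (f y) (f x))\<^sup>2 \<le> 2 * \<bar>y - x\<bar> * K" by (rule bound)
      also have "\<dots> \<le> 2 * \<bar>y - x\<bar> * (K + 1)" by (intro mult_left_mono) auto
      also have "\<dots> < 2 * d * (K + 1)" using that K by (intro mult_strict_right_mono) (auto simp: dist_real_def)
      also have "\<dots> = e\<^sup>2" using K by (simp add: d_def field_simps)
      finally show ?thesis using \<open>e > 0\<close> by (simp add: power_less_imp_less_base)
    qed
    ultimately show "\<exists>d>0. \<forall>x'\<in>UNIV. dist x' x < d \<longrightarrow> dist (f x') (f x) < e" by blast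
  qed
qed

text \<open>Closed intervals are stable under intersection and generate the Borel sets, so vanishing
  integrals extend to all Borel sets. Truncation to bounded intervals provides the global
  integrability for this.\<close>

lemma interval_integrals_determine:
  fixes h :: "real \<Rightarrow> complex"
  assumes int: "\<And>a b. set_integrable lborel {a..b} h"
    and zero: "\<And>a b. (LINT t:{a..b}|lborel. h t) = 0"
  shows "AE x in lborel. h x = 0"
proof -
  have n: "AE x in lborel. indicator {- real n..real n} x *\<^sub>R h x = 0" for n
  proof (rule sigma_finite_measure.density_zero[OF sigma_finite_lborel])
    let ?I = "{- real n..real n}"
    let ?h = "\<lambda>x. indicator ?I x *\<^sub>R h x"
    show ih: "integrable lborel ?h" using int[of "- real n" "real n"] by (simp add: set_integrable_def)
    have si: "set_integrable lborel A ?h" if "A \<in> sets lborel" for A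
      unfolding set_integrable_def using integrable_mult_indicator[OF that ih] .
    let ?G = "range (\<lambda>(a, b). {a..b::real})"
    have "Int_stable ?G"
    proof (rule Int_stableI)
      fix A B assume "A \<in> ?G" "B \<in> ?G"
      then obtain a b c d where "A = {a..b}" "B = {c..d}" by auto
      then have "A \<inter> B = (\<lambda>(a, b). {a..b}) (max a c, min b d)" by auto
      then show "A \<inter> B \<in> ?G" by blast
    qed
    have gen: "sets lborel = sigma_sets UNIV ?G"
      by (simp add: borel_eq_atLeastAtMost)
    fix A :: "real set" assume "A \<in> sets lborel"
    note \<open>Int_stable ?G\<close>
    moreover have "?G \<subseteq> Pow UNIV" by simp
    moreover have "A \<in> sigma_sets UNIV ?G" using \<open>A \<in> sets lborel\<close> unfolding gen .
    ultimately show "set_lebesgue_integral lborel A ?h = 0"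
    proof (induct rule: sigma_sets_induct_disjoint)
      case (basic A)
      then obtain a b where "A = {a..b}" by auto
      then have "set_lebesgue_integral lborel A ?h = (LINT t:{max a (- real n)..min b (real n)}|lborel. h t)"
        unfolding set_lebesgue_integral_def
        by (intro Bochner_Integration.integral_cong) (auto simp: indicator_def)
      then show ?case by (simp add: zero)
    next
      case (compl A)
      then have A: "A \<in> sets lborel" unfolding gen by simp
      have "set_lebesgue_integral lborel (A \<union> (UNIV - A)) ?h
          = set_lebesgue_integral lborel A ?h + set_lebesgue_integral lborel (UNIV - A) ?h"
        using A by (intro set_integral_Un si) auto
      moreover have "set_lebesgue_integral lborel (A \<union> (UNIV - A)) ?h = (LINT t:?I|lborel. h t)"
        unfolding set_lebesgue_integral_def by simp
      ultimately show ?case using compl zero by simp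
    next
      case (union A)
      then have A: "A i \<in> sets lborel" for i unfolding gen by auto
      have "set_lebesgue_integral lborel (\<Union>i. A i) ?h = (\<Sum>i. set_lebesgue_integral lborel (A i) ?h)"
        using union(1) A by (intro lebesgue_integral_countable_add si) (auto simp: disjoint_family_on_def)
      then show ?case using union by simp
    qed (simp_all add: set_lebesgue_integral_def)
  qed
  then have "AE x in lborel. \<forall>n. indicator {- real n..real n} x *\<^sub>R h x = 0" unfolding AE_all_countable by blast
  then show ?thesis
  proof eventually_elim
    case (elim x)
    obtain n where "\<bar>x\<bar> \<le> real n" using real_arch_simple by blast
    then show ?case using elim[rule_format, of n] by (auto simp: abs_le_iff)
  qed
qed

text \<open>Makes the choice of a derivative in \<open>weak_deriv\<close> immaterial.\<close>

lemma ac_pair_unique: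
  assumes "ac_pair f g" "ac_pair f g'"
  shows "AE x in lborel. g x = g' x"
proof -
  have "AE x in lborel. g x - g' x = 0"
  proof (rule interval_integrals_determine)
    have gg: "g \<in> L2" "g' \<in> L2" using assms ac_pairD by auto
    show "set_integrable lborel {a..b} (\<lambda>x. g x - g' x)" for a b
      by (intro set_integral_diff(1) L2_set_integrable_Icc gg)
    show "(LINT t:{a..b}|lborel. g t - g' t) = 0" for a b
    proof (cases "a \<le> b")
      case True
      have "(LINT t:{a..b}|lborel. g t - g' t) = (LINT t:{a..b}|lborel. g t) - (LINT t:{a..b}|lborel. g' t)"
        by (intro set_integral_diff(2) L2_set_integrable_Icc gg)
      then show ?thesis using ac_pairD(3)[OF assms(1) True] ac_pairD(3)[OF assms(2) True] by simp
    qed (simp add: set_lebesgue_integral_def)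
  qed
  then show ?thesis by simp
qed

lemma continuous_AE_eq:
  fixes f g :: "real \<Rightarrow> complex"
  assumes "continuous_on UNIV f" "continuous_on UNIV g" "AE x in lborel. f x = g x"
  shows "f = g"
proof -
  have "AE x in lborel. \<not> x \<in> {x. f x \<noteq> g x}" using assms(3) by simp
  moreover have op: "open {x. f x \<noteq> g x}" using assms by (intro open_Collect_neq) auto
  ultimately have "{x. f x \<noteq> g x} \<in> null_sets lborel"
    by (subst AE_iff_null_sets) auto
  then have "negligible {x. f x \<noteq> g x}" by (simp add: negligible_iff_null_sets null_sets_completionI)
  then have "{x. f x \<noteq> g x} = {}" using open_not_negligible[OF op] by blast
  then show ?thesis by auto
qed

section \<open>Weak derivatives and integration by parts\<close>

lemma test_functionD:
  assumes "test_function \<phi>"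
  obtains R where "R > 0" "\<And>x. (\<phi> has_real_derivative deriv \<phi> x) (at x)" "continuous_on UNIV (deriv \<phi>)"
    "\<And>x. R \<le> \<bar>x\<bar> \<Longrightarrow> \<phi> x = 0" "\<And>x. R \<le> \<bar>x\<bar> \<Longrightarrow> deriv \<phi> x = 0"
proof -
  obtain D where D: "\<And>x. (\<phi> has_vector_derivative D x) (at x)" "continuous_on UNIV D"
    using assms unfolding test_function_def C1_differentiable_on_def by auto
  have der: "(\<phi> has_real_derivative D x) (at x)" for x
    using D(1) by (simp add: has_real_derivative_iff_has_vector_derivative)
  have dD: "deriv \<phi> = D" using DERIV_imp_deriv[OF der] by blast
  have "bounded (closure {x. \<phi> x \<noteq> 0})"
    using assms by (simp add: test_function_def compact_imp_bounded)
  then obtain r where r: "\<And>x. x \<in> closure {x. \<phi> x \<noteq> 0} \<Longrightarrow> norm x \<le> r" by (auto simp: bounded_iff)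
  \<comment> \<open>The added 1 puts the points with \<open>\<bar>x\<bar> = R\<close> outside the
    closed support, where \<open>\<phi>\<close> vanishes in a neighbourhood and its derivative with
    it.\<close>
  define R where "R = \<bar>r\<bar> + 1"
  have out: "x \<notin> closure {x. \<phi> x \<noteq> 0}" if "R \<le> \<bar>x\<bar>" for x
    using r[of x] that by (auto simp: R_def)
  have z: "\<phi> x = 0" if "x \<notin> closure {x. \<phi> x \<noteq> 0}" for x
    using that closure_subset[of "{x. \<phi> x \<noteq> 0}"] by blast
  have "deriv \<phi> x = 0" if "R \<le> \<bar>x\<bar>" for x
  proof -
    have "((\<lambda>x. 0) has_real_derivative D x) (at x)"
    proof (rule has_field_derivative_transform_within_open[OF der])
      show "open (- closure {x. \<phi> x \<noteq> 0})" by blast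
      show "x \<in> - closure {x. \<phi> x \<noteq> 0}" using out[OF that] by blast
      show "\<phi> y = 0" if "y \<in> - closure {x. \<phi> x \<noteq> 0}" for y using z that by blast
    qed
    then show ?thesis unfolding dD by (rule DERIV_unique[OF _ DERIV_const])
  qed
  moreover have "\<phi> x = 0" if "R \<le> \<bar>x\<bar>" for x using z[OF out[OF that]] .
  moreover have "R > 0" by (simp add: R_def)
  ultimately show thesis using that[of R] der D(2) unfolding dD by blast
qed

text \<open>Integration by parts is the exchange of the order of integration over the triangle \<open>t \<le> x\<close>.\<close>

lemma ac_pair_imp_has_weak_deriv:
  assumes fg: "ac_pair f g"
  shows "has_weak_deriv f g"
  unfolding has_weak_deriv_def
proof (intro allI impI)
  fix \<phi> assume "test_function \<phi>"
  then obtain R where R: "R > 0" and der: "\<And>x. (\<phi> has_real_derivative deriv \<phi> x) (at x)"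
    and cont: "continuous_on UNIV (deriv \<phi>)"
    and out: "\<And>x. R \<le> \<bar>x\<bar> \<Longrightarrow> \<phi> x = 0" "\<And>x. R \<le> \<bar>x\<bar> \<Longrightarrow> deriv \<phi> x = 0"
    by (rule test_functionD) blast
  define D where "D = deriv \<phi>"
  have Dm [measurable]: "D \<in> borel_measurable borel"
    using cont by (simp add: D_def borel_measurable_continuous_onI)
  have gm [measurable]: "g \<in> borel_measurable borel" using ac_pairD(2)[OF fg] by measurable
  have FTC: "(LINT x|lborel. indicator {a..R} x *\<^sub>R D x) = - \<phi> a" if "a \<le> R" for a
  proof -
    have "(LINT x|lborel. indicator {a..R} x *\<^sub>R D x) = \<phi> R - \<phi> a"
    proof (rule integral_FTC_atLeastAtMost[OF that])
      show "(\<phi> has_vector_derivative D x) (at x within {a..R})" for x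
        unfolding D_def using der has_real_derivative_iff_has_vector_derivative has_vector_derivative_at_within by blast
      show "continuous_on {a..R} D" using cont continuous_on_subset D_def by blast
    qed
    then show ?thesis using out(1)[of R] by simp
  qed
  \<comment> \<open>The integrand on the triangle, with both variables confined to
    \<open>{- R..R}\<close>, where \<open>g\<close> is integrable.\<close>
  define F where "F t x = (if - R \<le> t \<and> t \<le> x \<and> x \<le> R then D x *\<^sub>R g t else 0)" for t x
  define a where "a x = indicator {- R..R} x * \<bar>D x\<bar>" for x
  define b where "b t = indicator {- R..R} t * cmod (g t)" for t
  have a: "integrable lborel a"
    using borel_integrable_compact[of "{- R..R}" "\<lambda>x. \<bar>D x\<bar>"] continuous_on_subset[OF cont, of "{- R..R}"]
    by (simp add: a_def[abs_def] D_def continuous_on_rabs)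
  have b: "integrable lborel b"
    using set_integrable_norm[OF L2_set_integrable_Icc[OF ac_pairD(2)[OF fg], of "- R" R]]
    by (simp add: b_def[abs_def] set_integrable_def)
  have ab: "integrable (lborel \<Otimes>\<^sub>M lborel) (\<lambda>p. b (fst p) * a (snd p))"
  proof (rule lborel_pair.Fubini_integrable)
    show "(\<lambda>p. b (fst p) * a (snd p)) \<in> borel_measurable (lborel \<Otimes>\<^sub>M lborel)"
      unfolding a_def b_def by measurable
    have "norm (b (fst (x, y)) * a (snd (x, y))) = b x * a y" for x y
      by (simp add: abs_mult a_def b_def)
    then show "integrable lborel (\<lambda>x. LINT y|lborel. norm (b (fst (x, y)) * a (snd (x, y))))"
      using b by (simp only: integral_mult_right_zero integrable_mult_left)
  qed (use a in simp)
  have "integrable (lborel \<Otimes>\<^sub>M lborel) (case_prod F)"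
  proof (rule Bochner_Integration.integrable_bound[OF ab])
    show "case_prod F \<in> borel_measurable (lborel \<Otimes>\<^sub>M lborel)"
      unfolding F_def by measurable
    show "AE p in lborel \<Otimes>\<^sub>M lborel. norm (case_prod F p) \<le> norm (b (fst p) * a (snd p))"
      by (auto simp: F_def a_def b_def abs_mult mult.commute)
  qed
  then have fub: "(LINT x|lborel. LINT t|lborel. F t x) = (LINT t|lborel. LINT x|lborel. F t x)"
    by (rule lborel_pair.Fubini_integral)
  \<comment> \<open>The derivative of \<open>\<phi>\<close> has integral zero, so the constant
    \<open>f (- R)\<close> left over by the inner integral drops out.\<close>
  have D0: "(LINT x|lborel. indicator {- R..R} x *\<^sub>R D x) = 0"
    using FTC[of "- R"] R out(1)[of "- R"] by simp
  have Di: "integrable lborel (\<lambda>x. indicator {- R..R} x *\<^sub>R D x)"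
    using borel_integrable_compact[of "{- R..R}" D] continuous_on_subset[OF cont, of "{- R..R}"] by (simp add: D_def)
  have inner: "(LINT t|lborel. F t x) = (indicator {- R..R} x * D x) *\<^sub>R (f x - f (- R))" for x
  proof (cases "x \<in> {- R..R}")
    case True
    then have "(LINT t|lborel. F t x) = (LINT t|lborel. D x *\<^sub>R (indicator {- R..x} t *\<^sub>R g t))"
      by (intro Bochner_Integration.integral_cong) (auto simp: F_def indicator_def)
    also have "\<dots> = D x *\<^sub>R (LINT t:{- R..x}|lborel. g t)"
      by (simp only: set_lebesgue_integral_def integral_scaleR_right)
    also have "(LINT t:{- R..x}|lborel. g t) = f x - f (- R)" using ac_pairD(3)[OF fg, of "- R" x] True by simp
    finally show ?thesis using True by simp
  next
    case False
    then have "F t x = 0" for t by (auto simp: F_def)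
    then show ?thesis using False by simp
  qed
  have row: "(LINT x|lborel. F t x) = - (g t * of_real (\<phi> t))" for t
  proof (cases "t \<in> {- R..R}")
    case True
    then have "(LINT x|lborel. F t x) = (LINT x|lborel. (indicator {t..R} x *\<^sub>R D x) *\<^sub>R g t)"
      by (intro Bochner_Integration.integral_cong) (auto simp: F_def indicator_def)
    also have "\<dots> = (LINT x|lborel. indicator {t..R} x *\<^sub>R D x) *\<^sub>R g t"
      using borel_integrable_compact[of "{t..R}" D] continuous_on_subset[OF cont, of "{t..R}"]
      by (intro integral_scaleR_left) (simp add: D_def)
    finally show ?thesis using FTC[of t] True by (simp add: scaleR_conv_of_real mult.commute)
  next
    case False
    then have "F t x = 0" "\<phi> t = 0" for x using out(1)[of t] by (auto simp: F_def)
    then show ?thesis by simp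
  qed
  have "f x * of_real (D x) = (LINT t|lborel. F t x) + (indicator {- R..R} x *\<^sub>R D x) *\<^sub>R f (- R)" for x
  proof (cases "x \<in> {- R..R}")
    case True
    then show ?thesis unfolding inner by (simp add: scaleR_conv_of_real algebra_simps)
  next
    case False
    then have "D x = 0" unfolding D_def by (intro out(2)) auto
    then show ?thesis unfolding inner by simp
  qed
  moreover have iF: "integrable lborel (\<lambda>x. LINT t|lborel. F t x)"
    using lborel_pair.integrable_snd[OF \<open>integrable (lborel \<Otimes>\<^sub>M lborel) (case_prod F)\<close>] .
  ultimately have "(LINT x|lborel. f x * of_real (D x))
      = (LINT x|lborel. LINT t|lborel. F t x) + (LINT x|lborel. (indicator {- R..R} x *\<^sub>R D x) *\<^sub>R f (- R))"
    using Di by (simp add: Bochner_Integration.integral_add integrable_scaleR_left)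
  also have "(LINT x|lborel. (indicator {- R..R} x *\<^sub>R D x) *\<^sub>R f (- R)) = 0"
    using D0 Di by (subst integral_scaleR_left) auto
  also have "(LINT x|lborel. LINT t|lborel. F t x) = (LINT t|lborel. LINT x|lborel. F t x)" by (rule fub)
  also have "\<dots> = - (LINT t|lborel. g t * of_real (\<phi> t))" by (simp add: row)
  finally show "(LINT x|lborel. f x * of_real (deriv \<phi> x)) = - (LINT x|lborel. g x * of_real (\<phi> x))"
    by (simp add: D_def)
qed

text \<open>
  The functions in \<open>test_function\<close> need only be \<open>C\<^sup>1\<close>, so differences of rescaled copies of \<open>smooth_step\<close>
  are test functions that approximate indicators of intervals.
\<close>

definition tent :: "real \<Rightarrow> real" where
  "tent x = 4 * (max 0 x - 2 * max 0 (x - 1/2) + max 0 (x - 1))"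

text \<open>The primitive of the triangular bump \<open>tent\<close>. Writing both with positive
  parts makes the derivative formula uniform in \<open>x\<close>.\<close>

definition smooth_step :: "real \<Rightarrow> real" where
  "smooth_step x = 2 * ((max 0 x)\<^sup>2 - 2 * (max 0 (x - 1/2))\<^sup>2 + (max 0 (x - 1))\<^sup>2)"

lemma max_square_deriv: "((\<lambda>x. (max 0 x)\<^sup>2) has_real_derivative 2 * max 0 x) (at x)" for x :: real
proof -
  consider "x > 0" | "x < 0" | "x = 0" by linarith
  then show ?thesis
  proof cases
    case 1
    have "((\<lambda>x. x\<^sup>2) has_real_derivative 2 * x) (at x)" by (auto intro!: derivative_eq_intros)
    then show ?thesis
      by (rule has_field_derivative_transform_within_open[where S = "{0<..}", THEN DERIV_cong]) (use 1 in auto)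
  next
    case 2
    have "((\<lambda>x. 0) has_real_derivative 0) (at x)" by simp
    then show ?thesis
      by (rule has_field_derivative_transform_within_open[where S = "{..<0}", THEN DERIV_cong]) (use 2 in auto)
  next
    case 3
    \<comment> \<open>At the kink \<open>(max 0 z)\<^sup>2 = max 0 z * z\<close>, which exhibits the
      continuous slope in Caratheodory's criterion.\<close>
    show ?thesis unfolding CARAT_DERIV
    proof (intro exI[of _ "\<lambda>z. max 0 z"] conjI allI)
      show "isCont (max 0) x" by (intro continuous_intros)
    qed (use 3 in \<open>auto simp: max_def power2_eq_square\<close>)
  qed
qed

lemma smooth_step_deriv: "(smooth_step has_real_derivative tent x) (at x)"
proof -
  have *: "((\<lambda>x. (max 0 (x - c))\<^sup>2) has_real_derivative 2 * max 0 (x - c) * (1 - 0)) (at x)" for c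
    by (rule DERIV_chain'[OF DERIV_diff[OF DERIV_ident DERIV_const] max_square_deriv])
  have "((\<lambda>x. 2 * ((max 0 x)\<^sup>2 - 2 * (max 0 (x - 1/2))\<^sup>2 + (max 0 (x - 1))\<^sup>2)) has_real_derivative
      2 * (2 * max 0 x - 2 * (2 * max 0 (x - 1/2) * (1 - 0)) + 2 * max 0 (x - 1) * (1 - 0))) (at x)"
    by (intro DERIV_cmult DERIV_add DERIV_diff * max_square_deriv)
  then show ?thesis unfolding smooth_step_def[abs_def] tent_def by (simp add: algebra_simps)
qed

lemma tent_continuous: "continuous_on A tent"
  unfolding tent_def[abs_def] by (intro continuous_intros)

lemma tent_outside: "x \<notin> {0..1} \<Longrightarrow> tent x = 0"
  by (auto simp: tent_def max_def)

lemma smooth_step_left: "x \<le> 0 \<Longrightarrow> smooth_step x = 0"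
  by (simp add: smooth_step_def)

lemma smooth_step_right:
  assumes "1 \<le> x"
  shows "smooth_step x = 1"
proof -
  have "max 0 x = x" "max 0 (x - 1/2) = x - 1/2" "max 0 (x - 1) = x - 1" using assms by auto
  then have "smooth_step x = 2 * (x\<^sup>2 - 2 * (x - 1/2)\<^sup>2 + (x - 1)\<^sup>2)" by (simp only: smooth_step_def)
  then show ?thesis by (simp add: power2_eq_square algebra_simps)
qed

lemma tent_nonneg: "0 \<le> tent x"
  unfolding tent_def max_def by auto

lemma smooth_step_mono:
  assumes "x \<le> y"
  shows "smooth_step x \<le> smooth_step y"
  using smooth_step_deriv tent_nonneg by (intro DERIV_nonneg_imp_nondecreasing[OF assms]) metis

lemma smooth_step_range: "0 \<le> smooth_step x" "smooth_step x \<le> 1"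
proof -
  show "0 \<le> smooth_step x"
    using smooth_step_mono[of 0 x] smooth_step_left[of 0] smooth_step_left[of x] by (cases "0 \<le> x") auto
  show "smooth_step x \<le> 1"
    using smooth_step_mono[of x 1] smooth_step_right[of 1] smooth_step_right[of x] by (cases "x \<le> 1") auto
qed

lemma integrable_compact_support:
  fixes h :: "real \<Rightarrow> 'a::{banach, second_countable_topology}"
  assumes "continuous_on UNIV h" "\<And>x. x \<notin> {a..b} \<Longrightarrow> h x = 0"
  shows "integrable lborel h"
proof -
  have "integrable lborel (\<lambda>x. indicator {a..b} x *\<^sub>R h x)"
    by (intro borel_integrable_compact continuous_on_subset[OF assms(1)]) auto
  also have "(\<lambda>x. indicator {a..b} x *\<^sub>R h x) = h" using assms(2) by (auto simp: fun_eq_iff indicator_def)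
  finally show ?thesis .
qed

lemma tent_integral: "integrable lborel tent" "(LINT x|lborel. tent x) = 1"
proof -
  show "integrable lborel tent"
    by (rule integrable_compact_support[OF tent_continuous]) (rule tent_outside)
  have "(LINT x|lborel. indicator {0..1} x *\<^sub>R tent x) = smooth_step 1 - smooth_step 0"
    using smooth_step_deriv has_real_derivative_iff_has_vector_derivative has_vector_derivative_at_within
    by (intro integral_FTC_atLeastAtMost tent_continuous) (auto, blast)
  also have "(\<lambda>x. indicator {0..1} x *\<^sub>R tent x) = tent" using tent_outside by (auto simp: fun_eq_iff indicator_def)
  finally show "(LINT x|lborel. tent x) = 1" by (simp add: smooth_step_left smooth_step_right)
qed

text \<open>The rescaled kernels live to the right of \<open>a\<close>, so a bound for
  \<open>f\<close> on \<open>{a..a + 1}\<close> suffices for dominated convergence; the substitution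
  moves the scaling from the kernel to \<open>f\<close>.\<close>

lemma tent_approximate_identity:
  fixes f :: "real \<Rightarrow> complex"
  assumes f: "continuous_on UNIV f"
  shows "(\<lambda>n. LINT x|lborel. f x * of_real (real (Suc n) * tent (real (Suc n) * (x - a)))) \<longlonglongrightarrow> f a"
proof -
  have subst: "(LINT x|lborel. f x * of_real (real (Suc n) * tent (real (Suc n) * (x - a))))
      = (LINT s|lborel. f (a + inverse (real (Suc n)) * s) * of_real (tent s))" for n
  proof -
    define N where "N = real (Suc n)"
    have N: "N > 0" by (simp add: N_def)
    have "(LINT x|lborel. f x * of_real (N * tent (N * (x - a))))
        = \<bar>inverse N\<bar> *\<^sub>R (LINT s|lborel. f (a + inverse N * s) * of_real (N * tent (N * ((a + inverse N * s) - a))))"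
      using N by (intro lborel_integral_real_affine) simp
    also have "\<dots> = (LINT s|lborel. inverse N *\<^sub>R (f (a + inverse N * s) * of_real (N * tent (N * ((a + inverse N * s) - a)))))"
      using N by (simp only: integral_scaleR_right abs_of_pos positive_imp_inverse_positive)
    also have "\<dots> = (LINT s|lborel. f (a + inverse N * s) * of_real (tent s))"
    proof (intro Bochner_Integration.integral_cong refl)
      fix s
      have "N * ((a + inverse N * s) - a) = s" using N by simp
      then show "inverse N *\<^sub>R (f (a + inverse N * s) * of_real (N * tent (N * ((a + inverse N * s) - a))))
          = f (a + inverse N * s) * of_real (tent s)"
        using N by (simp add: scaleR_conv_of_real field_simps)
    qed
    finally show ?thesis by (simp only: N_def)
  qed
  obtain M where M: "\<forall>x\<in>{a..a + 1}. cmod (f x) \<le> M"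
    using compact_imp_bounded[OF compact_continuous_image[OF continuous_on_subset[OF f] compact_Icc[of a "a + 1"]]]
    by (auto simp: bounded_iff)
  have "(\<lambda>n. LINT s|lborel. f (a + inverse (real (Suc n)) * s) * of_real (tent s))
      \<longlonglongrightarrow> (LINT s|lborel. f a * of_real (tent s))"
  proof (rule integral_dominated_convergence)
    show "integrable lborel (\<lambda>s. M * tent s)" using tent_integral(1) by simp
    show "(\<lambda>s. f a * of_real (tent s)) \<in> borel_measurable lborel"
      using borel_measurable_continuous_onI[OF tent_continuous] by measurable
    have "(\<lambda>s. f (a + inverse (real (Suc n)) * s)) \<in> borel_measurable lborel" for n
      using borel_measurable_continuous_onI[OF f] by measurable
    then show "(\<lambda>s. f (a + inverse (real (Suc n)) * s) * of_real (tent s)) \<in> borel_measurable lborel" for n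
      using borel_measurable_continuous_onI[OF tent_continuous] by measurable
    have "(\<lambda>n. f (a + inverse (real (Suc n)) * s) * of_real (tent s)) \<longlonglongrightarrow> f a * of_real (tent s)" for s
    proof -
      have "(\<lambda>n. a + inverse (real (Suc n)) * s) \<longlonglongrightarrow> a + 0 * s"
        by (intro tendsto_intros LIMSEQ_inverse_real_of_nat)
      then have "(\<lambda>n. f (a + inverse (real (Suc n)) * s)) \<longlonglongrightarrow> f a"
        using continuous_on_tendsto_compose[OF f, of _ a] by simp
      then show ?thesis by (intro tendsto_intros)
    qed
    then show "AE s in lborel. (\<lambda>n. f (a + inverse (real (Suc n)) * s) * of_real (tent s)) \<longlonglongrightarrow> f a * of_real (tent s)"
      by simp
    have "norm (f (a + inverse (real (Suc n)) * s) * of_real (tent s)) \<le> M * tent s" for n s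
    proof (cases "s \<in> {0..1}")
      case True
      then have "inverse (real (Suc n)) * s \<le> 1 * 1" by (intro mult_mono) (auto simp: inverse_le_1_iff)
      then have "cmod (f (a + inverse (real (Suc n)) * s)) \<le> M" using True by (intro M[rule_format]) auto
      then show ?thesis using tent_nonneg[of s] by (simp add: norm_mult mult_right_mono)
    qed (simp add: tent_outside)
    then show "AE s in lborel. norm (f (a + inverse (real (Suc n)) * s) * of_real (tent s)) \<le> M * tent s" for n
      by simp
  qed
  also have "(LINT s|lborel. f a * of_real (tent s)) = f a"
    using tent_integral by simp
  finally show ?thesis unfolding subst .
qed

text \<open>The test functions rise from 0 to 1 after \<open>a\<close> and fall back after
  \<open>b\<close>, ever more steeply. Their derivatives are differences of two approximate
  identities, so one side of the weak identity tends to \<open>f a - f b\<close> and the other to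
  minus the integral of \<open>g\<close>.\<close>

lemma has_weak_deriv_imp_ac_pair:
  assumes f: "f \<in> L2" "continuous_on UNIV f" and g: "g \<in> L2" and weak: "has_weak_deriv f g"
  shows "ac_pair f g"
  unfolding ac_pair_def
proof (intro conjI allI impI)
  fix a b :: real assume "a \<le> b"
  define s where "s n x = real (Suc n) * x" for n x
  define \<phi> where "\<phi> n x = smooth_step (s n (x - a)) - smooth_step (s n (x - b))" for n x
  define D where "D n x = real (Suc n) * tent (s n (x - a)) - real (Suc n) * tent (s n (x - b))" for n x
  have der: "(\<phi> n has_real_derivative D n x) (at x)" for n x
  proof -
    have *: "((\<lambda>x. smooth_step (s n (x - c))) has_real_derivative tent (s n (x - c)) * (real (Suc n) * (1 - 0))) (at x)" for c
      unfolding s_def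
      by (rule DERIV_chain'[OF DERIV_cmult[OF DERIV_diff[OF DERIV_ident DERIV_const]] smooth_step_deriv])
    show ?thesis unfolding \<phi>_def[abs_def] D_def using DERIV_diff[OF *[of a] *[of b]] by (simp add: mult.commute)
  qed
  then have dD: "deriv (\<phi> n) = D n" for n using DERIV_imp_deriv by blast
  have left: "\<phi> n x = 0" if "x \<le> a" for n x
    using that \<open>a \<le> b\<close> by (simp add: \<phi>_def s_def smooth_step_left mult_nonneg_nonpos)
  have right: "\<phi> n x = 0" if "1 \<le> s n (x - b)" for n x
  proof -
    have "s n (x - b) \<le> s n (x - a)" using \<open>a \<le> b\<close> by (simp add: s_def)
    then show ?thesis using that by (simp add: \<phi>_def smooth_step_right)
  qed
  have right': "\<phi> n x = 0" if "b + 1 \<le> x" for n x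
  proof (rule right)
    have "1 * 1 \<le> real (Suc n) * (x - b)" using that by (intro mult_mono) auto
    then show "1 \<le> s n (x - b)" by (simp add: s_def)
  qed
  have test: "test_function (\<phi> n)" for n
    unfolding test_function_def
  proof
    have "continuous_on UNIV (D n)" unfolding D_def[abs_def] s_def
      by (intro continuous_intros continuous_on_compose2[OF tent_continuous[of UNIV]]) auto
    then show "\<phi> n C1_differentiable_on UNIV"
      unfolding C1_differentiable_on_def using der has_real_derivative_iff_has_vector_derivative by blast
    have "{x. \<phi> n x \<noteq> 0} \<subseteq> {a..b + 1}"
    proof
      fix x assume "x \<in> {x. \<phi> n x \<noteq> 0}"
      then have "\<not> x \<le> a" "\<not> b + 1 \<le> x" using left[of x n] right'[of x n] by auto
      then show "x \<in> {a..b + 1}" by simp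
    qed
    then show "compact (closure {x. \<phi> n x \<noteq> 0})"
      using bounded_subset[OF bounded_closed_interval] compact_closure by blast
  qed
  have range: "\<bar>\<phi> n x\<bar> \<le> 1" for n x
    using smooth_step_range[of "s n (x - a)"] smooth_step_range[of "s n (x - b)"] by (simp add: \<phi>_def abs_le_iff)
  have eq: "(LINT x|lborel. f x * of_real (D n x)) = - (LINT x|lborel. g x * of_real (\<phi> n x))" for n
    using weak test[of n] unfolding has_weak_deriv_def dD[symmetric] by blast
  have int: "integrable lborel (\<lambda>x. f x * of_real (real (Suc n) * tent (s n (x - c))))" for n c
  proof (rule integrable_compact_support[of _ c "c + 1"])
    show "continuous_on UNIV (\<lambda>x. f x * of_real (real (Suc n) * tent (s n (x - c))))"
      unfolding s_def by (intro continuous_intros f continuous_on_compose2[OF tent_continuous[of UNIV]]) auto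
    fix x assume x: "x \<notin> {c..c + 1}"
    have "s n (x - c) \<notin> {0..1}"
    proof (cases "x < c")
      case True
      then show ?thesis by (simp add: s_def mult_pos_neg not_le)
    next
      case False
      then have "1 * 1 < real (Suc n) * (x - c)" using x by (intro mult_le_less_imp_less) auto
      then show ?thesis by (simp add: s_def)
    qed
    then show "f x * of_real (real (Suc n) * tent (s n (x - c))) = 0" by (simp add: tent_outside)
  qed
  have "(LINT x|lborel. f x * of_real (D n x)) = (LINT x|lborel. f x * of_real (real (Suc n) * tent (s n (x - a))))
      - (LINT x|lborel. f x * of_real (real (Suc n) * tent (s n (x - b))))" for n
    unfolding D_def of_real_diff right_diff_distrib by (rule Bochner_Integration.integral_diff[OF int int])
  then have 1: "(\<lambda>n. LINT x|lborel. f x * of_real (D n x)) \<longlonglongrightarrow> f a - f b"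
    unfolding s_def by (simp only:) (intro tendsto_diff tent_approximate_identity f)
  \<comment> \<open>Each ramp starts at its endpoint, so the limit is still 0 at \<open>a\<close>
    and still 1 at \<open>b\<close>.\<close>
  have "(\<lambda>n. LINT x|lborel. g x * of_real (\<phi> n x)) \<longlonglongrightarrow> (LINT x|lborel. indicator {a<..b} x *\<^sub>R g x)"
  proof (rule integral_dominated_convergence)
    show "integrable lborel (\<lambda>x. indicator {a..b + 1} x * cmod (g x))"
      using set_integrable_norm[OF L2_set_integrable_Icc[OF g]] by (simp add: set_integrable_def)
    show "(\<lambda>x. indicator {a<..b} x *\<^sub>R g x) \<in> borel_measurable lborel" using g by measurable
    have "continuous_on UNIV (\<phi> n)" for n
      using der DERIV_isCont continuous_at_imp_continuous_on by blast
    then have "\<phi> n \<in> borel_measurable borel" for n by (rule borel_measurable_continuous_onI)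
    then show "(\<lambda>x. g x * of_real (\<phi> n x)) \<in> borel_measurable lborel" for n using g by measurable
    have "norm (g x * of_real (\<phi> n x)) \<le> indicator {a..b + 1} x * cmod (g x)" for n x
      using left[of x n] right'[of x n] mult_left_mono[OF range[of n x], of "cmod (g x)"]
      by (cases "x \<in> {a..b + 1}") (auto simp: norm_mult)
    then show "AE x in lborel. norm (g x * of_real (\<phi> n x)) \<le> indicator {a..b + 1} x * cmod (g x)" for n by simp
    have "(\<lambda>n. g x * of_real (\<phi> n x)) \<longlonglongrightarrow> indicator {a<..b} x *\<^sub>R g x" for x
    proof -
      have ev: "\<forall>\<^sub>F n in sequentially. 1 \<le> s n (x - c)" if "c < x" for c
      proof -
        obtain N where N: "1 / (x - c) < real N" using reals_Archimedean2 by blast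
        have "1 \<le> s n (x - c)" if "n \<ge> N" for n
        proof -
          have "1 / (x - c) \<le> real (Suc n)" using N that by simp
          then show ?thesis using \<open>c < x\<close> by (simp add: s_def pos_divide_le_eq)
        qed
        then show ?thesis using eventually_sequentially by blast
      qed
      have "\<forall>\<^sub>F n in sequentially. g x * of_real (\<phi> n x) = indicator {a<..b} x *\<^sub>R g x"
      proof -
        consider "x \<le> a" | "a < x" "x \<le> b" | "b < x" by linarith
        then show ?thesis
        proof cases
          case 1
          then show ?thesis using left by simp
        next
          case 2
          have "\<forall>\<^sub>F n in sequentially. 1 \<le> s n (x - a)" by (rule ev) fact
          then show ?thesis
          proof eventually_elim
            case (elim n)
            have "s n (x - b) \<le> 0" using 2 by (simp add: s_def mult_nonneg_nonpos)
            then show ?case using 2 elim by (simp add: \<phi>_def smooth_step_left smooth_step_right)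
          qed
        next
          case 3
          have "\<forall>\<^sub>F n in sequentially. 1 \<le> s n (x - b)" by (rule ev) fact
          then show ?thesis by eventually_elim (use 3 right in simp)
        qed
      qed
      then show ?thesis by (rule tendsto_eventually)
    qed
    then show "AE x in lborel. (\<lambda>n. g x * of_real (\<phi> n x)) \<longlonglongrightarrow> indicator {a<..b} x *\<^sub>R g x" by simp
  qed
  then have 2: "(\<lambda>n. LINT x|lborel. f x * of_real (D n x)) \<longlonglongrightarrow> - (LINT x|lborel. indicator {a<..b} x *\<^sub>R g x)"
    unfolding eq by (rule tendsto_minus)
  have "f b - f a = (LINT x|lborel. indicator {a<..b} x *\<^sub>R g x)"
    using LIMSEQ_unique[OF 1 2] by (simp add: algebra_simps)
  also have "\<dots> = (LINT x:{a..b}|lborel. g x)"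
    unfolding set_lebesgue_integral_def
  proof (rule integral_cong_AE)
    show "AE x in lborel. indicator {a<..b} x *\<^sub>R g x = indicator {a..b} x *\<^sub>R g x"
      using AE_lborel_singleton[of a] by eventually_elim (auto simp: indicator_def)
  qed (use g in measurable)
  finally show "f b - f a = (LINT x:{a..b}|lborel. g x)" .
qed (use f g in auto)

lemma H1_iff_ac_pair: "f \<in> H1 \<longleftrightarrow> (\<exists>g. ac_pair f g)"
proof
  assume "f \<in> H1"
  then obtain g where "f \<in> L2" "continuous_on UNIV f" "g \<in> L2" "has_weak_deriv f g" by (auto simp: H1_def)
  then show "\<exists>g. ac_pair f g" using has_weak_deriv_imp_ac_pair by metis
next
  assume "\<exists>g. ac_pair f g"
  then obtain g where g: "ac_pair f g" by blast
  show "f \<in> H1"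
    unfolding H1_def using ac_pairD(1,2)[OF g] ac_pair_continuous[OF g] ac_pair_imp_has_weak_deriv[OF g] by auto
qed

lemma ac_pair_weak_deriv:
  assumes "f \<in> H1"
  shows "ac_pair f (weak_deriv f)"
proof -
  have "\<exists>g. g \<in> L2 \<and> has_weak_deriv f g" using assms by (auto simp: H1_def)
  then have "weak_deriv f \<in> L2 \<and> has_weak_deriv f (weak_deriv f)" unfolding weak_deriv_def by (rule someI_ex)
  then show ?thesis using assms by (intro has_weak_deriv_imp_ac_pair) (auto simp: H1_def)
qed

subsection \<open>Integrals against \<open>\<mu>\<close> on short intervals\<close>

text \<open>Values in \<open>ennreal\<close> allow sums over infinitely many cells before any
  integrability is known; \<open>M\<close> is either \<open>\<mu>\<close> or Lebesgue
  measure.\<close>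

definition sq_int :: "real measure \<Rightarrow> (real \<Rightarrow> complex) \<Rightarrow> real set \<Rightarrow> ennreal" where
  "sq_int M f A = (\<integral>\<^sup>+x. ennreal ((cmod (f x))\<^sup>2) * indicator A x \<partial>M)"

lemma sq_int_lborel:
  assumes "f \<in> L2" "A \<in> sets borel"
  shows "sq_int lborel f A = ennreal (LINT x:A|lborel. (cmod (f x))\<^sup>2)"
proof -
  have "sq_int lborel f A = (\<integral>\<^sup>+x. ennreal (indicator A x *\<^sub>R (cmod (f x))\<^sup>2) \<partial>lborel)"
    unfolding sq_int_def by (intro nn_integral_cong) (auto simp: indicator_def)
  also have "\<dots> = ennreal (LINT x:A|lborel. (cmod (f x))\<^sup>2)"
    unfolding set_lebesgue_integral_def
    by (rule nn_integral_eq_integral) (use L2_set_square_integrable[OF assms] in \<open>auto simp: set_integrable_def\<close>)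
  finally show ?thesis .
qed

lemma sq_int_lborel_UNIV: "f \<in> L2 \<Longrightarrow> sq_int lborel f UNIV = ennreal ((L2_norm f)\<^sup>2)"
  by (simp add: sq_int_def nn_integral_L2_norm)

lemma sq_int_mono: "A \<subseteq> B \<Longrightarrow> sq_int M f A \<le> sq_int M f B"
  unfolding sq_int_def by (intro nn_integral_mono mult_left_mono) (auto simp: indicator_def)

lemma sq_int_UN:
  assumes "sets M = sets borel" "f \<in> borel_measurable borel"
    and "\<And>i. i \<in> I \<Longrightarrow> X i \<in> sets borel" "countable I" "disjoint_family_on X I"
  shows "sq_int M f (\<Union>i\<in>I. X i) = (\<integral>\<^sup>+i. sq_int M f (X i) \<partial>count_space I)"
proof -
  have f: "(\<lambda>x. ennreal ((cmod (f x))\<^sup>2)) \<in> borel_measurable M"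
    unfolding measurable_cong_sets[OF assms(1) refl] using assms(2) by measurable
  have eq: "sq_int M f A = emeasure (density M (\<lambda>x. ennreal ((cmod (f x))\<^sup>2))) A" if "A \<in> sets borel" for A
    using that f by (simp add: sq_int_def emeasure_density assms(1))
  have UN: "(\<Union>i\<in>I. X i) \<in> sets borel"
    using assms(3,4) by (intro sets.countable_UN') auto
  have "sq_int M f (\<Union>i\<in>I. X i) = (\<integral>\<^sup>+i. emeasure (density M (\<lambda>x. ennreal ((cmod (f x))\<^sup>2))) (X i) \<partial>count_space I)"
    unfolding eq[OF UN] by (rule emeasure_UN_countable) (use assms in auto)
  also have "\<dots> = (\<integral>\<^sup>+i. sq_int M f (X i) \<partial>count_space I)"
    by (intro nn_integral_cong) (simp add: eq assms(3))
  finally show ?thesis .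
qed

lemma sq_int_tiling:
  assumes "sets M = sets borel" "ac_pair f g"
    and X: "\<And>i. i \<in> I \<Longrightarrow> X i \<in> sets borel" "countable I" "disjoint_family_on X I"
    and le: "\<And>i. i \<in> I \<Longrightarrow> sq_int M f (X i) \<le> \<alpha> * sq_int lborel g (X i) + \<beta> * sq_int lborel f (X i)"
  shows "sq_int M f (\<Union>i\<in>I. X i) \<le> \<alpha> * sq_int lborel g (\<Union>i\<in>I. X i) + \<beta> * sq_int lborel f (\<Union>i\<in>I. X i)"
proof -
  have fg: "f \<in> borel_measurable borel" "g \<in> borel_measurable borel" using ac_pairD[OF assms(2)] by auto
  have "sq_int M f (\<Union>i\<in>I. X i) = (\<integral>\<^sup>+i. sq_int M f (X i) \<partial>count_space I)"
    by (rule sq_int_UN) (use assms fg in auto)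
  also have "\<dots> \<le> (\<integral>\<^sup>+i. \<alpha> * sq_int lborel g (X i) + \<beta> * sq_int lborel f (X i) \<partial>count_space I)"
    by (intro nn_integral_mono) (use le in auto)
  also have "\<dots> = \<alpha> * (\<integral>\<^sup>+i. sq_int lborel g (X i) \<partial>count_space I) + \<beta> * (\<integral>\<^sup>+i. sq_int lborel f (X i) \<partial>count_space I)"
    by (simp add: nn_integral_add nn_integral_cmult)
  also have "\<dots> = \<alpha> * sq_int lborel g (\<Union>i\<in>I. X i) + \<beta> * sq_int lborel f (\<Union>i\<in>I. X i)"
    using X fg by (simp add: sq_int_UN)
  finally show ?thesis .
qed

lemma sq_int_le_sup:
  assumes "sets M = sets borel" "A \<in> sets borel" "\<And>x. x \<in> A \<Longrightarrow> (cmod (f x))\<^sup>2 \<le> K"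
  shows "sq_int M f A \<le> ennreal K * emeasure M A"
proof -
  have "sq_int M f A \<le> (\<integral>\<^sup>+x. ennreal K * indicator A x \<partial>M)"
    unfolding sq_int_def using assms(3) by (intro nn_integral_mono) (auto simp: indicator_def intro!: ennreal_leI)
  also have "\<dots> = ennreal K * emeasure M A" using assms by (intro nn_integral_cmult_indicator) simp
  finally show ?thesis .
qed

text \<open>Supremum of the function times mass of the interval; \<open>m\<close> decides how much
  of the kinetic energy is spent.\<close>

lemma sq_int_interval:
  assumes M: "sets M = sets borel" "emeasure M {a..<b} \<le> ennreal m" and "0 \<le> m"
    and fg: "ac_pair f g" and "a < b"
  shows "sq_int M f {a..<b} \<le> ennreal (2 * (b - a) * m) * sq_int lborel g {a..<b}
      + ennreal (2 * m / (b - a)) * sq_int lborel f {a..<b}"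
proof -
  define F where "F = (LINT t:{a..<b}|lborel. (cmod (f t))\<^sup>2)"
  define G where "G = (LINT t:{a..<b}|lborel. (cmod (g t))\<^sup>2)"
  have FG: "0 \<le> F" "0 \<le> G"
    unfolding F_def G_def set_lebesgue_integral_def by (auto intro!: Bochner_Integration.integral_nonneg)
  have "(cmod (f y))\<^sup>2 \<le> 2 * (b - a) * G + 2 / (b - a) * F" if "y \<in> {a..<b}" for y
    using ac_pair_sup_bound[OF fg that] \<open>a < b\<close> unfolding F_def[symmetric] G_def[symmetric]
    by (simp add: field_simps power2_eq_square)
  then have "sq_int M f {a..<b} \<le> ennreal (2 * (b - a) * G + 2 / (b - a) * F) * emeasure M {a..<b}"
    by (intro sq_int_le_sup M) auto
  also have "\<dots> \<le> ennreal (2 * (b - a) * G + 2 / (b - a) * F) * ennreal m"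
    by (intro mult_left_mono M) auto
  also have "\<dots> = ennreal (2 * (b - a) * m * G + 2 * m / (b - a) * F)"
  proof -
    have "0 \<le> 2 * (b - a) * G + 2 / (b - a) * F" using FG \<open>a < b\<close> by simp
    moreover have "(2 * (b - a) * G + 2 / (b - a) * F) * m = 2 * (b - a) * m * G + 2 * m / (b - a) * F"
      by (simp add: algebra_simps)
    ultimately show ?thesis using \<open>0 \<le> m\<close> by (metis ennreal_mult)
  qed
  also have "\<dots> = ennreal (2 * (b - a) * m) * ennreal G + ennreal (2 * m / (b - a)) * ennreal F"
  proof -
    define p q where "p = 2 * (b - a) * m" and "q = 2 * m / (b - a)"
    have "0 \<le> p" "0 \<le> q" using \<open>a < b\<close> \<open>0 \<le> m\<close> by (auto simp: p_def q_def)
    then show ?thesis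
      unfolding p_def[symmetric] q_def[symmetric] using FG by (simp add: ennreal_mult ennreal_plus)
  qed
  finally show ?thesis
    using ac_pairD[OF fg] by (simp add: sq_int_lborel F_def G_def)
qed

text \<open>With \<open>small\<close> the derivative term stays within the available energy, and
  besides it only a rank one term remains.\<close>

lemma sq_int_interval_mean:
  assumes M: "sets M = sets borel" "emeasure M {a..<b} \<le> ennreal m" and "0 \<le> m"
    and fg: "ac_pair f g" and "a < b" and small: "2 * (b - a) * m \<le> 1"
  shows "sq_int M f {a..<b} \<le> sq_int lborel g {a..<b}
      + ennreal (2 * m / (b - a)\<^sup>2 * (cmod (LINT t:{a..<b}|lborel. f t))\<^sup>2)"
proof -
  define G where "G = (LINT t:{a..<b}|lborel. (cmod (g t))\<^sup>2)"
  define I where "I = (cmod (LINT t:{a..<b}|lborel. f t))\<^sup>2"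
  have G: "0 \<le> G"
    unfolding G_def set_lebesgue_integral_def by (auto intro!: Bochner_Integration.integral_nonneg)
  have "sq_int M f {a..<b} \<le> ennreal (2 / (b - a)\<^sup>2 * I + 2 * (b - a) * G) * emeasure M {a..<b}"
    using ac_pair_mean_bound[OF fg] by (intro sq_int_le_sup M) (auto simp: I_def G_def)
  also have "\<dots> \<le> ennreal (2 / (b - a)\<^sup>2 * I + 2 * (b - a) * G) * ennreal m"
    by (intro mult_left_mono M) auto
  also have "\<dots> = ennreal (2 * m / (b - a)\<^sup>2 * I + 2 * (b - a) * m * G)"
  proof -
    have "0 \<le> 2 / (b - a)\<^sup>2 * I + 2 * (b - a) * G" using G \<open>a < b\<close> by (simp add: I_def)
    moreover have "(2 / (b - a)\<^sup>2 * I + 2 * (b - a) * G) * m = 2 * m / (b - a)\<^sup>2 * I + 2 * (b - a) * m * G"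
      by (simp add: algebra_simps)
    ultimately show ?thesis using \<open>0 \<le> m\<close> by (metis ennreal_mult)
  qed
  also have "\<dots> \<le> ennreal (G + 2 * m / (b - a)\<^sup>2 * I)"
    using mult_right_mono[OF small G] by (intro ennreal_leI) simp
  also have "\<dots> = ennreal G + ennreal (2 * m / (b - a)\<^sup>2 * I)"
    using G \<open>0 \<le> m\<close> by (simp add: I_def ennreal_plus)
  finally show ?thesis
    using ac_pairD[OF fg] by (simp add: sq_int_lborel G_def I_def)
qed

section \<open>Tilings of the line and bounds relative to the kinetic energy\<close>

lemma cells_disjoint: "disjoint_family_on (\<lambda>k::int. {real_of_int k * h..<real_of_int (k + 1) * h}) I"
proof (unfold disjoint_family_on_def, intro ballI impI)
  fix i j :: int assume "i \<noteq> j"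
  have "{real_of_int i * h..<real_of_int (i + 1) * h} \<inter> {real_of_int j * h..<real_of_int (j + 1) * h} = {}"
    if "i < j" for i j :: int
  proof (cases "h > 0")
    case True
    have "real_of_int (i + 1) * h \<le> real_of_int j * h" using that True by (intro mult_right_mono) auto
    then show ?thesis by auto
  next
    case False
    then have "real_of_int (i + 1) * h \<le> real_of_int i * h" by (simp add: algebra_simps)
    then show ?thesis by auto
  qed
  from this[of i j] this[of j i] \<open>i \<noteq> j\<close>
  show "{real_of_int i * h..<real_of_int (i + 1) * h} \<inter> {real_of_int j * h..<real_of_int (j + 1) * h} = {}"
    by (cases "i < j") (auto simp: Int_commute)
qed

lemma cells_cover:
  assumes "h > 0"
  shows "\<exists>k::int. x \<in> {real_of_int k * h..<real_of_int (k + 1) * h}"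
proof -
  obtain k :: int where "real_of_int k \<le> x / h" "x / h < real_of_int (k + 1)"
    using floor_correct[of "x / h"] by blast
  then have "x \<in> {real_of_int k * h..<real_of_int (k + 1) * h}"
    using assms by (simp add: pos_le_divide_eq pos_divide_less_eq)
  then show ?thesis by blast
qed

text \<open>Cells of length \<open>h \<le> 1\<close> inherit the mass bound \<open>C\<close>, and
  \<open>h \<le> 1 / (4 * C)\<close> brings the derivative coefficient \<open>2 * h * C\<close> down
  to \<open>1/2\<close>. Any value below 1 would leave a coercive form after a shift.\<close>

lemma brinck_form_bound:
  assumes M: "sets \<mu> = sets borel" and "brinck \<mu>"
  shows "\<exists>B\<ge>0. \<forall>f g. ac_pair f g \<longrightarrow>
    sq_int \<mu> f UNIV \<le> ennreal (1/2 * (L2_norm g)\<^sup>2 + B * (L2_norm f)\<^sup>2)"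
proof -
  obtain C where C: "C > 0" "\<And>x. emeasure \<mu> {x..x + 1} < ennreal C" using assms by (auto simp: brinck_def)
  define h where "h = min 1 (1 / (4 * C))"
  have h: "h > 0" "h \<le> 1" "2 * h * C \<le> 1/2"
  proof -
    have "h * C \<le> 1 / (4 * C) * C" using C(1) by (intro mult_right_mono) (auto simp: h_def)
    then show "2 * h * C \<le> 1/2" using C(1) by simp
  qed (use C(1) in \<open>auto simp: h_def\<close>)
  define B where "B = 2 * C / h"
  have B: "B \<ge> 0" using h C(1) by (simp add: B_def)
  define X where "X k = {real_of_int k * h..<real_of_int (k + 1) * h}" for k
  have disj: "disjoint_family_on X I" for I unfolding X_def by (rule cells_disjoint)
  have UN: "(\<Union>k. X k) = UNIV" using cells_cover[OF h(1)] by (auto simp: X_def)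
  have "sq_int \<mu> f UNIV \<le> ennreal (1/2 * (L2_norm g)\<^sup>2 + B * (L2_norm f)\<^sup>2)" if fg: "ac_pair f g" for f g
  proof -
    have "sq_int \<mu> f (\<Union>k. X k) \<le> ennreal (1/2) * sq_int lborel g (\<Union>k. X k) + ennreal B * sq_int lborel f (\<Union>k. X k)"
    proof (rule sq_int_tiling[OF M fg])
      fix k :: int
      define a b where "a = real_of_int k * h" and "b = real_of_int (k + 1) * h"
      have ab: "X k = {a..<b}" "b - a = h" by (auto simp: X_def a_def b_def algebra_simps)
      have "emeasure \<mu> {a..<b} \<le> emeasure \<mu> {a..a + 1}"
        using ab h by (intro emeasure_mono) (auto simp: M)
      also have "\<dots> \<le> ennreal C" using C(2)[of a] by simp
      finally have "sq_int \<mu> f {a..<b} \<le> ennreal (2 * (b - a) * C) * sq_int lborel g {a..<b}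
          + ennreal (2 * C / (b - a)) * sq_int lborel f {a..<b}"
        using C(1) ab h fg by (intro sq_int_interval M) auto
      also have "\<dots> \<le> ennreal (1/2) * sq_int lborel g {a..<b} + ennreal B * sq_int lborel f {a..<b}"
        unfolding ab B_def using h by (intro add_mono mult_right_mono ennreal_leI) auto
      finally show "sq_int \<mu> f (X k) \<le> ennreal (1/2) * sq_int lborel g (X k) + ennreal B * sq_int lborel f (X k)"
        unfolding ab .
    next
      show "disjoint_family X" by (rule disj)
      show "X k \<in> sets borel" for k by (simp add: X_def)
    qed simp
    also have "\<dots> = ennreal (1/2 * (L2_norm g)\<^sup>2 + B * (L2_norm f)\<^sup>2)"
    proof -
      have "ennreal (q * (L2_norm g)\<^sup>2 + B * (L2_norm f)\<^sup>2)
          = ennreal q * ennreal ((L2_norm g)\<^sup>2) + ennreal B * ennreal ((L2_norm f)\<^sup>2)" if "0 \<le> q" for q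
        using B that by (simp add: ennreal_mult ennreal_plus)
      from this[of "1/2"] show ?thesis
        unfolding UN sq_int_lborel_UNIV[OF ac_pairD(1)[OF fg]] sq_int_lborel_UNIV[OF ac_pairD(2)[OF fg]] by simp
    qed
    finally show ?thesis unfolding UN .
  qed
  then show ?thesis using B by blast
qed

text \<open>
  On intervals that are short compared to \<open>1 / \<mu>\<close> only the mean value of the function contributes,
  so the form is nonnegative up to a finite rank term on every bounded interval.
\<close>

lemma local_finite_rank_bound:
  assumes M: "sets \<mu> = sets borel" and m: "\<And>x y. L \<le> x \<Longrightarrow> x < y \<Longrightarrow> y \<le> L' \<Longrightarrow> emeasure \<mu> {x..<y} \<le> ennreal m" "0 < m"
    and "L < L'"
  shows "\<exists>C E. 0 \<le> C \<and> finite E \<and> (\<forall>f g. ac_pair f g \<longrightarrow>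
    sq_int \<mu> f {L..<L'} \<le> sq_int lborel g {L..<L'}
      + ennreal (C * (\<Sum>(a, b)\<in>E. (cmod (LINT t:{a..<b}|lborel. f t))\<^sup>2)))"
proof -
  \<comment> \<open>Cells this short satisfy \<open>2 * h * m \<le> 1\<close>, the condition of
    \<open>sq_int_interval_mean\<close>.\<close>
  obtain n :: nat where n: "2 * m * (L' - L) < real n" using reals_Archimedean2 by blast
  have "0 < 2 * m * (L' - L)" using m(2) \<open>L < L'\<close> by simp
  with n have n0: "real n > 0" by linarith
  define h where "h = (L' - L) / real n"
  have h: "h > 0" "2 * h * m \<le> 1"
    using n n0 \<open>L < L'\<close> m(2) by (auto simp: h_def field_simps)
  define X where "X k = {L + real k * h..<L + real (Suc k) * h}" for k
  define C where "C = 2 * m / h\<^sup>2"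
  define E where "E = (\<lambda>k. (L + real k * h, L + real (Suc k) * h)) ` {..<n}"
  have C: "0 \<le> C" using m(2) h by (simp add: C_def)
  have nh: "real n * h = L' - L" using n0 by (simp add: h_def)
  have UN: "(\<Union>k\<in>{..<n}. X k) = {L..<L'}"
  proof (intro set_eqI iffI)
    fix x assume "x \<in> (\<Union>k\<in>{..<n}. X k)"
    then obtain k where k: "k < n" "x \<in> X k" by auto
    have "real (Suc k) * h \<le> real n * h" using k h by (intro mult_right_mono) auto
    moreover have "0 \<le> real k * h" using h by simp
    ultimately show "x \<in> {L..<L'}" using k(2) nh by (auto simp: X_def)
  next
    fix x assume x: "x \<in> {L..<L'}"
    define k where "k = nat \<lfloor>(x - L) / h\<rfloor>"
    have "0 \<le> (x - L) / h" using x h by simp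
    then have rk: "real k \<le> (x - L) / h" "(x - L) / h < real (Suc k)" unfolding k_def by linarith+
    then have xk: "x \<in> X k" using h by (auto simp: X_def field_simps)
    have "real k * h < real n * h" using xk x nh by (auto simp: X_def)
    then have "k < n" using h by simp
    then show "x \<in> (\<Union>k\<in>{..<n}. X k)" using xk by blast
  qed
  have disj: "disjoint_family_on X {..<n}"
  proof (unfold disjoint_family_on_def, intro ballI impI)
    fix i j :: nat assume "i \<noteq> j"
    have *: "X i \<inter> X j = {}" if "i < j" for i j :: nat
    proof -
      have "real (Suc i) * h \<le> real j * h" using that h by (intro mult_right_mono) auto
      then show ?thesis by (auto simp: X_def)
    qed
    show "X i \<inter> X j = {}" using *[of i j] *[of j i] \<open>i \<noteq> j\<close> by (cases "i < j") (auto simp: Int_commute)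
  qed
  have inj: "inj_on (\<lambda>k. (L + real k * h, L + real (Suc k) * h)) {..<n}"
    using h by (auto simp: inj_on_def)
  have "sq_int \<mu> f {L..<L'} \<le> sq_int lborel g {L..<L'}
      + ennreal (C * (\<Sum>(a, b)\<in>E. (cmod (LINT t:{a..<b}|lborel. f t))\<^sup>2))" if fg: "ac_pair f g" for f g
  proof -
    have fgm: "f \<in> borel_measurable borel" "g \<in> borel_measurable borel" using ac_pairD[OF fg] by auto
    have cell: "sq_int \<mu> f (X k) \<le> sq_int lborel g (X k) + ennreal (C * (cmod (LINT t:X k|lborel. f t))\<^sup>2)"
      if "k < n" for k
    proof -
      define a b where "a = L + real k * h" and "b = L + real (Suc k) * h"
      have ab: "X k = {a..<b}" "b - a = h" by (auto simp: X_def a_def b_def algebra_simps)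
      have "real (Suc k) * h \<le> real n * h" using that h by (intro mult_right_mono) auto
      then have "b \<le> L'" using nh by (simp add: b_def)
      moreover have "L \<le> a" "a < b" using h ab by (auto simp: a_def)
      ultimately have "emeasure \<mu> {a..<b} \<le> ennreal m" by (intro m)
      then have "sq_int \<mu> f {a..<b} \<le> sq_int lborel g {a..<b}
          + ennreal (2 * m / (b - a)\<^sup>2 * (cmod (LINT t:{a..<b}|lborel. f t))\<^sup>2)"
        using m(2) ab h fg by (intro sq_int_interval_mean M) auto
      then show ?thesis unfolding ab C_def .
    qed
    have "sq_int \<mu> f {L..<L'} = (\<Sum>k<n. sq_int \<mu> f (X k))"
      unfolding UN[symmetric] using disj fgm M
      by (subst sq_int_UN) (auto simp: X_def nn_integral_count_space_finite)
    also have "\<dots> \<le> (\<Sum>k<n. sq_int lborel g (X k) + ennreal (C * (cmod (LINT t:X k|lborel. f t))\<^sup>2))"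
      by (intro sum_mono cell) simp
    also have "\<dots> = (\<Sum>k<n. sq_int lborel g (X k)) + (\<Sum>k<n. ennreal (C * (cmod (LINT t:X k|lborel. f t))\<^sup>2))"
      by (rule sum.distrib)
    also have "(\<Sum>k<n. sq_int lborel g (X k)) = sq_int lborel g {L..<L'}"
      unfolding UN[symmetric] using disj fgm
      by (subst sq_int_UN) (auto simp: X_def nn_integral_count_space_finite)
    also have "(\<Sum>k<n. ennreal (C * (cmod (LINT t:X k|lborel. f t))\<^sup>2))
        = ennreal (C * (\<Sum>k<n. (cmod (LINT t:X k|lborel. f t))\<^sup>2))"
      using C by (simp add: sum_ennreal sum_distrib_left)
    also have "(\<Sum>k<n. (cmod (LINT t:X k|lborel. f t))\<^sup>2) = (\<Sum>(a, b)\<in>E. (cmod (LINT t:{a..<b}|lborel. f t))\<^sup>2)"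
      unfolding E_def by (subst sum.reindex[OF inj]) (simp add: X_def)
    finally show ?thesis .
  qed
  moreover have "finite E" by (simp add: E_def)
  ultimately show ?thesis using C by blast
qed

subsection \<open>The form and its operator\<close>

lemma L2_sum:
  assumes "finite B" "\<And>b. b \<in> B \<Longrightarrow> f b \<in> L2"
  shows "(\<lambda>x. \<Sum>b\<in>B. f b x) \<in> L2" "abs_l2 (\<lambda>x. \<Sum>b\<in>B. f b x) = (\<Sum>b\<in>B. abs_l2 (f b))"
proof -
  have "(\<lambda>x. \<Sum>b\<in>B. f b x) \<in> L2 \<and> abs_l2 (\<lambda>x. \<Sum>b\<in>B. f b x) = (\<Sum>b\<in>B. abs_l2 (f b))"
    using assms
  proof (induction B rule: finite_induct)
    case empty
    then show ?case by (simp add: L2_zero zero_l2.abs_eq)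
  next
    case (insert b B)
    then show ?case by (simp add: L2_add abs_l2_add[symmetric])
  qed
  then show "(\<lambda>x. \<Sum>b\<in>B. f b x) \<in> L2" "abs_l2 (\<lambda>x. \<Sum>b\<in>B. f b x) = (\<Sum>b\<in>B. abs_l2 (f b))" by auto
qed

lemma abs_l2_mult:
  assumes "f \<in> L2"
  shows "abs_l2 (\<lambda>x. c * f x) = Re c *\<^sub>R abs_l2 f + Im c *\<^sub>R imul (abs_l2 f)"
proof -
  have "c * f x = Re c *\<^sub>R f x + Im c *\<^sub>R (\<i> * f x)" for x
    by (simp add: complex_eq_iff)
  then show ?thesis
    using assms by (simp add: abs_l2_imul abs_l2_scaleR abs_l2_add L2_scaleR L2_mult)
qed

lemma abs_l2_cong_AE: "f \<in> L2 \<Longrightarrow> g \<in> L2 \<Longrightarrow> AE x in lborel. f x = g x \<Longrightarrow> abs_l2 f = abs_l2 g"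
  by (simp add: abs_l2_eq_iff)

lemma norm_abs_l2_sq: "f \<in> L2 \<Longrightarrow> abs_l2 f \<bullet> abs_l2 f = (L2_norm f)\<^sup>2"
  by (simp add: abs_l2_norm flip: power2_norm_eq_inner)

text \<open>Pairing a function with its weak derivative makes \<open>H\<^sup>1\<close> a closed subspace of \<open>l2 \<times> l2\<close>, hence complete.\<close>

definition h1_graph :: "(l2 \<times> l2) set" where
  "h1_graph = {(abs_l2 f, abs_l2 g) | f g. ac_pair f g}"

text \<open>The continuous representative as a function of the pair of classes. Since
  \<open>\<mu>\<close> may charge Lebesgue null sets, integrals against it cannot be formed from
  classes.\<close>

definition crep :: "l2 \<times> l2 \<Rightarrow> real \<Rightarrow> complex" where
  "crep p = (THE f. \<exists>g. ac_pair f g \<and> p = (abs_l2 f, abs_l2 g))"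

lemma h1_graphI: "ac_pair f g \<Longrightarrow> (abs_l2 f, abs_l2 g) \<in> h1_graph"
  by (auto simp: h1_graph_def)

lemma h1_graphE:
  assumes "p \<in> h1_graph"
  obtains f g where "ac_pair f g" "p = (abs_l2 f, abs_l2 g)"
  using assms by (auto simp: h1_graph_def)

lemma crep_eq:
  assumes "ac_pair f g"
  shows "crep (abs_l2 f, abs_l2 g) = f"
  unfolding crep_def
proof (rule the_equality)
  fix f' assume "\<exists>g'. ac_pair f' g' \<and> (abs_l2 f, abs_l2 g) = (abs_l2 f', abs_l2 g')"
  then obtain g' where g': "ac_pair f' g'" "abs_l2 f = abs_l2 f'" by blast
  then have "AE x in lborel. f' x = f x"
    using abs_l2_eq_iff[of f' f] ac_pairD(1) assms by auto
  then show "f' = f" using assms g' ac_pair_continuous continuous_AE_eq by blast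
qed (use assms in blast)

lemma subspace_h1_graph: "subspace h1_graph"
  unfolding subspace_def
proof (intro conjI ballI allI)
  show "0 \<in> h1_graph"
    using h1_graphI[OF ac_pair_zero] by (simp add: zero_prod_def zero_l2.abs_eq)
next
  fix p q assume "p \<in> h1_graph" "q \<in> h1_graph"
  then obtain f g f' g' where "ac_pair f g" "p = (abs_l2 f, abs_l2 g)" "ac_pair f' g'" "q = (abs_l2 f', abs_l2 g')"
    by (metis h1_graphE)
  then show "p + q \<in> h1_graph"
    using h1_graphI[OF ac_pair_add[of f g f' g']] ac_pairD by (simp add: abs_l2_add)
next
  fix c p assume "p \<in> h1_graph"
  then obtain f g where "ac_pair f g" "p = (abs_l2 f, abs_l2 g)" by (metis h1_graphE)
  then show "c *\<^sub>R p \<in> h1_graph"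
    using h1_graphI[OF ac_pair_scaleR[of f g c]] ac_pairD by (simp add: abs_l2_scaleR)
qed

lemma crep_add:
  assumes "p \<in> h1_graph" "q \<in> h1_graph"
  shows "crep (p + q) x = crep p x + crep q x"
proof -
  obtain f g f' g' where *: "ac_pair f g" "p = (abs_l2 f, abs_l2 g)" "ac_pair f' g'" "q = (abs_l2 f', abs_l2 g')"
    using assms by (metis h1_graphE)
  have "p + q = (abs_l2 (\<lambda>x. f x + f' x), abs_l2 (\<lambda>x. g x + g' x))"
    using * ac_pairD by (simp add: abs_l2_add)
  then have "crep (p + q) = (\<lambda>x. f x + f' x)" using crep_eq[OF ac_pair_add[OF *(1,3)]] by simp
  then show ?thesis using * by (simp add: crep_eq)
qed

lemma crep_scaleR:
  assumes "p \<in> h1_graph"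
  shows "crep (c *\<^sub>R p) x = c *\<^sub>R crep p x"
proof -
  obtain f g where *: "ac_pair f g" "p = (abs_l2 f, abs_l2 g)" using assms by (metis h1_graphE)
  have "c *\<^sub>R p = (abs_l2 (\<lambda>x. c *\<^sub>R f x), abs_l2 (\<lambda>x. c *\<^sub>R g x))"
    using * ac_pairD by (simp add: abs_l2_scaleR)
  then have "crep (c *\<^sub>R p) = (\<lambda>x. c *\<^sub>R f x)" using crep_eq[OF ac_pair_scaleR[OF *(1)]] by simp
  then show ?thesis using * by (simp add: crep_eq)
qed

text \<open>The Sobolev embedding: \<open>ac_pair_sup_bound\<close> on the unit interval that starts
  at \<open>y\<close>. Convergence in the graph norm is therefore uniform.\<close>

lemma ac_pair_pointwise_bound:
  assumes "ac_pair f g"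
  shows "(cmod (f y))\<^sup>2 \<le> 2 * (L2_norm f)\<^sup>2 + 2 * (L2_norm g)\<^sup>2"
proof -
  show ?thesis
    using ac_pair_sup_bound[OF assms, of y y "y + 1"] L2_set_square_le[OF ac_pairD(1)[OF assms], of "{y..<y + 1}"]
      L2_set_square_le[OF ac_pairD(2)[OF assms], of "{y..<y + 1}"] by simp
qed

text \<open>The limit of the \<open>f n\<close> in \<open>l2\<close> is only a class, that of
  \<open>U\<close>. The embedding gives a pointwise limit \<open>F\<close>, Fatou's lemma identifies
  it with \<open>U\<close>, and the integral identity passes to the limit at fixed
  endpoints.\<close>

lemma closed_h1_graph: "closed h1_graph"
  unfolding closed_sequential_limits
proof (intro allI impI, elim conjE)
  fix p l assume p: "\<forall>n. p n \<in> h1_graph" "p \<longlonglongrightarrow> l"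
  then have "\<forall>n. \<exists>f g. ac_pair f g \<and> p n = (abs_l2 f, abs_l2 g)" by (metis h1_graphE)
  then obtain f g where fg: "\<And>n. ac_pair (f n) (g n)" "\<And>n. p n = (abs_l2 (f n), abs_l2 (g n))" by metis
  note L = ac_pairD(1)[OF fg(1)] ac_pairD(2)[OF fg(1)]
  obtain U where U: "U \<in> L2" "fst l = abs_l2 U" by (metis l2_cases)
  obtain g' where g': "g' \<in> L2" "snd l = abs_l2 g'" by (metis l2_cases)
  have limf: "(\<lambda>n. L2_norm (\<lambda>x. f n x - U x)) \<longlonglongrightarrow> 0"
    using tendsto_norm_zero[OF LIM_zero[OF tendsto_fst[OF p(2)]]] L U
    by (simp add: fg(2) abs_l2_diff abs_l2_norm L2_diff)
  have limg: "(\<lambda>n. L2_norm (\<lambda>x. g n x - g' x)) \<longlonglongrightarrow> 0"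
    using tendsto_norm_zero[OF LIM_zero[OF tendsto_snd[OF p(2)]]] L g'
    by (simp add: fg(2) abs_l2_diff abs_l2_norm L2_diff)
  have "Cauchy (\<lambda>n. f n x)" for x
  proof (rule CauchyI)
    fix e :: real assume e: "e > 0"
    obtain N where N: "\<And>i j. i \<ge> N \<Longrightarrow> j \<ge> N \<Longrightarrow> norm (p i - p j) < e / 2"
      using CauchyD[OF LIMSEQ_imp_Cauchy[OF p(2)], of "e / 2"] e by auto
    have "norm (f i x - f j x) < e" if "i \<ge> N" "j \<ge> N" for i j
    proof -
      have "(cmod (f i x - f j x))\<^sup>2 \<le> 2 * (L2_norm (\<lambda>x. f i x - f j x))\<^sup>2 + 2 * (L2_norm (\<lambda>x. g i x - g j x))\<^sup>2"
        by (rule ac_pair_pointwise_bound[OF ac_pair_diff[OF fg(1) fg(1)]])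
      also have "\<dots> = 2 * (norm (p i - p j))\<^sup>2"
        using L by (simp add: fg(2) norm_Pair abs_l2_diff abs_l2_norm L2_diff)
      also have "\<dots> < 2 * (e / 2)\<^sup>2" using N[OF that] by (simp add: power_strict_mono)
      also have "\<dots> \<le> e\<^sup>2" by (simp add: power_divide)
      finally show ?thesis using e by (simp add: power_less_imp_less_base)
    qed
    then show "\<exists>M. \<forall>m\<ge>M. \<forall>n\<ge>M. norm (f m x - f n x) < e" by blast
  qed
  then have "\<forall>x. \<exists>y. (\<lambda>n. f n x) \<longlonglongrightarrow> y" by (simp add: Cauchy_convergent_iff convergent_def)
  then obtain F where F: "\<And>x. (\<lambda>n. f n x) \<longlonglongrightarrow> F x" by metis
  have Fm: "F \<in> borel_measurable borel"
    by (rule borel_measurable_LIMSEQ_metric[OF L2_measurable[OF L(1)] F])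
  have diff: "(\<lambda>x. F x - U x) \<in> L2 \<and> L2_norm (\<lambda>x. F x - U x) \<le> e" if "e > 0" for e
  proof -
    obtain N where N: "\<forall>n\<ge>N. norm (L2_norm (\<lambda>x. f n x - U x) - 0) < e" using LIMSEQ_D[OF limf \<open>e > 0\<close>] by blast
    then have "L2_norm (\<lambda>x. f (n + N) x - U x) \<le> e" for n by (auto intro: less_imp_le)
    moreover have "AE x in lborel. (\<lambda>n. f (n + N) x - U x) \<longlonglongrightarrow> F x - U x"
      using F by (intro always_eventually allI tendsto_diff tendsto_const LIMSEQ_ignore_initial_segment)
    moreover have "(\<lambda>x. F x - U x) \<in> borel_measurable lborel" using Fm U(1) by measurable
    ultimately show ?thesis using L2_Fatou[of "\<lambda>n x. f (n + N) x - U x" e "\<lambda>x. F x - U x"] L2_diff[OF L(1) U(1)] by blast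
  qed
  have "L2_norm (\<lambda>x. F x - U x) \<le> 0" by (rule field_le_epsilon) (use diff in simp)
  moreover have FU: "(\<lambda>x. F x - U x) \<in> L2" using diff[of 1] by simp
  ultimately have "abs_l2 (\<lambda>x. F x - U x) = 0"
    using abs_l2_norm[OF FU] L2_norm_nonneg[of "\<lambda>x. F x - U x"] by (metis norm_le_zero_iff)
  have FL: "F \<in> L2" using L2_add[OF FU U(1)] by simp
  then have "abs_l2 F = fst l"
    using \<open>abs_l2 (\<lambda>x. F x - U x) = 0\<close> U by (simp add: abs_l2_diff[symmetric])
  moreover have "ac_pair F g'"
    unfolding ac_pair_def
  proof (intro conjI allI impI FL g')
    fix x y :: real assume xy: "x \<le> y"
    have "(\<lambda>n. (LINT t:{x..y}|lborel. g n t) - (LINT t:{x..y}|lborel. g' t)) \<longlonglongrightarrow> 0"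
    proof (rule Lim_null_comparison[OF always_eventually, rule_format])
      fix n
      let ?d = "\<lambda>t. g n t - g' t"
      have d: "?d \<in> L2" by (rule L2_diff[OF L(2) g'(1)])
      have "(LINT t:{x..y}|lborel. g n t) - (LINT t:{x..y}|lborel. g' t) = (LINT t:{x..y}|lborel. ?d t)"
        by (rule set_integral_diff(2)[symmetric]) (intro L2_set_integrable_Icc L g')+
      then have "norm ((LINT t:{x..y}|lborel. g n t) - (LINT t:{x..y}|lborel. g' t)) \<le> (LINT t:{x..y}|lborel. cmod (?d t))"
        unfolding set_lebesgue_integral_def
        by (simp only:) (rule order_trans[OF integral_norm_bound], simp add: norm_mult)
      \<comment> \<open>Enlarged to a half-open interval, the shape to which
        \<open>L2_set_Cauchy_Schwarz\<close> applies.\<close>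
      also have "\<dots> \<le> (LINT t:{x..<y + 1}|lborel. cmod (?d t))"
        unfolding set_lebesgue_integral_def
        using set_integrable_norm[OF L2_set_integrable_Icc[OF d], of x y]
          set_integrable_norm[OF L2_set_Cauchy_Schwarz(1)[OF d], of x "y + 1"] xy
        by (intro integral_mono) (auto simp: set_integrable_def indicator_def)
      also have "\<dots> \<le> sqrt (y + 1 - x) * L2_norm ?d"
      proof (rule power2_le_imp_le)
        have "(LINT t:{x..<y + 1}|lborel. cmod (?d t))\<^sup>2 \<le> (y + 1 - x) * (LINT t:{x..<y + 1}|lborel. (cmod (?d t))\<^sup>2)"
          using L2_set_Cauchy_Schwarz(2)[OF d, of x "y + 1"] xy by simp
        also have "\<dots> \<le> (y + 1 - x) * (L2_norm ?d)\<^sup>2"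
          using xy by (intro mult_left_mono L2_set_square_le d) auto
        also have "\<dots> = (sqrt (y + 1 - x) * L2_norm ?d)\<^sup>2"
          using xy by (simp add: power_mult_distrib)
        finally show "(LINT t:{x..<y + 1}|lborel. cmod (?d t))\<^sup>2 \<le> (sqrt (y + 1 - x) * L2_norm ?d)\<^sup>2" .
      qed (use xy in simp)
      finally show "norm ((LINT t:{x..y}|lborel. g n t) - (LINT t:{x..y}|lborel. g' t)) \<le> sqrt (y + 1 - x) * L2_norm ?d" .
    next
      show "(\<lambda>n. sqrt (y + 1 - x) * L2_norm (\<lambda>t. g n t - g' t)) \<longlonglongrightarrow> 0"
        using tendsto_mult_left[OF limg, of "sqrt (y + 1 - x)"] by simp
    qed
    then have "(\<lambda>n. LINT t:{x..y}|lborel. g n t) \<longlonglongrightarrow> (LINT t:{x..y}|lborel. g' t)" by (rule LIM_zero_cancel)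
    moreover have "(LINT t:{x..y}|lborel. g n t) = f n y - f n x" for n using ac_pairD(3)[OF fg(1) xy] by simp
    moreover have "(\<lambda>n. f n y - f n x) \<longlonglongrightarrow> F y - F x" by (intro tendsto_diff F)
    ultimately show "F y - F x = (LINT t:{x..y}|lborel. g' t)" using LIMSEQ_unique by auto
  qed
  ultimately show "l \<in> h1_graph" using h1_graphI[of F g'] g'(2) by (metis prod.collapse)
qed

text \<open>The Brinck condition enters the operator theory in the form of this relative bound; the
  coefficient \<open>1/2\<close> leaves half of the kinetic energy for coercivity.\<close>

locale form_bounded_measure =
  fixes \<mu> :: "real measure" and B :: real
  assumes sets_\<mu>: "sets \<mu> = sets borel" and B_nonneg: "0 \<le> B"
    and form_bound: "\<And>f g. ac_pair f g \<Longrightarrow> sq_int \<mu> f UNIV \<le> ennreal (1/2 * (L2_norm g)\<^sup>2 + B * (L2_norm f)\<^sup>2)"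
begin

lemma measurable_\<mu>: "f \<in> borel_measurable borel \<Longrightarrow> f \<in> borel_measurable \<mu>"
  by (simp add: measurable_cong_sets[OF sets_\<mu> refl])

lemma square_integrable_\<mu>:
  assumes fg: "ac_pair f g"
  shows "integrable \<mu> (\<lambda>x. (cmod (f x))\<^sup>2)" "ennreal (LINT x|\<mu>. (cmod (f x))\<^sup>2) = sq_int \<mu> f UNIV"
proof -
  have "(\<lambda>x. (cmod (f x))\<^sup>2) \<in> borel_measurable borel" using ac_pairD(1)[OF fg] by measurable
  then have m: "(\<lambda>x. (cmod (f x))\<^sup>2) \<in> borel_measurable \<mu>" by (rule measurable_\<mu>)
  have "sq_int \<mu> f UNIV < \<infinity>" using form_bound[OF fg] ennreal_less_top le_less_trans infinity_ennreal_def by metis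
  then show 1: "integrable \<mu> (\<lambda>x. (cmod (f x))\<^sup>2)"
    by (intro integrableI_bounded m) (simp add: sq_int_def)
  show "ennreal (LINT x|\<mu>. (cmod (f x))\<^sup>2) = sq_int \<mu> f UNIV"
    using nn_integral_eq_integral[OF 1] by (simp add: sq_int_def)
qed

lemma product_integrable_\<mu>:
  assumes "ac_pair f g" "ac_pair f' g'"
  shows "integrable \<mu> (\<lambda>x. f x * cnj (f' x))"
proof (rule Bochner_Integration.integrable_bound)
  show "integrable \<mu> (\<lambda>x. (cmod (f x))\<^sup>2 + (cmod (f' x))\<^sup>2)"
    using assms square_integrable_\<mu>(1) by simp
  have "(\<lambda>x. f x * cnj (f' x)) \<in> borel_measurable borel"
    using assms ac_pairD(1) by measurable
  then show "(\<lambda>x. f x * cnj (f' x)) \<in> borel_measurable \<mu>" by (rule measurable_\<mu>)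
  have "norm (f x * cnj (f' x)) \<le> norm ((cmod (f x))\<^sup>2 + (cmod (f' x))\<^sup>2)" for x
    using norm_mult_le_squares[of "f x" "f' x"] by (simp add: norm_mult)
  then show "AE x in \<mu>. norm (f x * cnj (f' x)) \<le> norm ((cmod (f x))\<^sup>2 + (cmod (f' x))\<^sup>2)" by simp
qed

lemma form_domain_iff: "f \<in> form_domain \<mu> \<longleftrightarrow> (\<exists>g. ac_pair f g)"
  using square_integrable_\<mu>(1) by (auto simp: form_domain_def H1_iff_ac_pair)

text \<open>The real part of \<open>form_a\<close>, on pairs. Its values at multiples of the test
  function by the imaginary unit recover the imaginary part.\<close>

definition form_r :: "l2 \<times> l2 \<Rightarrow> l2 \<times> l2 \<Rightarrow> real" where
  "form_r p q = snd p \<bullet> snd q - Re (LINT x|\<mu>. crep p x * cnj (crep q x))"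

lemma form_r_abs:
  assumes "ac_pair f g" "ac_pair f' g'"
  shows "form_r (abs_l2 f, abs_l2 g) (abs_l2 f', abs_l2 g')
    = abs_l2 g \<bullet> abs_l2 g' - Re (LINT x|\<mu>. f x * cnj (f' x))"
  using assms by (simp add: form_r_def crep_eq)

lemma form_r_self:
  assumes "ac_pair f g"
  shows "form_r (abs_l2 f, abs_l2 g) (abs_l2 f, abs_l2 g) = (L2_norm g)\<^sup>2 - (LINT x|\<mu>. (cmod (f x))\<^sup>2)"
proof -
  have "(LINT x|\<mu>. f x * cnj (f x)) = of_real (LINT x|\<mu>. (cmod (f x))\<^sup>2)"
    unfolding complex_norm_square[symmetric] of_real_power[symmetric] integral_complex_of_real ..
  then show ?thesis using assms ac_pairD by (simp add: form_r_abs norm_abs_l2_sq)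
qed

lemma form_r_add:
  assumes "p \<in> h1_graph" "q \<in> h1_graph" "r \<in> h1_graph"
  shows "form_r (p + q) r = form_r p r + form_r q r"
proof -
  have int: "integrable \<mu> (\<lambda>x. crep p x * cnj (crep q x))" if "p \<in> h1_graph" "q \<in> h1_graph" for p q
    using that by (metis crep_eq h1_graphE product_integrable_\<mu>)
  have "(LINT x|\<mu>. crep (p + q) x * cnj (crep r x))
      = (LINT x|\<mu>. crep p x * cnj (crep r x)) + (LINT x|\<mu>. crep q x * cnj (crep r x))"
    using assms by (simp add: crep_add distrib_right int)
  then show ?thesis by (simp add: form_r_def inner_add_left)
qed

lemma form_r_scale: "p \<in> h1_graph \<Longrightarrow> form_r (c *\<^sub>R p) q = c * form_r p q"
  by (simp add: form_r_def crep_scaleR right_diff_distrib)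

lemma form_r_sym: "form_r p q = form_r q p"
proof -
  have "(LINT x|\<mu>. crep p x * cnj (crep q x)) = cnj (LINT x|\<mu>. crep q x * cnj (crep p x))"
    unfolding Bochner_Integration.integral_cnj[symmetric] by (simp add: mult.commute)
  then show ?thesis by (simp add: form_r_def inner_commute)
qed

text \<open>In the shift, \<open>B\<close> absorbs the negative part of the relative bound and the
  remaining 1 restores the norm of the function, so the form is equivalent to the squared norm on
  the graph.\<close>

definition form_c :: "l2 \<times> l2 \<Rightarrow> l2 \<times> l2 \<Rightarrow> real" where
  "form_c p q = form_r p q + (B + 1) * (fst p \<bullet> fst q)"

lemma form_c_bounds:
  assumes "p \<in> h1_graph"
  shows "1/2 * (norm p)\<^sup>2 \<le> form_c p p" "form_c p p \<le> (B + 1) * (norm p)\<^sup>2"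
proof -
  obtain f g where fg: "ac_pair f g" "p = (abs_l2 f, abs_l2 g)" using assms by (metis h1_graphE)
  note L = ac_pairD(1,2)[OF fg(1)]
  have n: "(norm p)\<^sup>2 = (L2_norm f)\<^sup>2 + (L2_norm g)\<^sup>2"
    using L by (simp add: fg(2) norm_Pair abs_l2_norm)
  have c: "form_c p p = (L2_norm g)\<^sup>2 - (LINT x|\<mu>. (cmod (f x))\<^sup>2) + (B + 1) * (L2_norm f)\<^sup>2"
    using form_r_self[OF fg(1)] L by (simp add: form_c_def fg(2) norm_abs_l2_sq)
  have "ennreal (LINT x|\<mu>. (cmod (f x))\<^sup>2) \<le> ennreal (1/2 * (L2_norm g)\<^sup>2 + B * (L2_norm f)\<^sup>2)"
    unfolding square_integrable_\<mu>(2)[OF fg(1)] by (rule form_bound[OF fg(1)])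
  moreover have "0 \<le> 1/2 * (L2_norm g)\<^sup>2 + B * (L2_norm f)\<^sup>2" using B_nonneg by simp
  ultimately have "(LINT x|\<mu>. (cmod (f x))\<^sup>2) \<le> 1/2 * (L2_norm g)\<^sup>2 + B * (L2_norm f)\<^sup>2"
    using ennreal_le_iff by blast
  moreover have c': "form_c p p = (L2_norm g)\<^sup>2 - (LINT x|\<mu>. (cmod (f x))\<^sup>2) + B * (L2_norm f)\<^sup>2 + (L2_norm f)\<^sup>2"
    using c by (simp add: algebra_simps)
  moreover have "0 \<le> (L2_norm f)\<^sup>2" by simp
  ultimately show "1/2 * (norm p)\<^sup>2 \<le> form_c p p" using n by linarith
  have "0 \<le> (LINT x|\<mu>. (cmod (f x))\<^sup>2)" by simp
  moreover have "0 \<le> B * (L2_norm g)\<^sup>2" using B_nonneg by simp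
  moreover have "(B + 1) * (norm p)\<^sup>2 = B * (L2_norm f)\<^sup>2 + B * (L2_norm g)\<^sup>2 + (L2_norm f)\<^sup>2 + (L2_norm g)\<^sup>2"
    using n by (simp add: algebra_simps)
  ultimately show "form_c p p \<le> (B + 1) * (norm p)\<^sup>2" using c' by linarith
qed

sublocale form_c: psd_form h1_graph form_c
proof
  fix x y z assume "x \<in> h1_graph" "y \<in> h1_graph" "z \<in> h1_graph"
  then show "form_c (x + y) z = form_c x z + form_c y z"
    by (simp add: form_c_def form_r_add inner_add_left algebra_simps)
next
  fix r x y assume "x \<in> h1_graph" "y \<in> h1_graph"
  then show "form_c (r *\<^sub>R x) y = r * form_c x y"
    by (simp add: form_c_def form_r_scale algebra_simps)
next
  fix x y show "form_c x y = form_c y x" by (simp add: form_c_def form_r_sym[of x y] inner_commute)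
next
  fix x assume "x \<in> h1_graph"
  then have "1/2 * (norm x)\<^sup>2 \<le> form_c x x" by (rule form_c_bounds)
  then show "0 \<le> form_c x x" using zero_le_power2[of "norm x"] by linarith
qed (rule subspace_h1_graph)

text \<open>\<open>fst p\<close> is the inverse of the operator shifted by \<open>B + 1\<close>,
  applied to \<open>f\<close>; it exists because the graph is complete.\<close>

lemma form_c_solve: "\<exists>p\<in>h1_graph. \<forall>q\<in>h1_graph. form_c p q = f \<bullet> fst q"
proof (rule riesz_form[OF form_c.psd_form_axioms closed_h1_graph])
  show "(0::real) < 1/2" by simp
  show "1/2 * (norm x)\<^sup>2 \<le> form_c x x" if "x \<in> h1_graph" for x using form_c_bounds(1)[OF that] .
  show "form_c x x \<le> (B + 1) * (norm x)\<^sup>2" if "x \<in> h1_graph" for x using form_c_bounds(2)[OF that] .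
  show "bounded_linear (\<lambda>q. f \<bullet> fst q)"
    by (intro bounded_linear_intros)
qed

section \<open>The operator as a self-adjoint relation\<close>

definition op_rel :: "(l2 \<times> l2) set" where
  "op_rel = {(abs_l2 u, abs_l2 w) | u w. (u, w) \<in> H_op \<mu>}"

lemma abs_weak_deriv:
  assumes "ac_pair f g"
  shows "weak_deriv f \<in> L2" "abs_l2 (weak_deriv f) = abs_l2 g"
proof -
  have "f \<in> H1" using assms H1_iff_ac_pair by blast
  then have *: "ac_pair f (weak_deriv f)" by (rule ac_pair_weak_deriv)
  then show "weak_deriv f \<in> L2" by (rule ac_pairD)
  then show "abs_l2 (weak_deriv f) = abs_l2 g"
    using ac_pair_unique[OF * assms] ac_pairD(2)[OF assms] by (intro abs_l2_cong_AE)
qed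

lemma Re_form_a:
  assumes "ac_pair f g" "ac_pair f' g'"
  shows "Re (form_a \<mu> f f') = form_r (abs_l2 f, abs_l2 g) (abs_l2 f', abs_l2 g')"
proof -
  have "Re (L2_inner (weak_deriv f) (weak_deriv f')) = abs_l2 g \<bullet> abs_l2 g'"
    using abs_weak_deriv[OF assms(1)] abs_weak_deriv[OF assms(2)] by (metis abs_l2_inner)
  then show ?thesis using form_r_abs[OF assms] by (simp add: form_a_def)
qed

lemma L2_inner_mult_right: "L2_inner f (\<lambda>x. c * g x) = cnj c * L2_inner f g"
proof -
  have "L2_inner f (\<lambda>x. c * g x) = (LINT x|lborel. cnj c * (f x * cnj (g x)))"
    unfolding L2_inner_def by (intro Bochner_Integration.integral_cong) auto
  then show ?thesis by (simp add: L2_inner_def)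
qed

lemma form_a_mult_right:
  assumes "ac_pair f g" "ac_pair f' g'"
  shows "form_a \<mu> f (\<lambda>x. c * f' x) = cnj c * form_a \<mu> f f'"
proof -
  note cf = ac_pair_mult[OF assms(2), of c]
  have L: "weak_deriv (\<lambda>x. c * f' x) \<in> L2" "weak_deriv f' \<in> L2" "weak_deriv f \<in> L2"
    using abs_weak_deriv assms cf by auto
  have "abs_l2 (weak_deriv (\<lambda>x. c * f' x)) = abs_l2 (\<lambda>x. c * weak_deriv f' x)"
    using abs_weak_deriv[OF cf] abs_weak_deriv[OF assms(2)] ac_pairD(2)[OF assms(2)]
    by (simp add: abs_l2_mult)
  then have "L2_inner (weak_deriv f) (weak_deriv (\<lambda>x. c * f' x)) = L2_inner (weak_deriv f) (\<lambda>x. c * weak_deriv f' x)"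
    using L abs_l2_eq_iff by (intro L2_inner_cong) (auto simp: L2_eq_def L2_mult)
  moreover have "(LINT x|\<mu>. f x * cnj (c * f' x)) = (LINT x|\<mu>. cnj c * (f x * cnj (f' x)))"
    by (intro Bochner_Integration.integral_cong) auto
  ultimately show ?thesis
    by (simp add: form_a_def L2_inner_mult_right right_diff_distrib)
qed

text \<open>Testing with real parts suffices because the form domain is closed under multiplication
  by the imaginary unit.\<close>

lemma op_rel_iff:
  "(x, y) \<in> op_rel \<longleftrightarrow> (\<exists>g. (x, g) \<in> h1_graph \<and> (\<forall>q\<in>h1_graph. form_r (x, g) q = y \<bullet> fst q))"
proof
  assume "(x, y) \<in> op_rel"
  then obtain u w where uw: "x = abs_l2 u" "y = abs_l2 w" "(u, w) \<in> H_op \<mu>" by (auto simp: op_rel_def)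
  then have w: "w \<in> L2" "\<And>v. v \<in> form_domain \<mu> \<Longrightarrow> form_a \<mu> u v = L2_inner w v" and u: "u \<in> form_domain \<mu>"
    by (auto simp: H_op_def form_operator_def)
  obtain g where g: "ac_pair u g" using u form_domain_iff[of u] by blast
  have "form_r (x, abs_l2 g) q = y \<bullet> fst q" if q: "q \<in> h1_graph" for q
  proof -
    obtain v h where v: "ac_pair v h" "q = (abs_l2 v, abs_l2 h)" using q by (rule h1_graphE)
    have "form_a \<mu> u v = L2_inner w v" by (rule w(2)) (use v(1) form_domain_iff[of v] in blast)
    then show ?thesis
      using Re_form_a[OF g v(1)] w(1) ac_pairD(1)[OF v(1)] by (simp add: uw v(2) abs_l2_inner)
  qed
  then show "\<exists>g. (x, g) \<in> h1_graph \<and> (\<forall>q\<in>h1_graph. form_r (x, g) q = y \<bullet> fst q)"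
    using h1_graphI[OF g] uw(1) by blast
next
  assume "\<exists>g. (x, g) \<in> h1_graph \<and> (\<forall>q\<in>h1_graph. form_r (x, g) q = y \<bullet> fst q)"
  then obtain g where g: "(x, g) \<in> h1_graph" "\<And>q. q \<in> h1_graph \<Longrightarrow> form_r (x, g) q = y \<bullet> fst q" by blast
  obtain u u' where u: "ac_pair u u'" "(x, g) = (abs_l2 u, abs_l2 u')" using g(1) by (rule h1_graphE)
  obtain w where w: "w \<in> L2" "y = abs_l2 w" by (metis l2_cases)
  have Re_eq: "Re (form_a \<mu> u v) = Re (L2_inner w v)" if "ac_pair v h" for v h
    using g(2)[OF h1_graphI[OF that]] Re_form_a[OF u(1) that] u(2) w ac_pairD(1)[OF that]
    by (simp add: abs_l2_inner)
  have "form_a \<mu> u v = L2_inner w v" if v: "v \<in> form_domain \<mu>" for v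
  proof (rule complex_eqI)
    obtain h where h: "ac_pair v h" using v form_domain_iff[of v] by blast
    show "Re (form_a \<mu> u v) = Re (L2_inner w v)" by (rule Re_eq[OF h])
    \<comment> \<open>The real part at \<open>\<i> * v\<close> is the imaginary part at
      \<open>v\<close>.\<close>
    have "Re (- \<i> * form_a \<mu> u v) = Re (- \<i> * L2_inner w v)"
      using Re_eq[OF ac_pair_mult[OF h, of \<i>]] form_a_mult_right[OF u(1) h, of \<i>] L2_inner_mult_right[of w \<i> v]
      by simp
    then show "Im (form_a \<mu> u v) = Im (L2_inner w v)" by simp
  qed
  then have "(u, w) \<in> H_op \<mu>"
    using u(1) w(1) form_domain_iff[of u] unfolding H_op_def form_operator_def by blast
  then show "(x, y) \<in> op_rel" using u(2) w(2) by (auto simp: op_rel_def)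
qed

lemma op_rel_resolvent:
  assumes "p \<in> h1_graph" "\<And>q. q \<in> h1_graph \<Longrightarrow> form_c p q = f \<bullet> fst q"
  shows "(fst p, f - (B + 1) *\<^sub>R fst p) \<in> op_rel"
  unfolding op_rel_iff
proof (intro exI[of _ "snd p"] conjI ballI)
  show "(fst p, snd p) \<in> h1_graph" using assms(1) by simp
  fix q assume "q \<in> h1_graph"
  then show "form_r (fst p, snd p) q = (f - (B + 1) *\<^sub>R fst p) \<bullet> fst q"
    using assms(2)[of q] by (simp add: form_c_def inner_diff_left)
qed

lemma op_rel_symmetric:
  assumes "(x, y) \<in> op_rel" "(x', y') \<in> op_rel"
  shows "y \<bullet> x' = x \<bullet> y'"
proof -
  obtain g where g: "(x, g) \<in> h1_graph" "\<And>q. q \<in> h1_graph \<Longrightarrow> form_r (x, g) q = y \<bullet> fst q"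
    using assms(1) op_rel_iff by blast
  obtain g' where g': "(x', g') \<in> h1_graph" "\<And>q. q \<in> h1_graph \<Longrightarrow> form_r (x', g') q = y' \<bullet> fst q"
    using assms(2) op_rel_iff by blast
  show ?thesis
    using g(2)[OF g'(1)] g'(2)[OF g(1)] form_r_sym[of "(x, g)" "(x', g')"] by (simp add: inner_commute)
qed

lemma imul_skew: "imul u \<bullet> v = - (u \<bullet> imul v)"
  using imul_facts(4)[of u "imul v"] by (simp add: imul_facts(3))

lemma op_rel_imul:
  assumes "(x, y) \<in> op_rel"
  shows "(imul x, imul y) \<in> op_rel"
proof -
  obtain g where g: "(x, g) \<in> h1_graph" "\<And>q. q \<in> h1_graph \<Longrightarrow> form_r (x, g) q = y \<bullet> fst q"
    using assms op_rel_iff by blast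
  obtain u u' where u: "ac_pair u u'" "x = abs_l2 u" "g = abs_l2 u'" using g(1) by (auto elim: h1_graphE)
  have i: "(imul (abs_l2 f), imul (abs_l2 f')) = (abs_l2 (\<lambda>x. \<i> * f x), abs_l2 (\<lambda>x. \<i> * f' x))"
    if "ac_pair f f'" for f f'
    using ac_pairD[OF that] by (simp add: abs_l2_imul)
  have "form_r (imul x, imul g) q = imul y \<bullet> fst q" if q: "q \<in> h1_graph" for q
  proof -
    obtain v h where v: "ac_pair v h" "q = (abs_l2 v, abs_l2 h)" using q by (rule h1_graphE)
    have "(LINT t|\<mu>. \<i> * u t * cnj (v t)) = \<i> * (LINT t|\<mu>. u t * cnj (v t))"
      unfolding mult.assoc by simp
    moreover have "(LINT t|\<mu>. u t * cnj (\<i> * v t)) = - \<i> * (LINT t|\<mu>. u t * cnj (v t))"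
    proof -
      have "(LINT t|\<mu>. u t * cnj (\<i> * v t)) = (LINT t|\<mu>. - \<i> * (u t * cnj (v t)))"
        by (intro Bochner_Integration.integral_cong) auto
      then show ?thesis by simp
    qed
    ultimately have "form_r (imul x, imul g) q = - form_r (x, g) (imul (abs_l2 v), imul (abs_l2 h))"
      unfolding u(2,3) v(2) i[OF u(1)] i[OF v(1)]
      using form_r_abs[OF ac_pair_mult[OF u(1)] v(1)] form_r_abs[OF u(1) ac_pair_mult[OF v(1)]]
        imul_skew[of "abs_l2 u'" "abs_l2 h"] ac_pairD[OF u(1)] ac_pairD[OF v(1)]
      by (simp add: abs_l2_imul)
    also have "\<dots> = - (y \<bullet> imul (abs_l2 v))"
      using g(2)[OF h1_graphI[OF ac_pair_mult[OF v(1), of \<i>]]] i[OF v(1)] by simp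
    finally show ?thesis by (simp add: v(2) imul_skew)
  qed
  moreover have "(imul x, imul g) \<in> h1_graph"
    unfolding u(2,3) i[OF u(1)] by (rule h1_graphI[OF ac_pair_mult[OF u(1)]])
  ultimately show ?thesis unfolding op_rel_iff by blast
qed

sublocale op: selfadjoint_relation op_rel imul
proof
  fix w h
  show "(w, h) \<in> op_rel \<longleftrightarrow> (\<forall>(u, v)\<in>op_rel. v \<bullet> w = u \<bullet> h)"
  proof
    assume "(w, h) \<in> op_rel"
    then show "\<forall>(u, v)\<in>op_rel. v \<bullet> w = u \<bullet> h" using op_rel_symmetric by blast
  next
    assume a: "\<forall>(u, v)\<in>op_rel. v \<bullet> w = u \<bullet> h"
    define c where "c = B + 1"
    have res: "\<exists>x. (x, f - c *\<^sub>R x) \<in> op_rel" for f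
      using form_c_solve[of f] op_rel_resolvent unfolding c_def by blast
    \<comment> \<open>A symmetric relation is self-adjoint as soon as \<open>T + c\<close> is onto:
      \<open>u0\<close> solves the shifted equation that \<open>w\<close> would have to solve, and
      \<open>w - u0\<close> is orthogonal to the range of \<open>T + c\<close>, which is
      everything.\<close>
    obtain u0 where u0: "(u0, (h + c *\<^sub>R w) - c *\<^sub>R u0) \<in> op_rel" using res by blast
    have "f \<bullet> (w - u0) = 0" for f
    proof -
      obtain x where x: "(x, f - c *\<^sub>R x) \<in> op_rel" using res by blast
      have "(f - c *\<^sub>R x) \<bullet> w = x \<bullet> h" using a x by blast
      moreover have "(f - c *\<^sub>R x) \<bullet> u0 = x \<bullet> ((h + c *\<^sub>R w) - c *\<^sub>R u0)" by (rule op_rel_symmetric[OF x u0])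
      ultimately show ?thesis by (simp add: inner_diff_left inner_diff_right inner_add_right)
    qed
    then have "w = u0" by (metis inner_eq_zero_iff right_minus_eq)
    then show "(w, h) \<in> op_rel" using u0 by simp
  qed
qed (auto simp: imul_facts op_rel_imul)

end

subsection \<open>The essential spectrum\<close>

context form_bounded_measure
begin

lemma op_relE:
  assumes "(x, y) \<in> op_rel"
  obtains u w where "(u, w) \<in> H_op \<mu>" "u \<in> L2" "w \<in> L2" "x = abs_l2 u" "y = abs_l2 w"
proof -
  obtain u w where uw: "(u, w) \<in> H_op \<mu>" "x = abs_l2 u" "y = abs_l2 w"
    using assms by (auto simp: op_rel_def)
  then have "u \<in> L2" "w \<in> L2"
    by (auto simp: H_op_def form_operator_def form_domain_def H1_def)
  then show thesis using that uw by blast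
qed

lemma H_op_L2: "(u, w) \<in> H_op \<mu> \<Longrightarrow> u \<in> L2" "(u, w) \<in> H_op \<mu> \<Longrightarrow> w \<in> L2"
  by (auto simp: H_op_def form_operator_def form_domain_def H1_def)

lemma op_relI: "(u, w) \<in> H_op \<mu> \<Longrightarrow> (abs_l2 u, abs_l2 w) \<in> op_rel"
  by (auto simp: op_rel_def)

lemma shift_abs:
  assumes "u \<in> L2" "w \<in> L2"
  shows "op.shift z (abs_l2 u, abs_l2 w) = abs_l2 (\<lambda>x. w x - z * u x)"
proof -
  have "abs_l2 (\<lambda>x. w x - z * u x) = abs_l2 w - abs_l2 (\<lambda>x. z * u x)"
    using assms by (simp add: abs_l2_diff L2_mult)
  then show ?thesis
    using assms by (simp add: op.shift_def abs_l2_mult)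
qed

lemma resolvent_set_iff: "z \<in> resolvent_set (H_op \<mu>) \<longleftrightarrow> op.regular z"
proof
  assume z: "z \<in> resolvent_set (H_op \<mu>)"
  then obtain c where c: "\<And>u w. (u, w) \<in> H_op \<mu> \<Longrightarrow> L2_norm u \<le> c * L2_norm (\<lambda>x. w x - z * u x)"
    unfolding resolvent_set_def by blast
  have "\<exists>p\<in>op_rel. op.shift z p = F" for F
  proof -
    obtain f where f: "f \<in> L2" "F = abs_l2 f" by (metis l2_cases)
    then obtain u w where uw: "(u, w) \<in> H_op \<mu>" "AE x in lborel. w x - z * u x = f x"
      using z unfolding resolvent_set_def by blast
    note L = H_op_L2[OF uw(1)]
    have "op.shift z (abs_l2 u, abs_l2 w) = F"
      unfolding shift_abs[OF L] f(2) using L f(1) uw(2) by (intro abs_l2_cong_AE L2_diff L2_mult)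
    then show ?thesis using op_relI[OF uw(1)] by blast
  qed
  moreover have "norm (fst p) \<le> c * norm (op.shift z p)" if p: "p \<in> op_rel" for p
  proof -
    obtain x y where xy: "p = (x, y)" by force
    obtain u w where uw: "(u, w) \<in> H_op \<mu>" "u \<in> L2" "w \<in> L2" "x = abs_l2 u" "y = abs_l2 w"
      using p[unfolded xy] by (rule op_relE)
    then show ?thesis using c[OF uw(1)] by (simp add: xy shift_abs abs_l2_norm L2_diff L2_mult)
  qed
  ultimately show "op.regular z" unfolding op.regular_def by blast
next
  assume z: "op.regular z"
  then obtain c where c: "\<And>p. p \<in> op_rel \<Longrightarrow> norm (fst p) \<le> c * norm (op.shift z p)"
    unfolding op.regular_def by blast
  have "\<exists>(u, w)\<in>H_op \<mu>. AE x in lborel. w x - z * u x = f x" if f: "f \<in> L2" for f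
  proof -
    obtain p where p: "p \<in> op_rel" "op.shift z p = abs_l2 f" using z unfolding op.regular_def by blast
    obtain x y where xy: "p = (x, y)" by force
    obtain u w where uw: "(u, w) \<in> H_op \<mu>" "u \<in> L2" "w \<in> L2" "x = abs_l2 u" "y = abs_l2 w"
      using p(1)[unfolded xy] by (rule op_relE)
    have "abs_l2 (\<lambda>x. w x - z * u x) = abs_l2 f"
      using p(2) shift_abs[OF uw(2,3)] by (simp add: xy uw(4,5))
    then have "AE x in lborel. w x - z * u x = f x"
      using abs_l2_eq_iff[OF L2_diff[OF uw(3) L2_mult[OF uw(2)]] f] by blast
    then show ?thesis using uw(1) by blast
  qed
  moreover have "L2_norm u \<le> c * L2_norm (\<lambda>x. w x - z * u x)" if uw: "(u, w) \<in> H_op \<mu>" for u w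
    using c[OF op_relI[OF uw]] H_op_L2[OF uw] by (simp add: shift_abs abs_l2_norm L2_diff L2_mult)
  ultimately show "z \<in> resolvent_set (H_op \<mu>)" unfolding resolvent_set_def by blast
qed

lemma spectrum_iff: "z \<in> spectrum (H_op \<mu>) \<longleftrightarrow> \<not> op.regular z"
  by (simp add: spectrum_def resolvent_set_iff)

lemma isolated_iff:
  "\<not> z islimpt spectrum (H_op \<mu>) \<longleftrightarrow> (\<exists>d>0. \<forall>z'. z' \<noteq> z \<and> cmod (z' - z) < d \<longrightarrow> op.regular z')"
  unfolding islimpt_approachable dist_norm Bex_def spectrum_iff by auto

lemma eigenspace_real_iff:
  assumes "u \<in> eigenspace (H_op \<mu>) (complex_of_real x)"
  shows "u \<in> L2" "(abs_l2 u, x *\<^sub>R abs_l2 u) \<in> op_rel"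
proof -
  obtain w where w: "(u, w) \<in> H_op \<mu>" "AE t in lborel. w t = complex_of_real x * u t"
    using assms unfolding eigenspace_def by blast
  note L = H_op_L2[OF w(1)]
  show "u \<in> L2" by (rule L)
  have "abs_l2 w = abs_l2 (\<lambda>t. complex_of_real x * u t)"
    by (rule abs_l2_cong_AE[OF L(2) L2_mult[OF L(1)] w(2)])
  also have "\<dots> = x *\<^sub>R abs_l2 u" using L by (simp add: abs_l2_mult)
  finally show "(abs_l2 u, x *\<^sub>R abs_l2 u) \<in> op_rel" using op_relI[OF w(1)] by simp
qed

lemma eigenvector_representative:
  assumes "(U, x *\<^sub>R U) \<in> op_rel"
  shows "\<exists>u\<in>eigenspace (H_op \<mu>) (complex_of_real x). u \<in> L2 \<and> abs_l2 u = U"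
proof -
  obtain u w where uw: "(u, w) \<in> H_op \<mu>" "u \<in> L2" "w \<in> L2" "U = abs_l2 u" "x *\<^sub>R U = abs_l2 w"
    using assms by (rule op_relE)
  have "abs_l2 w = abs_l2 (\<lambda>t. complex_of_real x * u t)"
    using uw by (simp add: abs_l2_mult)
  then have "AE t in lborel. w t = complex_of_real x * u t"
    using abs_l2_eq_iff[OF uw(3) L2_mult[OF uw(2)]] by blast
  then show ?thesis using uw unfolding eigenspace_def by blast
qed

lemma isolated_eigenvalue_imp_discrete:
  assumes iso: "op.isolated_eigenvalue z" and nr: "\<not> op.regular z"
  shows "z \<in> discrete_spectrum (H_op \<mu>)"
proof -
  define x where "x = Re z"
  have z: "z = complex_of_real x" using iso by (auto simp: op.isolated_eigenvalue_def x_def complex_eq_iff)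
  obtain U where U: "U \<noteq> 0" "(U, x *\<^sub>R U) \<in> op_rel"
    using iso unfolding op.isolated_eigenvalue_def x_def by blast
  obtain F where F: "finite F" "\<And>V. (V, x *\<^sub>R V) \<in> op_rel \<Longrightarrow> V \<in> span F"
    using iso unfolding op.isolated_eigenvalue_def x_def by blast
  have "eigenvalue (H_op \<mu>) z"
  proof -
    obtain u where u: "u \<in> eigenspace (H_op \<mu>) z" "u \<in> L2" "abs_l2 u = U"
      using eigenvector_representative[OF U(2)] unfolding z by blast
    have "\<not> (AE t in lborel. u t = 0)"
    proof
      assume "AE t in lborel. u t = 0"
      then have "abs_l2 u = abs_l2 (\<lambda>t. 0)" by (rule abs_l2_cong_AE[OF u(2) L2_zero])
      then show False using u(3) U(1) by (simp add: zero_l2.abs_eq)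
    qed
    then show ?thesis using u(1) unfolding eigenvalue_def by blast
  qed
  moreover have "finite_multiplicity (H_op \<mu>) z"
  proof -
    define r where "r V = (SOME f. f \<in> L2 \<and> abs_l2 f = V)" for V
    have r: "r V \<in> L2" "abs_l2 (r V) = V" for V
    proof -
      have "\<exists>f. f \<in> L2 \<and> abs_l2 f = V" by (metis l2_cases)
      then have "r V \<in> L2 \<and> abs_l2 (r V) = V" unfolding r_def by (rule someI_ex)
      then show "r V \<in> L2" "abs_l2 (r V) = V" by auto
    qed
    \<comment> \<open>Distinct classes have distinct representatives, so a sum over \<open>F\<close>
      can be rewritten over the chosen functions, with the coefficients attached to them.\<close>
    have inj: "inj_on r F" by (rule inj_on_inverseI[of F abs_l2]) (rule r(2))
    have "\<exists>c. AE t in lborel. u t = (\<Sum>b\<in>r ` F. c b * b t)" if u: "u \<in> eigenspace (H_op \<mu>) z" for u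
    proof -
      note uL = eigenspace_real_iff[OF u[unfolded z]]
      have "abs_l2 u \<in> span F" by (rule F(2)[OF uL(2)])
      then obtain c where c: "abs_l2 u = (\<Sum>V\<in>F. c V *\<^sub>R V)"
        using span_finite[OF F(1)] by auto
      have "(\<Sum>V\<in>F. c V *\<^sub>R V) = (\<Sum>V\<in>F. abs_l2 (\<lambda>t. c V *\<^sub>R r V t))"
        using r by (simp add: abs_l2_scaleR[symmetric])
      also have "\<dots> = abs_l2 (\<lambda>t. \<Sum>V\<in>F. c V *\<^sub>R r V t)"
        by (rule L2_sum(2)[symmetric, OF F(1)]) (rule L2_scaleR[OF r(1)])
      finally have "AE t in lborel. u t = (\<Sum>V\<in>F. c V *\<^sub>R r V t)"
        using c abs_l2_eq_iff[OF uL(1) L2_sum(1)[OF F(1), of "\<lambda>V t. c V *\<^sub>R r V t"]] L2_scaleR[OF r(1)] by simp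
      moreover have "(\<Sum>V\<in>F. c V *\<^sub>R r V t) = (\<Sum>b\<in>r ` F. complex_of_real (c (abs_l2 b)) * b t)" for t
        unfolding sum.reindex[OF inj] by (simp add: r(2) scaleR_conv_of_real)
      ultimately show ?thesis by (intro exI[of _ "\<lambda>b. complex_of_real (c (abs_l2 b))"]) simp
    qed
    moreover have "finite (r ` F)" "r ` F \<subseteq> L2" using F(1) r(1) by auto
    ultimately show ?thesis unfolding finite_multiplicity_def by blast
  qed
  moreover have "\<not> z islimpt spectrum (H_op \<mu>)"
    unfolding isolated_iff using iso unfolding op.isolated_eigenvalue_def by blast
  ultimately show ?thesis using nr unfolding discrete_spectrum_def spectrum_iff by blast
qed

lemma discrete_imp_isolated_eigenvalue:
  assumes "complex_of_real x \<in> discrete_spectrum (H_op \<mu>)"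
  shows "op.isolated_eigenvalue (complex_of_real x)"
proof -
  let ?z = "complex_of_real x"
  have d: "\<not> ?z islimpt spectrum (H_op \<mu>)" "eigenvalue (H_op \<mu>) ?z" "finite_multiplicity (H_op \<mu>) ?z"
    using assms by (auto simp: discrete_spectrum_def)
  have "\<exists>U. U \<noteq> 0 \<and> (U, x *\<^sub>R U) \<in> op_rel"
  proof -
    obtain u where u: "u \<in> eigenspace (H_op \<mu>) ?z" "\<not> (AE t in lborel. u t = 0)"
      using d(2) unfolding eigenvalue_def by blast
    note uL = eigenspace_real_iff[OF u(1)]
    have "abs_l2 u \<noteq> 0" using abs_l2_eq_iff[OF uL(1) L2_zero] u(2) by (simp add: zero_l2.abs_eq)
    then show ?thesis using uL(2) by blast
  qed
  moreover have "\<exists>F. finite F \<and> (\<forall>U. (U, x *\<^sub>R U) \<in> op_rel \<longrightarrow> U \<in> span F)"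
  proof -
    obtain E where E: "finite E" "E \<subseteq> L2"
      "\<And>u. u \<in> eigenspace (H_op \<mu>) ?z \<Longrightarrow> \<exists>c. AE t in lborel. u t = (\<Sum>b\<in>E. c b * b t)"
      using d(3) unfolding finite_multiplicity_def by blast
    \<comment> \<open>A complex combination of \<open>E\<close> is a real combination of its classes
      and their multiples by the imaginary unit.\<close>
    define F where "F = abs_l2 ` E \<union> imul ` abs_l2 ` E"
    have "U \<in> span F" if U: "(U, x *\<^sub>R U) \<in> op_rel" for U
    proof -
      obtain u where u: "u \<in> eigenspace (H_op \<mu>) ?z" "u \<in> L2" "abs_l2 u = U"
        using eigenvector_representative[OF U] by blast
      obtain c where c: "AE t in lborel. u t = (\<Sum>b\<in>E. c b * b t)" using E(3)[OF u(1)] by blast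
      have cb: "(\<lambda>t. c b * b t) \<in> L2" if "b \<in> E" for b using that E(2) L2_mult by blast
      have "U = abs_l2 (\<lambda>t. \<Sum>b\<in>E. c b * b t)"
        unfolding u(3)[symmetric] by (rule abs_l2_cong_AE[OF u(2) L2_sum(1)[OF E(1) cb] c])
      also have "\<dots> = (\<Sum>b\<in>E. abs_l2 (\<lambda>t. c b * b t))" by (rule L2_sum(2)[OF E(1) cb])
      also have "\<dots> = (\<Sum>b\<in>E. Re (c b) *\<^sub>R abs_l2 b + Im (c b) *\<^sub>R imul (abs_l2 b))"
        using E(2) by (intro sum.cong) (auto simp: abs_l2_mult)
      also have "\<dots> \<in> span F"
        by (intro span_sum span_add span_scale span_base) (auto simp: F_def)
      finally show ?thesis .
    qed
    then show ?thesis using E(1) by (intro exI[of _ F]) (auto simp: F_def)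
  qed
  ultimately show ?thesis using d(1) unfolding isolated_iff op.isolated_eigenvalue_def by simp
qed

lemma essential_spectrum_lower_bound:
  assumes "finite E" "0 \<le> C"
    and low: "\<And>f g. ac_pair f g \<Longrightarrow>
      a * (L2_norm f)\<^sup>2 - C * (\<Sum>e\<in>E. (abs_l2 f \<bullet> e)\<^sup>2) \<le> (L2_norm g)\<^sup>2 - (LINT x|\<mu>. (cmod (f x))\<^sup>2)"
    and z: "z \<in> essential_spectrum (H_op \<mu>)"
  shows "a \<le> Re z"
proof (rule ccontr)
  assume "\<not> a \<le> Re z"
  then have "Re z < a" by simp
  have "a * (norm u)\<^sup>2 - C * (\<Sum>e\<in>E. (u \<bullet> e)\<^sup>2) \<le> v \<bullet> u" if uv: "(u, v) \<in> op_rel" for u v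
  proof -
    obtain k where k: "(u, k) \<in> h1_graph" "\<And>q. q \<in> h1_graph \<Longrightarrow> form_r (u, k) q = v \<bullet> fst q"
      using uv op_rel_iff by blast
    obtain f g where fg: "ac_pair f g" "(u, k) = (abs_l2 f, abs_l2 g)" using k(1) by (rule h1_graphE)
    have "v \<bullet> u = (L2_norm g)\<^sup>2 - (LINT x|\<mu>. (cmod (f x))\<^sup>2)"
      using k(2)[OF k(1)] form_r_self[OF fg(1)] fg(2) by simp
    then show ?thesis using low[OF fg(1)] fg(2) abs_l2_norm[OF ac_pairD(1)[OF fg(1)]] by simp
  qed
  then have "op.regular z \<or> op.isolated_eigenvalue z"
    by (rule op.below_essential_spectrum[OF assms(1,2) _ \<open>Re z < a\<close>])
  then have "z \<notin> spectrum (H_op \<mu>) \<or> z \<in> discrete_spectrum (H_op \<mu>)"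
    using isolated_eigenvalue_imp_discrete spectrum_iff by blast
  then show False using z by (simp add: essential_spectrum_def)
qed

text \<open>Weyl vectors are sought for the bounded operator \<open>R\<close>, the inverse of the
  operator shifted by \<open>c\<close>. A small form value becomes a large quadratic value of
  \<open>R\<close> through Cauchy-Schwarz in \<open>form_c\<close>.\<close>

lemma essential_spectrum_upper_bound:
  assumes low: "\<And>F. finite F \<Longrightarrow> \<exists>p\<in>h1_graph. norm (fst p) = 1 \<and> (\<forall>e\<in>F. fst p \<bullet> e = 0) \<and> form_r p p \<le> a"
  shows "\<exists>z\<in>essential_spectrum (H_op \<mu>). Re z \<le> a"
proof -
  define c where "c = B + 1"
  have "\<forall>f. \<exists>p. p \<in> h1_graph \<and> (\<forall>q\<in>h1_graph. form_c p q = f \<bullet> fst q)" using form_c_solve by blast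
  then obtain P where P: "\<And>f. P f \<in> h1_graph" "\<And>f q. q \<in> h1_graph \<Longrightarrow> form_c (P f) q = f \<bullet> fst q" by metis
  define R where "R f = fst (P f)" for f
  have S: "(R f, f - c *\<^sub>R R f) \<in> op_rel" for f
    unfolding R_def c_def by (rule op_rel_resolvent[OF P])
  have sym: "R f \<bullet> g = f \<bullet> R g" for f g
    using op_rel_symmetric[OF S[of f] S[of g]] by (simp add: inner_diff_left inner_diff_right)
  have zero: "u = v" if "\<And>h. u \<bullet> h = v \<bullet> h" for u v :: l2
    using that[of "u - v"] by (metis inner_diff_left inner_eq_zero_iff right_minus_eq)
  have R: "bounded_linear R"
  proof (rule bounded_linear_intro[where K = 2])
    show "R (f + g) = R f + R g" for f g by (rule zero) (simp add: sym inner_add_left)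
    show "R (r *\<^sub>R f) = r *\<^sub>R R f" for r f by (rule zero) (simp add: sym)
    show "norm (R f) \<le> norm f * 2" for f
    proof -
      have n: "norm (R f) \<le> norm (P f)" unfolding R_def using norm_fst_le[of "fst (P f)" "snd (P f)"] by simp
      have "1/2 * (norm (P f))\<^sup>2 \<le> form_c (P f) (P f)" by (rule form_c_bounds[OF P(1)])
      also have "\<dots> = f \<bullet> R f" unfolding R_def by (rule P(2)[OF P(1)])
      also have "\<dots> \<le> norm f * norm (R f)" by (rule norm_cauchy_schwarz)
      also have "\<dots> \<le> norm f * norm (P f)" using n by (rule mult_left_mono) simp
      finally have "norm (P f) * norm (P f) \<le> (norm f * 2) * norm (P f)" by (simp add: power2_eq_square)
      then have "norm (P f) \<le> norm f * 2"
        by (cases "norm (P f) = 0") (auto simp: mult_le_cancel_right)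
      then show ?thesis using n by linarith
    qed
  qed
  \<comment> \<open>The vector that \<open>low\<close> provides for the empty set has a positive
    value of \<open>form_c\<close>, so \<open>1 / (a + c)\<close> is a positive lower bound for
    \<open>R\<close>.\<close>
  have pos: "0 < a + c"
  proof -
    obtain p where p: "p \<in> h1_graph" "norm (fst p) = 1" "form_r p p \<le> a" using low[of "{}"] by auto
    have "1 \<le> norm p" using p(2) norm_fst_le[of "fst p" "snd p"] by simp
    then have "0 < 1/2 * (norm p)\<^sup>2" by auto
    also have "\<dots> \<le> form_c p p" by (rule form_c_bounds[OF p(1)])
    also have "\<dots> \<le> a + c" using p(2,3) by (simp add: form_c_def c_def flip: power2_norm_eq_inner)
    finally show ?thesis .
  qed
  have "\<exists>u. norm u = 1 \<and> (\<forall>e\<in>F. u \<bullet> e = 0) \<and> 1 / (a + c) \<le> R u \<bullet> u" if F: "finite F" for F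
  proof -
    obtain p where p: "p \<in> h1_graph" "norm (fst p) = 1" "\<forall>e\<in>F. fst p \<bullet> e = 0" "form_r p p \<le> a"
      using low[OF F] by blast
    define u where "u = fst p"
    have u: "u \<bullet> u = 1" using p(2) by (simp add: u_def flip: power2_norm_eq_inner)
    have cp: "form_c p p \<le> a + c" using p(4) u by (simp add: form_c_def c_def u_def)
    \<comment> \<open>By the choice of \<open>P\<close> this pairing is
      \<open>u \<bullet> u\<close>, so 1 is at most the product of \<open>R u \<bullet> u\<close>
      and \<open>form_c p p\<close>.\<close>
    have "form_c (P u) p = 1" using P(2)[OF p(1), of u] u by (simp add: u_def)
    then have "1 \<le> form_c (P u) (P u) * form_c p p" using form_c.cauchy_schwarz[OF P(1) p(1), of u] by simp
    also have "form_c (P u) (P u) = R u \<bullet> u" using P(2)[OF P(1), of u u] by (simp add: R_def inner_commute)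
    also have "(R u \<bullet> u) * form_c p p \<le> (R u \<bullet> u) * (a + c)"
      using cp form_c.nonneg[OF P(1), of u] P(2)[OF P(1), of u u]
      by (intro mult_left_mono) (simp_all add: R_def inner_commute)
    finally have "1 / (a + c) \<le> R u \<bullet> u" using pos by (simp add: pos_divide_le_eq)
    then show ?thesis using p(2,3) unfolding u_def by blast
  qed
  then obtain x where x: "x \<le> 1 / (1 / (a + c)) - c" "\<not> op.regular (complex_of_real x)"
      "\<not> op.isolated_eigenvalue (complex_of_real x)"
    using op.essential_spectrum_point[OF R sym S, of "1 / (a + c)"] pos by auto
  have "complex_of_real x \<in> essential_spectrum (H_op \<mu>)"
    using x(2,3) discrete_imp_isolated_eigenvalue by (auto simp: essential_spectrum_def spectrum_iff)
  then show ?thesis using x(1) by (intro bexI[of _ "complex_of_real x"]) auto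
qed

end

section \<open>Upper bound from test functions with disjoint supports\<close>

context form_bounded_measure
begin

text \<open>No cross terms appear in the norm or in the form, so every combination inherits the
  bound of the single functions, and enough of them leave room for orthogonality to a given finite
  set.\<close>

lemma essential_spectrum_upper_bound_orthogonal:
  assumes p: "\<And>i::nat. p i \<in> h1_graph" "\<And>i. fst (p i) \<noteq> 0" "\<And>i. form_r (p i) (p i) \<le> a * (norm (fst (p i)))\<^sup>2"
    and orth: "\<And>i j. i \<noteq> j \<Longrightarrow> fst (p i) \<bullet> fst (p j) = 0" "\<And>i j. i \<noteq> j \<Longrightarrow> form_r (p i) (p j) = 0"
  shows "\<exists>z\<in>essential_spectrum (H_op \<mu>). Re z \<le> a"
proof (rule essential_spectrum_upper_bound)
  fix F :: "l2 set" assume F: "finite F"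
  \<comment> \<open>\<open>{..card F}\<close> has one element more than \<open>F\<close>.\<close>
  define I where "I = {..card F}"
  have I: "finite I" "card F < card I" by (auto simp: I_def)
  obtain c where c: "\<exists>i\<in>I. c i \<noteq> 0" "\<forall>e\<in>F. (\<Sum>i\<in>I. c i *\<^sub>R fst (p i)) \<bullet> e = 0"
    using orthogonal_combination[OF F I, of "\<lambda>i. fst (p i)"] by blast
  define s where "s = (\<Sum>i\<in>I. c i *\<^sub>R p i)"
  have sG: "(\<Sum>i\<in>J. c i *\<^sub>R p i) \<in> h1_graph" for J
    using p(1) by (intro subspace_sum[OF subspace_h1_graph] subspace_scale[OF subspace_h1_graph])
  have fst_s: "fst s = (\<Sum>i\<in>I. c i *\<^sub>R fst (p i))" by (simp add: s_def fst_sum)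
  have lin: "form_r (\<Sum>i\<in>J. c i *\<^sub>R p i) q = (\<Sum>i\<in>J. c i * form_r (p i) q)" if "finite J" "q \<in> h1_graph" for J q
    using that(1)
  proof (induction J rule: finite_induct)
    case empty
    then show ?case using form_r_scale[OF p(1), of 0 0 q] by simp
  next
    case (insert j J)
    then show ?case
      using form_r_add[OF subspace_scale[OF subspace_h1_graph p(1)] sG that(2)] form_r_scale[OF p(1)] by simp
  qed
  have "form_r s s = (\<Sum>i\<in>I. c i * form_r (p i) s)" unfolding s_def by (rule lin[OF I(1) sG])
  also have "\<dots> = (\<Sum>i\<in>I. (c i)\<^sup>2 * form_r (p i) (p i))"
  proof (rule sum.cong[OF refl])
    fix i assume i: "i \<in> I"
    have "form_r (p i) s = form_r s (p i)" by (rule form_r_sym)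
    also have "\<dots> = (\<Sum>j\<in>I. c j * form_r (p j) (p i))" unfolding s_def by (rule lin[OF I(1) p(1)])
    also have "\<dots> = (\<Sum>j\<in>I. if j = i then c i * form_r (p i) (p i) else 0)"
      using orth(2) by (intro sum.cong) auto
    also have "\<dots> = c i * form_r (p i) (p i)" using i I(1) by simp
    finally show "c i * form_r (p i) s = (c i)\<^sup>2 * form_r (p i) (p i)" by (simp add: power2_eq_square)
  qed
  finally have form_s: "form_r s s = (\<Sum>i\<in>I. (c i)\<^sup>2 * form_r (p i) (p i))" .
  have "fst s \<bullet> fst s = (\<Sum>i\<in>I. c i * (fst (p i) \<bullet> fst s))"
    by (subst (1) fst_s) (simp add: inner_sum_left)
  also have "\<dots> = (\<Sum>i\<in>I. (c i)\<^sup>2 * (norm (fst (p i)))\<^sup>2)"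
  proof (rule sum.cong[OF refl])
    fix i assume i: "i \<in> I"
    have "fst (p i) \<bullet> fst s = (\<Sum>j\<in>I. c j * (fst (p i) \<bullet> fst (p j)))"
      unfolding fst_s by (simp add: inner_sum_right)
    also have "\<dots> = (\<Sum>j\<in>I. if j = i then c i * (fst (p i) \<bullet> fst (p i)) else 0)"
      using orth(1) by (intro sum.cong) auto
    also have "\<dots> = c i * (norm (fst (p i)))\<^sup>2" using i I(1) by (simp add: power2_norm_eq_inner)
    finally show "c i * (fst (p i) \<bullet> fst s) = (c i)\<^sup>2 * (norm (fst (p i)))\<^sup>2" by (simp add: power2_eq_square)
  qed
  finally have norm_s: "(norm (fst s))\<^sup>2 = (\<Sum>i\<in>I. (c i)\<^sup>2 * (norm (fst (p i)))\<^sup>2)"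
    by (simp add: power2_norm_eq_inner)
  obtain k where k: "k \<in> I" "c k \<noteq> 0" using c(1) by blast
  have "0 < (c k)\<^sup>2 * (norm (fst (p k)))\<^sup>2" using k p(2)[of k] by simp
  also have "\<dots> \<le> (norm (fst s))\<^sup>2"
    unfolding norm_s using k I(1) by (intro member_le_sum) auto
  finally have n: "norm (fst s) > 0" by auto
  have le: "form_r s s \<le> a * (norm (fst s))\<^sup>2"
    unfolding form_s norm_s sum_distrib_left
  proof (rule sum_mono)
    fix i
    have "(c i)\<^sup>2 * form_r (p i) (p i) \<le> (c i)\<^sup>2 * (a * (norm (fst (p i)))\<^sup>2)"
      by (rule mult_left_mono[OF p(3)]) simp
    then show "(c i)\<^sup>2 * form_r (p i) (p i) \<le> a * ((c i)\<^sup>2 * (norm (fst (p i)))\<^sup>2)" by (simp only: mult.left_commute)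
  qed
  define t where "t = inverse (norm (fst s))"
  have ts: "t *\<^sub>R s \<in> h1_graph" unfolding s_def by (rule subspace_scale[OF subspace_h1_graph sG])
  have "form_r (t *\<^sub>R s) (t *\<^sub>R s) = t\<^sup>2 * form_r s s"
  proof -
    have sI: "s \<in> h1_graph" unfolding s_def by (rule sG)
    have "form_r (t *\<^sub>R s) (t *\<^sub>R s) = t * form_r s (t *\<^sub>R s)" by (rule form_r_scale[OF sI])
    also have "form_r s (t *\<^sub>R s) = form_r (t *\<^sub>R s) s" by (rule form_r_sym)
    also have "\<dots> = t * form_r s s" by (rule form_r_scale[OF sI])
    finally show ?thesis by (simp add: power2_eq_square)
  qed
  also have "\<dots> \<le> t\<^sup>2 * (a * (norm (fst s))\<^sup>2)" by (rule mult_left_mono[OF le]) simp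
  also have "\<dots> = a" using n by (simp add: t_def power2_eq_square field_simps)
  finally have "form_r (t *\<^sub>R s) (t *\<^sub>R s) \<le> a" .
  moreover have "norm (fst (t *\<^sub>R s)) = 1" using n by (simp add: t_def)
  moreover have "\<forall>e\<in>F. fst (t *\<^sub>R s) \<bullet> e = 0" using c(2) by (simp add: fst_s)
  ultimately show "\<exists>p\<in>h1_graph. norm (fst p) = 1 \<and> (\<forall>e\<in>F. fst p \<bullet> e = 0) \<and> form_r p p \<le> a"
    using ts by blast
qed

end

lemma tent_le: "tent x \<le> 2"
  by (auto simp: tent_def max_def)

text \<open>With ramps of length \<open>3 * d\<close> the final estimate needs no more about \<open>\<pi>\<close> than \<open>2 \<le> \<pi>\<close>.\<close>

lemma plateau_function:
  fixes x d :: real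
  assumes d: "d > 0"
  shows "\<exists>f g. ac_pair f g \<and> (\<forall>y. y \<notin> {x - 7/2 * d..x + 7/2 * d} \<longrightarrow> f y = 0 \<and> g y = 0) \<and>
    (\<forall>y\<in>{x - d/2..x + d/2}. f y = 1) \<and>
    d \<le> (L2_norm f)\<^sup>2 \<and> (L2_norm f)\<^sup>2 \<le> 7 * d \<and> (L2_norm g)\<^sup>2 \<le> 8 / (3 * d)"
proof -
  define w where "w = 3 * d"
  define p where "p = x - 7/2 * d"
  define q where "q = x + d/2"
  have w: "w > 0" using d by (simp add: w_def)
  define s where "s c y = (y - c) / w" for c y
  define F where "F y = smooth_step (s p y) - smooth_step (s q y)" for y
  define G where "G y = tent (s p y) / w - tent (s q y) / w" for y
  have der: "(F has_real_derivative G y) (at y)" for y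
  proof -
    have *: "((\<lambda>y. smooth_step (s c y)) has_real_derivative tent (s c y) * ((1 - 0) / w)) (at y)" for c
      unfolding s_def by (rule DERIV_chain'[OF DERIV_cdivide[OF DERIV_diff[OF DERIV_ident DERIV_const]] smooth_step_deriv])
    show ?thesis unfolding F_def[abs_def] G_def using DERIV_diff[OF *[of p] *[of q]] by simp
  qed
  have contG: "continuous_on UNIV G"
    unfolding G_def[abs_def] s_def using w
    by (intro continuous_intros continuous_on_compose2[OF tent_continuous[of UNIV]]) auto
  have contF: "continuous_on UNIV F"
    using der DERIV_isCont continuous_at_imp_continuous_on by blast
  have sp: "s c y \<le> 0 \<longleftrightarrow> y \<le> c" "1 \<le> s c y \<longleftrightarrow> c + w \<le> y" "0 \<le> s c y \<longleftrightarrow> c \<le> y" "s c y \<le> 1 \<longleftrightarrow> y \<le> c + w" for c y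
    using w by (auto simp: s_def divide_le_0_iff zero_le_divide_iff pos_le_divide_eq pos_divide_le_eq)
  have pq: "p + w = x - d/2" "q + w = x + 7/2 * d" "p + w \<le> q" "p \<le> q"
    using d by (auto simp: p_def q_def w_def)
  have range: "0 \<le> F y" "F y \<le> 1" for y
  proof -
    have "s q y \<le> s p y" using pq w by (simp add: s_def divide_right_mono)
    then show "0 \<le> F y" using smooth_step_mono by (simp add: F_def)
    show "F y \<le> 1" using smooth_step_range[of "s p y"] smooth_step_range[of "s q y"] by (simp add: F_def)
  qed
  have F1: "F y = 1" if "y \<in> {x - d/2..x + d/2}" for y
  proof -
    have "1 \<le> s p y" "s q y \<le> 0" using that pq by (auto simp: sp q_def)
    then show ?thesis by (simp add: F_def smooth_step_left smooth_step_right)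
  qed
  have F0: "F y = 0" if "y \<notin> {x - 7/2 * d..x + 7/2 * d}" for y
  proof (cases "y < p")
    case True
    then have "s p y \<le> 0" "s q y \<le> 0" using pq by (auto simp: sp)
    then show ?thesis by (simp add: F_def smooth_step_left)
  next
    case False
    then have "q + w \<le> y" using that pq(2) by (auto simp: p_def)
    then have "1 \<le> s p y" "1 \<le> s q y" using pq w by (auto simp: sp)
    then show ?thesis by (simp add: F_def smooth_step_right)
  qed
  have tent0: "tent (s c y) = 0" if "y \<notin> {c..c + w}" for c y
    using that by (intro tent_outside) (auto simp: sp)
  \<comment> \<open>The slope of a ramp is at most \<open>2 / w\<close>. Two ramps of length
    \<open>w\<close> thus contribute at most \<open>8 / w\<close> to the energy, which is
    \<open>8 / (3 * d)\<close>.\<close>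
  have Gsq: "(G y)\<^sup>2 \<le> 4 / w\<^sup>2 * (indicator {p..p + w} y + indicator {q..q + w} y)" for y
  proof -
    have t: "0 \<le> tent (s c y) / w" "tent (s c y) / w \<le> 2 / w" for c
      using tent_nonneg[of "s c y"] tent_le[of "s c y"] w by (auto simp: divide_right_mono)
    have "\<bar>G y\<bar> \<le> 2 / w" using t[of p] t[of q] unfolding G_def by linarith
    then have G4: "(G y)\<^sup>2 \<le> 4 / w\<^sup>2" using power_mono[of "\<bar>G y\<bar>" "2 / w" 2] by (simp add: power_divide)
    show ?thesis
    proof (cases "y \<in> {p..p + w} \<or> y \<in> {q..q + w}")
      case True
      then have "1 \<le> indicat_real {p..p + w} y + indicat_real {q..q + w} y" by (auto simp: indicator_def)
      then have "4 / w\<^sup>2 * 1 \<le> 4 / w\<^sup>2 * (indicat_real {p..p + w} y + indicat_real {q..q + w} y)"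
        by (intro mult_left_mono) auto
      then show ?thesis using G4 by linarith
    next
      case False
      then have "G y = 0" using tent0[of y p] tent0[of y q] by (simp add: G_def)
      then show ?thesis by simp
    qed
  qed
  have G0: "G y = 0" if "y \<notin> {x - 7/2 * d..x + 7/2 * d}" for y
  proof -
    have "y \<notin> {p..p + w}" "y \<notin> {q..q + w}" using that pq by (auto simp: p_def)
    then show ?thesis using tent0[of y p] tent0[of y q] by (simp add: G_def)
  qed
  define f where "f y = complex_of_real (F y)" for y
  define g where "g y = complex_of_real (G y)" for y
  have meas: "f \<in> borel_measurable borel" "g \<in> borel_measurable borel"
    unfolding f_def g_def using contF contG by (auto intro!: borel_measurable_continuous_onI continuous_intros)
  have ind: "integrable lborel (indicat_real {a..b})" for a b :: real
    by (intro integrable_real_indicator emeasure_compact_finite) auto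
  have fle: "(cmod (f y))\<^sup>2 \<le> indicator {x - 7/2 * d..x + 7/2 * d} y" for y
  proof (cases "y \<in> {x - 7/2 * d..x + 7/2 * d}")
    case True
    then show ?thesis using range[of y] by (simp add: f_def power_le_one)
  qed (use F0 in \<open>simp add: f_def\<close>)
  have fge: "indicator {x - d/2..x + d/2} y \<le> (cmod (f y))\<^sup>2" for y
    using F1[of y] by (auto simp: indicator_def f_def)
  have fL: "f \<in> L2" using L2I[OF _ ind fle] meas by simp
  have gle: "(cmod (g y))\<^sup>2 \<le> 4 / w\<^sup>2 * (indicator {p..p + w} y + indicator {q..q + w} y)" for y
    using Gsq[of y] by (simp add: g_def)
  have gi: "integrable lborel (\<lambda>y. 4 / w\<^sup>2 * (indicat_real {p..p + w} y + indicat_real {q..q + w} y))"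
    using ind by simp
  have gL: "g \<in> L2" using L2I[OF _ gi gle] meas by simp
  have ac: "ac_pair f g"
    unfolding ac_pair_def
  proof (intro conjI allI impI fL gL)
    fix a b :: real assume "a \<le> b"
    have "(LINT t|lborel. indicator {a..b} t *\<^sub>R G t) = F b - F a"
    proof (rule integral_FTC_atLeastAtMost[OF \<open>a \<le> b\<close>])
      show "(F has_vector_derivative G y) (at y within {a..b})" for y
        using der has_real_derivative_iff_has_vector_derivative has_vector_derivative_at_within by blast
      show "continuous_on {a..b} G" using contG continuous_on_subset by blast
    qed
    moreover have "(LINT t:{a..b}|lborel. g t) = complex_of_real (LINT t|lborel. indicator {a..b} t *\<^sub>R G t)"
      unfolding set_lebesgue_integral_def g_def integral_complex_of_real[symmetric]
      by (intro Bochner_Integration.integral_cong) (auto simp: scaleR_conv_of_real)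
    ultimately show "f b - f a = (LINT t:{a..b}|lborel. g t)" by (simp add: f_def)
  qed
  have sq: "(L2_norm h)\<^sup>2 = (LINT y|lborel. (cmod (h y))\<^sup>2)" for h
    by (simp add: L2_norm_def)
  have "(L2_norm f)\<^sup>2 \<le> (LINT y|lborel. indicat_real {x - 7/2 * d..x + 7/2 * d} y)"
    unfolding sq by (rule integral_mono[OF L2_integrable[OF fL] ind fle])
  then have "(L2_norm f)\<^sup>2 \<le> 7 * d" using d by simp
  moreover have "(LINT y|lborel. indicat_real {x - d/2..x + d/2} y) \<le> (L2_norm f)\<^sup>2"
    unfolding sq by (rule integral_mono[OF ind L2_integrable[OF fL] fge])
  then have "d \<le> (L2_norm f)\<^sup>2" using d by simp
  moreover have "(L2_norm g)\<^sup>2 \<le> (LINT y|lborel. 4 / w\<^sup>2 * (indicat_real {p..p + w} y + indicat_real {q..q + w} y))"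
    unfolding sq by (rule integral_mono[OF L2_integrable[OF gL] gi gle])
  then have "(L2_norm g)\<^sup>2 \<le> 4 / w\<^sup>2 * (w + w)" using w ind by simp
  then have "(L2_norm g)\<^sup>2 \<le> 8 / (3 * d)" using d by (simp add: w_def field_simps power2_eq_square)
  ultimately show ?thesis
    using ac F0 G0 F1 by (intro exI[of _ f] exI[of _ g]) (simp add: f_def g_def)
qed

context form_bounded_measure
begin

text \<open>The plateau collects the mass \<open>m\<close> and the ramps cost at most
  \<open>8 / (3 * d)\<close>. The squared norm is known only to lie between \<open>d\<close> and
  \<open>7 * d\<close>, and \<open>a\<close> may have either sign, hence the condition for all
  \<open>s\<close> in that range.\<close>

lemma essential_spectrum_upper_bound_plateaus:
  assumes d: "d > 0" and "0 \<le> m"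
    and \<mu>m: "\<And>x. N \<le> x \<Longrightarrow> ennreal m \<le> emeasure \<mu> {x - d/2..x + d/2}"
    and a: "\<And>s. d \<le> s \<Longrightarrow> s \<le> 7 * d \<Longrightarrow> 8 / (3 * d) - m \<le> a * s"
  shows "\<exists>z\<in>essential_spectrum (H_op \<mu>). Re z \<le> a"
proof -
  \<comment> \<open>The spacing \<open>8 * d\<close> exceeds the length \<open>7 * d\<close> of the
    supports.\<close>
  define x where "x i = N + 8 * d * real i" for i :: nat
  have "\<forall>i. \<exists>f g. ac_pair f g \<and> (\<forall>y. y \<notin> {x i - 7/2 * d..x i + 7/2 * d} \<longrightarrow> f y = 0 \<and> g y = 0) \<and>
    (\<forall>y\<in>{x i - d/2..x i + d/2}. f y = 1) \<and>
    d \<le> (L2_norm f)\<^sup>2 \<and> (L2_norm f)\<^sup>2 \<le> 7 * d \<and> (L2_norm g)\<^sup>2 \<le> 8 / (3 * d)"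
    using plateau_function[OF d] by blast
  then obtain f g where fg: "\<And>i. ac_pair (f i) (g i)"
    and out: "\<And>i y. y \<notin> {x i - 7/2 * d..x i + 7/2 * d} \<Longrightarrow> f i y = 0 \<and> g i y = 0"
    and one: "\<And>i y. y \<in> {x i - d/2..x i + d/2} \<Longrightarrow> f i y = 1"
    and nf: "\<And>i. d \<le> (L2_norm (f i))\<^sup>2" "\<And>i. (L2_norm (f i))\<^sup>2 \<le> 7 * d"
    and ng: "\<And>i. (L2_norm (g i))\<^sup>2 \<le> 8 / (3 * d)" by metis
  define p where "p i = (abs_l2 (f i), abs_l2 (g i))" for i
  have L: "f i \<in> L2" "g i \<in> L2" for i using ac_pairD[OF fg] by auto
  have disj: "f i y * cnj (f j y) = 0 \<and> g i y * cnj (g j y) = 0" if "i \<noteq> j" for i j y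
  proof -
    have far: "8 * d \<le> \<bar>x i - x j\<bar>"
    proof -
      have "1 \<le> \<bar>real i - real j\<bar>" using that by linarith
      then have "8 * d * 1 \<le> 8 * d * \<bar>real i - real j\<bar>" using d by (intro mult_left_mono) auto
      also have "\<dots> = \<bar>x i - x j\<bar>" using d by (simp add: x_def abs_mult flip: right_diff_distrib)
      finally show ?thesis by simp
    qed
    have "y \<notin> {x i - 7/2 * d..x i + 7/2 * d} \<or> y \<notin> {x j - 7/2 * d..x j + 7/2 * d}"
      using far d by auto
    then show ?thesis using out[of y i] out[of y j] by auto
  qed
  show ?thesis
  proof (rule essential_spectrum_upper_bound_orthogonal[of p])
    show "p i \<in> h1_graph" for i unfolding p_def by (rule h1_graphI[OF fg])
    have n: "(norm (fst (p i)))\<^sup>2 = (L2_norm (f i))\<^sup>2" for i by (simp add: p_def abs_l2_norm L)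
    show "fst (p i) \<noteq> 0" for i using n[of i] nf(1)[of i] d by auto
    show "form_r (p i) (p i) \<le> a * (norm (fst (p i)))\<^sup>2" for i
    proof -
      have "x i \<ge> N" using d by (simp add: x_def)
      have "ennreal m \<le> emeasure \<mu> {x i - d/2..x i + d/2}" by (rule \<mu>m) fact
      also have "\<dots> = (\<integral>\<^sup>+y. indicator {x i - d/2..x i + d/2} y \<partial>\<mu>)"
        by (rule nn_integral_indicator[symmetric]) (simp add: sets_\<mu>)
      also have "\<dots> \<le> sq_int \<mu> (f i) UNIV"
        unfolding sq_int_def using one[of _ i] by (intro nn_integral_mono) (auto simp: indicator_def)
      also have "\<dots> = ennreal (LINT y|\<mu>. (cmod (f i y))\<^sup>2)" using square_integrable_\<mu>(2)[OF fg] by simp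
      finally have "m \<le> (LINT y|\<mu>. (cmod (f i y))\<^sup>2)" by (simp add: ennreal_le_iff)
      then have "form_r (p i) (p i) \<le> 8 / (3 * d) - m"
        unfolding p_def form_r_self[OF fg] using ng[of i] by linarith
      also have "\<dots> \<le> a * (L2_norm (f i))\<^sup>2" by (rule a[OF nf])
      finally show ?thesis by (simp add: n)
    qed
    fix i j :: nat assume ij: "i \<noteq> j"
    have z: "(\<lambda>y. f i y * cnj (f j y)) = (\<lambda>y. 0)" "(\<lambda>y. g i y * cnj (g j y)) = (\<lambda>y. 0)"
      using disj[OF ij] by blast+
    show "fst (p i) \<bullet> fst (p j) = 0"
      by (simp only: p_def fst_conv abs_l2_inner L L2_inner_def z) simp
    show "form_r (p i) (p j) = 0"
      unfolding p_def form_r_abs[OF fg fg] by (simp only: abs_l2_inner L L2_inner_def z) simp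
  qed
qed

end

section \<open>Lower bound from estimates on cells\<close>

lemma sq_int_Un:
  assumes "sets M = sets borel" "f \<in> borel_measurable borel" "A \<in> sets borel" "A' \<in> sets borel" "A \<inter> A' = {}"
  shows "sq_int M f (A \<union> A') = sq_int M f A + sq_int M f A'"
proof -
  have m: "(\<lambda>x. ennreal ((cmod (f x))\<^sup>2) * indicator D x) \<in> borel_measurable M" if "D \<in> sets borel" for D
    unfolding measurable_cong_sets[OF assms(1) refl] using assms(2) that by measurable
  have "sq_int M f (A \<union> A') = (\<integral>\<^sup>+x. ennreal ((cmod (f x))\<^sup>2) * indicator A x + ennreal ((cmod (f x))\<^sup>2) * indicator A' x \<partial>M)"
    unfolding sq_int_def using assms(5) by (intro nn_integral_cong) (auto simp: indicator_def)
  also have "\<dots> = sq_int M f A + sq_int M f A'"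
    unfolding sq_int_def by (rule nn_integral_add[OF m[OF assms(3)] m[OF assms(4)]])
  finally show ?thesis .
qed

text \<open>A complex functional amounts to two real ones, those of \<open>e\<close> and
  \<open>imul e\<close>, which is the format of the finite rank term in
  \<open>below_essential_spectrum\<close>.\<close>

lemma interval_integral_inner:
  assumes "f \<in> L2" and e_def: "e = abs_l2 (\<lambda>x. indicator {a..<b} x *\<^sub>R (1::complex))"
  shows "(cmod (LINT t:{a..<b}|lborel. f t))\<^sup>2 = (abs_l2 f \<bullet> e)\<^sup>2 + (abs_l2 f \<bullet> imul e)\<^sup>2"
proof -
  let ?i = "\<lambda>x. indicator {a..<b} x *\<^sub>R (1::complex)"
  have i: "L2_inner f ?i = (LINT t:{a..<b}|lborel. f t)"
    unfolding L2_inner_def set_lebesgue_integral_def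
    by (intro Bochner_Integration.integral_cong) (auto simp: indicator_def)
  have "L2_inner f (\<lambda>x. \<i> * ?i x) = (LINT x|lborel. - \<i> * (f x * cnj (?i x)))"
    unfolding L2_inner_def by (intro Bochner_Integration.integral_cong) auto
  also have "\<dots> = - \<i> * L2_inner f ?i" unfolding L2_inner_def by (rule integral_mult_right_zero)
  finally have im: "L2_inner f (\<lambda>x. \<i> * ?i x) = - \<i> * L2_inner f ?i" .
  have "abs_l2 f \<bullet> imul e = Re (L2_inner f (\<lambda>x. \<i> * ?i x))"
    unfolding e_def abs_l2_imul[OF L2_indicator] by (rule abs_l2_inner[OF assms(1) L2_mult[OF L2_indicator]])
  also have "\<dots> = Im (L2_inner f ?i)" unfolding im by simp
  finally have "abs_l2 f \<bullet> imul e = Im (L2_inner f ?i)" .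
  moreover have "abs_l2 f \<bullet> e = Re (L2_inner f ?i)"
    unfolding e_def using assms(1) L2_indicator[of a b] by (simp add: abs_l2_inner)
  ultimately show ?thesis by (simp add: cmod_power2 i)
qed

context form_bounded_measure
begin

text \<open>Each outer cell spends at most the kinetic energy it contains, plus
  \<open>1 / d\<^sup>2\<close> times its share of the norm; \<open>{- L..<L}\<close> spends its own
  energy up to a finite rank term. \<open>L\<close> is a multiple of \<open>d\<close>, so that no
  cell is cut.\<close>

lemma essential_spectrum_lower_bound_intervals:
  assumes fin: "\<And>R. emeasure \<mu> {- R..R} < \<infinity>" and d: "d > 0"
    and small: "\<And>x. N \<le> \<bar>x\<bar> \<Longrightarrow> emeasure \<mu> {x - d/2..x + d/2} \<le> ennreal (1 / (2 * d))"
    and z: "z \<in> essential_spectrum (H_op \<mu>)"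
  shows "- (1 / d\<^sup>2) \<le> Re z"
proof -
  obtain n :: nat where n: "\<bar>N\<bar> / d + 1 < real n" using reals_Archimedean2 by blast
  define K where "K = int n"
  have "0 \<le> \<bar>N\<bar> / d" using d by simp
  then have "\<bar>N\<bar> / d < real n" "0 < real n" using n by linarith+
  then have K: "\<bar>N\<bar> \<le> real_of_int K * d" "K > 0" using d by (auto simp: K_def pos_divide_less_eq)
  define L where "L = real_of_int K * d"
  have L: "L > 0" using K d by (simp add: L_def)
  define m where "m = measure \<mu> {- L..L} + 1"
  have m: "m > 0" by (simp add: m_def add_nonneg_pos)
  have "emeasure \<mu> {x..<y} \<le> ennreal m" if "- L \<le> x" "y \<le> L" for x y
  proof -
    have "emeasure \<mu> {x..<y} \<le> emeasure \<mu> {- L..L}"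
      using that by (intro emeasure_mono) (auto simp: sets_\<mu>)
    also have "\<dots> = ennreal (measure \<mu> {- L..L})" using fin[of L] by (intro emeasure_eq_ennreal_measure) auto
    also have "\<dots> \<le> ennreal m" by (intro ennreal_leI) (simp add: m_def)
    finally show ?thesis .
  qed
  then obtain C E where CE: "0 \<le> C" "finite E" and inner: "\<And>f g. ac_pair f g \<Longrightarrow>
    sq_int \<mu> f {- L..<L} \<le> sq_int lborel g {- L..<L}
      + ennreal (C * (\<Sum>(a, b)\<in>E. (cmod (LINT t:{a..<b}|lborel. f t))\<^sup>2))"
    using local_finite_rank_bound[OF sets_\<mu>, of "- L" L m] m L by auto
  define X where "X k = {real_of_int k * d..<real_of_int (k + 1) * d}" for k
  \<comment> \<open>Index \<open>k\<close> stands for the cell that begins at \<open>k * d\<close>;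
    the one that ends at \<open>- L\<close> has index \<open>- K - 1\<close>, hence the strict
    inequality on the left.\<close>
  define I where "I = {k. k \<ge> K \<or> k < - K}"
  have UN: "(\<Union>k\<in>I. X k) = - {- L..<L}"
  proof (intro set_eqI iffI)
    fix y assume "y \<in> (\<Union>k\<in>I. X k)"
    then obtain k where k: "k \<in> I" "y \<in> X k" by blast
    show "y \<in> - {- L..<L}"
    proof (cases "k \<ge> K")
      case True
      then have "L \<le> real_of_int k * d" unfolding L_def using d by (intro mult_right_mono) auto
      then show ?thesis using k(2) by (auto simp: X_def)
    next
      case False
      then have "k + 1 \<le> - K" using k(1) by (auto simp: I_def)
      then have "real_of_int (k + 1) * d \<le> real_of_int (- K) * d" using d by (intro mult_right_mono) linarith+
      then show ?thesis using k(2) by (auto simp: X_def L_def)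
    qed
  next
    fix y assume y: "y \<in> - {- L..<L}"
    obtain k :: int where k: "y \<in> X k" using cells_cover[OF d] unfolding X_def by blast
    have "k \<in> I"
    proof (rule ccontr)
      assume "k \<notin> I"
      then have "- K \<le> k" "k + 1 \<le> K" by (auto simp: I_def)
      then have "real_of_int (- K) * d \<le> real_of_int k * d" "real_of_int (k + 1) * d \<le> real_of_int K * d"
        using d by (intro mult_right_mono; linarith)+
      then show False using y k by (auto simp: X_def L_def)
    qed
    then show "y \<in> (\<Union>k\<in>I. X k)" using k by blast
  qed
  have outer: "sq_int \<mu> f (- {- L..<L}) \<le> 1 * sq_int lborel g (- {- L..<L}) + ennreal (1 / d\<^sup>2) * sq_int lborel f (- {- L..<L})"
    if fg: "ac_pair f g" for f g
    unfolding UN[symmetric]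
  proof (rule sq_int_tiling[OF sets_\<mu> fg])
    show "disjoint_family_on X I" unfolding X_def by (rule cells_disjoint)
    show "X k \<in> sets borel" for k by (simp add: X_def)
    fix k assume k: "k \<in> I"
    define a b where "a = real_of_int k * d" and "b = real_of_int (k + 1) * d"
    have ab: "X k = {a..<b}" "b - a = d" "b = a + d" by (auto simp: X_def a_def b_def algebra_simps)
    \<comment> \<open>\<open>small\<close> speaks of closed intervals around a centre, and the
      centre of an outer cell lies beyond \<open>N\<close> in modulus.\<close>
    have "N \<le> \<bar>a + d/2\<bar>"
    proof (cases "k \<ge> K")
      case True
      then have "L \<le> a" unfolding L_def a_def using d by (intro mult_right_mono) auto
      then show ?thesis using K d by (auto simp: L_def)
    next
      case False
      then have "k + 1 \<le> - K" using k by (auto simp: I_def)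
      then have "b \<le> real_of_int (- K) * d" unfolding b_def using d by (intro mult_right_mono) linarith+
      then show ?thesis using K d ab by auto
    qed
    then have "emeasure \<mu> {(a + d/2) - d/2..(a + d/2) + d/2} \<le> ennreal (1 / (2 * d))" by (rule small)
    moreover have "emeasure \<mu> {a..<b} \<le> emeasure \<mu> {(a + d/2) - d/2..(a + d/2) + d/2}"
      using ab by (intro emeasure_mono) (auto simp: sets_\<mu>)
    ultimately have "emeasure \<mu> {a..<b} \<le> ennreal (1 / (2 * d))" by (rule order_trans[rotated])
    then have "sq_int \<mu> f {a..<b} \<le> ennreal (2 * (b - a) * (1 / (2 * d))) * sq_int lborel g {a..<b}
        + ennreal (2 * (1 / (2 * d)) / (b - a)) * sq_int lborel f {a..<b}"
      using d ab fg by (intro sq_int_interval sets_\<mu>) auto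
    then show "sq_int \<mu> f (X k) \<le> 1 * sq_int lborel g (X k) + ennreal (1 / d\<^sup>2) * sq_int lborel f (X k)"
      unfolding ab using d by (simp add: power2_eq_square)
  qed simp
  define e where "e ab = abs_l2 (\<lambda>x. indicator {fst ab..<snd ab} x *\<^sub>R (1::complex))" for ab :: "real \<times> real"
  define E' where "E' = e ` E \<union> imul ` e ` E"
  have E': "finite E'" using CE by (simp add: E'_def)
  \<comment> \<open>Rather than tracking which elements of \<open>E'\<close> coincide, each interval
    is estimated by the whole sum over \<open>E'\<close>; this accounts for the factor
    \<open>2 * card E\<close>.\<close>
  define C' where "C' = C * (2 * real (card E))"
  have C': "0 \<le> C'" using CE by (simp add: C'_def)
  show ?thesis
  proof (rule essential_spectrum_lower_bound[OF E' C' _ z])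
    fix f g assume fg: "ac_pair f g"
    define S where "S = (\<Sum>(a, b)\<in>E. (cmod (LINT t:{a..<b}|lborel. f t))\<^sup>2)"
    define T where "T = (\<Sum>h\<in>E'. (abs_l2 f \<bullet> h)\<^sup>2)"
    have "S \<le> (\<Sum>ab\<in>E. 2 * T)"
      unfolding S_def
    proof (rule sum_mono)
      fix ab assume ab: "ab \<in> E"
      have "(abs_l2 f \<bullet> e ab)\<^sup>2 \<le> T" "(abs_l2 f \<bullet> imul (e ab))\<^sup>2 \<le> T"
        unfolding T_def using ab E' by (auto intro!: member_le_sum simp: E'_def)
      then show "(case ab of (a, b) \<Rightarrow> (cmod (LINT t:{a..<b}|lborel. f t))\<^sup>2) \<le> 2 * T"
        using interval_integral_inner[OF ac_pairD(1)[OF fg] e_def[of ab]]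
        by (simp add: split_beta)
    qed
    then have "S \<le> 2 * real (card E) * T" by (simp add: mult_ac)
    from mult_left_mono[OF this CE(1)] have S: "C * S \<le> C' * T" by (simp add: C'_def mult_ac)
    have S0: "0 \<le> S" unfolding S_def by (intro sum_nonneg) auto
    have fgm: "f \<in> borel_measurable borel" "g \<in> borel_measurable borel" using ac_pairD[OF fg] by auto
    have split: "sq_int M h UNIV = sq_int M h (- {- L..<L}) + sq_int M h {- L..<L}"
      if "sets M = sets borel" "h \<in> borel_measurable borel" for M h
      using sq_int_Un[OF that, of "- {- L..<L}" "{- L..<L}"] by (simp add: Compl_partition2)
    have "ennreal (LINT x|\<mu>. (cmod (f x))\<^sup>2) = sq_int \<mu> f (- {- L..<L}) + sq_int \<mu> f {- L..<L}"
      unfolding square_integrable_\<mu>(2)[OF fg] by (rule split[OF sets_\<mu> fgm(1)])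
    also have "\<dots> \<le> (sq_int lborel g (- {- L..<L}) + ennreal (1 / d\<^sup>2) * sq_int lborel f (- {- L..<L}))
        + (sq_int lborel g {- L..<L} + ennreal (C * S))"
      using outer[OF fg] inner[OF fg] unfolding S_def by (intro add_mono) simp_all
    also have "\<dots> \<le> (sq_int lborel g (- {- L..<L}) + ennreal (1 / d\<^sup>2) * sq_int lborel f UNIV)
        + (sq_int lborel g {- L..<L} + ennreal (C * S))"
      by (intro add_mono mult_left_mono order_refl sq_int_mono) auto
    also have "\<dots> = sq_int lborel g UNIV + ennreal (1 / d\<^sup>2) * sq_int lborel f UNIV + ennreal (C * S)"
      using split[OF sets_lborel fgm(2)] by (simp add: ac_simps)
    also have "\<dots> = ennreal ((L2_norm g)\<^sup>2 + r * (L2_norm f)\<^sup>2 + C * S)" if "r = 1 / d\<^sup>2" for r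
    proof -
      have "0 \<le> r" using that by simp
      then show ?thesis
        unfolding that[symmetric] using ac_pairD[OF fg] CE(1) S0
        by (simp add: sq_int_lborel_UNIV ennreal_mult ennreal_plus)
    qed
    finally have le: "ennreal (LINT x|\<mu>. (cmod (f x))\<^sup>2) \<le> ennreal ((L2_norm g)\<^sup>2 + 1 / d\<^sup>2 * (L2_norm f)\<^sup>2 + C * S)"
      by blast
    have "(LINT x|\<mu>. (cmod (f x))\<^sup>2) \<le> (L2_norm g)\<^sup>2 + 1 / d\<^sup>2 * (L2_norm f)\<^sup>2 + C * S"
      using le CE(1) S0 by (subst (asm) ennreal_le_iff) auto
    then show "- (1 / d\<^sup>2) * (L2_norm f)\<^sup>2 - C' * (\<Sum>h\<in>E'. (abs_l2 f \<bullet> h)\<^sup>2) \<le> (L2_norm g)\<^sup>2 - (LINT x|\<mu>. (cmod (f x))\<^sup>2)"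
      using S unfolding T_def[symmetric] by linarith
  qed
qed

end

subsection \<open>The Otelbaev function\<close>

lemma otelbaev_nonneg: "0 \<le> otelbaev \<mu> \<alpha> x"
  unfolding otelbaev_def by (rule Inf_greatest) auto

text \<open>The infimum supplies an admissible \<open>d'\<close> longer than \<open>d\<close>.
  Shrinking the interval lowers its mass and raises the threshold, so admissibility passes to
  \<open>d\<close>.\<close>

lemma otelbaev_less_imp:
  assumes "otelbaev \<mu> \<alpha> x < ereal (1 / d\<^sup>2)" "d > 0" "\<alpha> > 0" "sets \<mu> = sets borel"
  shows "emeasure \<mu> {x - d/2..x + d/2} \<le> ennreal (1 / (\<alpha> * d))"
proof -
  obtain d' where d': "d' > 0" "emeasure \<mu> {x - d'/2..x + d'/2} < ennreal (1 / (\<alpha> * d'))" "1 / d'\<^sup>2 < 1 / d\<^sup>2"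
    using assms(1) unfolding otelbaev_def Inf_less_iff by auto
  have "d\<^sup>2 < d'\<^sup>2" using d'(1,3) assms(2) by (simp add: divide_less_eq field_simps)
  then have dd: "d < d'" using d'(1) by (simp add: power_less_imp_less_base)
  have "emeasure \<mu> {x - d/2..x + d/2} \<le> emeasure \<mu> {x - d'/2..x + d'/2}"
    using dd assms(4) by (intro emeasure_mono) auto
  also have "\<dots> \<le> ennreal (1 / (\<alpha> * d'))" using d'(2) by simp
  also have "\<dots> \<le> ennreal (1 / (\<alpha> * d))"
    using dd assms(2,3) by (intro ennreal_leI divide_left_mono mult_left_mono mult_pos_pos) auto
  finally show ?thesis .
qed

lemma less_otelbaev_imp:
  assumes "ereal (1 / d\<^sup>2) < otelbaev \<mu> \<alpha> x" "d > 0"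
  shows "ennreal (1 / (\<alpha> * d)) \<le> emeasure \<mu> {x - d/2..x + d/2}"
proof (rule ccontr)
  assume "\<not> ?thesis"
  then have "otelbaev \<mu> \<alpha> x \<le> ereal (1 / d\<^sup>2)"
    unfolding otelbaev_def using assms(2) by (intro Inf_lower) (auto simp: not_le)
  then show False using assms(1) by simp
qed

theorem corollary4p14:
  fixes \<mu> :: "real measure" and \<alpha> :: real and \<Lambda> Q\<^sub>1 Q\<^sub>2 :: ereal
  assumes "radon_measure \<mu>"
    and "brinck \<mu>"
    and "\<Lambda> = inf_ess (H_op \<mu>)"
    and "\<alpha> = inverse (pi\<^sup>2 + 3 / 4)"
    and "Q\<^sub>1 = Limsup at_infinity (otelbaev \<mu> 2)"
    and "Q\<^sub>2 = Liminf at_infinity (otelbaev \<mu> \<alpha>)"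
  shows "- (4 * Q\<^sub>1) \<le> \<Lambda> \<and> \<Lambda> \<le> - (ereal (1 / 4) * Q\<^sub>2)"
proof
  have sets: "sets \<mu> = sets borel" using assms(1) unfolding radon_measure_def by blast
  have fin: "emeasure \<mu> {- R..R} < \<infinity>" for R
    using assms(1) compact_Icc[of "- R" R] unfolding radon_measure_def by blast
  obtain B where "form_bounded_measure \<mu> B"
    using brinck_form_bound[OF sets assms(2)] sets unfolding form_bounded_measure_def by blast
  then interpret form_bounded_measure \<mu> B .
  show "- (4 * Q\<^sub>1) \<le> \<Lambda>"
    unfolding assms(3) inf_ess_def
  proof (rule INF_greatest)
    fix z assume z: "z \<in> essential_spectrum (H_op \<mu>)"
    show "- (4 * Q\<^sub>1) \<le> ereal (Re z)"
    proof (rule ccontr)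
      assume "\<not> ?thesis"
      then have "Q\<^sub>1 < ereal (- Re z / 4)" by (cases Q\<^sub>1) auto
      define t where "t = - Re z / 4"
      have "\<forall>\<^sub>F x in at_infinity. otelbaev \<mu> 2 x < ereal t"
        using \<open>Q\<^sub>1 < ereal (- Re z / 4)\<close> unfolding assms(5) t_def by (rule Limsup_lessD)
      then obtain N where N: "\<And>x. N \<le> \<bar>x\<bar> \<Longrightarrow> otelbaev \<mu> 2 x < ereal t"
        unfolding eventually_at_infinity by auto
      have "otelbaev \<mu> 2 N < ereal t" by (rule N) simp
      \<comment> \<open>The strict inequality above a nonnegative function excludes
        \<open>t = 0\<close>, so that a length \<open>d\<close> can be chosen.\<close>
      then have t: "t > 0" using otelbaev_nonneg[of \<mu> 2 N] by (metis ereal_less(2) le_less_trans)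
      define d where "d = 1 / sqrt t"
      have d: "d > 0" "1 / d\<^sup>2 = t" using t by (auto simp: d_def power_divide)
      \<comment> \<open>With \<open>Re z = - 4 * t\<close> this reads
        \<open>- t \<le> - 4 * t\<close>, which contradicts \<open>t > 0\<close>.\<close>
      have "- (1 / d\<^sup>2) \<le> Re z"
      proof (rule essential_spectrum_lower_bound_intervals[OF fin d(1) _ z])
        fix x assume "N \<le> \<bar>x\<bar>"
        then show "emeasure \<mu> {x - d/2..x + d/2} \<le> ennreal (1 / (2 * d))"
          using N d sets by (intro otelbaev_less_imp) auto
      qed
      then show False using d(2) t by (simp add: t_def)
    qed
  qed
  have upper: "\<Lambda> \<le> ereal a" if "\<exists>z\<in>essential_spectrum (H_op \<mu>). Re z \<le> a" for a
    unfolding assms(3) inf_ess_def using that by (auto intro: INF_lower2)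
  show "\<Lambda> \<le> - (ereal (1 / 4) * Q\<^sub>2)"
  \<comment> \<open>Approximation from above treats finite and infinite \<open>Q\<^sub>2\<close>
    alike.\<close>
  proof (rule dense_ge)
    fix y assume y: "- (ereal (1 / 4) * Q\<^sub>2) < y"
    show "\<Lambda> \<le> y"
    proof (cases y)
      case (real a)
      show ?thesis
      proof (cases "a > 0")
        case True
        \<comment> \<open>This case works with \<open>m = 0\<close>: a long plateau has small
          energy, and \<open>8 / (3 * d) = a * d\<close> makes the quotient of form and squared norm
          at most \<open>a\<close>.\<close>
        define d where "d = sqrt (8 / (3 * a))"
        have d: "d > 0" "d\<^sup>2 = 8 / (3 * a)" using True by (auto simp: d_def)
        have "8 / (3 * d) = a * d" using d True by (simp add: field_simps power2_eq_square)
        then have "\<exists>z\<in>essential_spectrum (H_op \<mu>). Re z \<le> a"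
          using d(1) True by (intro essential_spectrum_upper_bound_plateaus[of d 0 0]) auto
        then show ?thesis unfolding real by (rule upper)
      next
        case False
        have "ereal (- 4 * a) < Q\<^sub>2" using y unfolding real by (cases Q\<^sub>2) auto
        \<comment> \<open>Since \<open>a \<le> 0\<close>, such a \<open>q\<close> is positive and
          determines a length.\<close>
        then obtain q where q: "- 4 * a < q" "ereal q < Q\<^sub>2" using ereal_dense2 by fastforce
        have q0: "q > 0" using q(1) False by simp
        have "\<forall>\<^sub>F x in at_infinity. ereal q < otelbaev \<mu> \<alpha> x"
          using q(2) unfolding assms(6) by (rule less_LiminfD)
        then obtain N where N: "\<And>x. N \<le> \<bar>x\<bar> \<Longrightarrow> ereal q < otelbaev \<mu> \<alpha> x"
          unfolding eventually_at_infinity by auto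
        define d where "d = 1 / sqrt q"
        have d: "d > 0" "1 / d\<^sup>2 = q" using q0 by (auto simp: d_def power_divide)
        define m where "m = 1 / (\<alpha> * d)"
        \<comment> \<open>Squaring \<open>2 \<le> pi\<close> shows that \<open>1 / \<alpha>\<close>
          is at least \<open>4 + 3/4 = 19/4\<close>.\<close>
        have "2\<^sup>2 \<le> pi\<^sup>2" using pi_ge_two by (intro power_mono) auto
        then have m: "19 / 4 / d \<le> m"
          unfolding m_def assms(4) using d(1) by (simp add: field_simps)
        have "\<exists>z\<in>essential_spectrum (H_op \<mu>). Re z \<le> - (1 / (4 * d\<^sup>2))"
        proof (rule essential_spectrum_upper_bound_plateaus[OF d(1), of m N])
          show "0 \<le> m" using m d(1) by (smt (verit) divide_pos_pos)
          show "ennreal m \<le> emeasure \<mu> {x - d/2..x + d/2}" if "N \<le> x" for x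
            unfolding m_def using N[of x] that d by (intro less_otelbaev_imp) auto
          fix s assume s: "d \<le> s" "s \<le> 7 * d"
          \<comment> \<open>The target value is negative, so the largest squared norm
            \<open>7 * d\<close> is the worst case: in units of \<open>1 / d\<close> the inequality
            is \<open>8/3 - 19/4 = -25/12 \<le> -7/4\<close>.\<close>
          have "8 / (3 * d) - m \<le> 8 / (3 * d) - 19 / 4 / d" using m by simp
          also have "\<dots> \<le> - (1 / (4 * d\<^sup>2)) * (7 * d)" using d(1) by (simp add: field_simps power2_eq_square)
          also have "\<dots> \<le> - (1 / (4 * d\<^sup>2)) * s" using s by (intro mult_left_mono_neg) auto
          finally show "8 / (3 * d) - m \<le> - (1 / (4 * d\<^sup>2)) * s" .
        qed
        then have "\<Lambda> \<le> ereal (- (1 / (4 * d\<^sup>2)))" by (rule upper)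
        also have "- (1 / (4 * d\<^sup>2)) = - (q / 4)" using d(2) by (simp add: field_simps)
        also have "ereal (- (q / 4)) \<le> y" unfolding real using q(1) by simp
        finally show ?thesis .
      qed
    qed (use y in auto)
  qed
qed

end
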